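(* Let $\Omega\subset\mathbb{R}^2$ be a strictly convex planar domain with smooth ($C^\infty$) boundary, and let $\beta_1,\beta_3$ be the coefficients of the formal Taylor expansion $\beta(\omega)\sim\sum_{k=0}^\infty\beta_k\frac{\omega^k}{k!}$ at $\omega=0$ of Mather's $\beta$-function of the billiard in $\Omega$. Then $$\beta_3+\pi^2\beta_1\le 0,$$ and equality holds if and only if $\Omega$ is a disc.
   Context: Billiard. $\Omega$ is a strictly convex planar domain with $C^\infty$ boundary (curvature $k>0$ everywhere) of length $\ell_0$, $\gamma$ is a positively oriented arc-length parametrization of $\partial\Omega$, extended $\ell_0$-periodically to $\mathbb{R}$. A point mass moves with unit speed along straight segments in $\Omega$ and reflects at the boundary with angle of incidence equal to angle of reflection. The billiard map is a twist map with generating function $h(s,s')=-\|\gamma(s)-\gamma(s')\|$ (minus the Euclidean distance), for lifts $s\le s'\le s+\ell_0$ of consecutive impact points. Rotation number. A billiard orbit with lifted impact points $(s_i)_{i\in\mathbb{Z}}$ has rotation number $\omega=\lim_{i\to\pm\infty}\frac{s_i}{i\,\ell_0}$ if the limit exists; for a periodic orbit this is $p/q$ with $p$ the winding number around $\partial\Omega$ and $q$ the number of reflections. $\beta$-function. An orbit $(s_i)$ is minimal if every finite segment of it minimizes $\sum h(s_i,s_{i+1})$ among sequences with the same endpoints. Minimal orbits exist for every rotation number, and $$\beta(\omega):=\lim_{N\to\infty}\frac1{2N}\sum_{i=-N}^{N-1}h(s_i,s_{i+1})$$ for any minimal orbit of rotation number $\omega$ (the value does not depend on the choice). Thus, for $p/q\in(0,1/2]$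 in lowest terms, $\beta(p/q)=-\frac1q\max\{\text{length of periodic billiard orbits of rotation number }p/q\}$, and $\beta(0)=0$. Formal Taylor expansion. A caustic is a smooth convex closed curve in $\Omega$ such that a trajectory tangent to it remains tangent to it after each reflection; its rotation number is that of the trajectories tangent to it. By Lazutkin's theorem, the rotation numbers for which a caustic exists accumulate at $0$. "$\beta(\omega)\sim\sum_k\beta_k\omega^k/k!$" means that for every $n$, $\beta(\omega)=\sum_{k=0}^n\beta_k\frac{\omega^k}{k!}+O(\omega^{n+1})$ as $\omega\to0^+$ along rotation numbers $\omega$ for which a caustic exists. *)

theory Defs
  imports "HOL-Analysis.Analysis" "HOL-Library.Landau_Symbols"
begin

definition curve_deriv :: "(real \<Rightarrow> real^2) \<Rightarrow> real \<Rightarrow> real^2" where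
  "curve_deriv c t = vector_derivative c (at t)"

definition smooth_curve :: "(real \<Rightarrow> real^2) \<Rightarrow> bool" where
  "smooth_curve c \<longleftrightarrow> (\<forall>n t. (curve_deriv ^^ n) c differentiable (at t))"

definition cross2 :: "real^2 \<Rightarrow> real^2 \<Rightarrow> real" where
  "cross2 u v = u $ 1 * v $ 2 - u $ 2 * v $ 1"

definition simple_closed_curve :: "real \<Rightarrow> (real \<Rightarrow> real^2) \<Rightarrow> bool" where
  "simple_closed_curve T c \<longleftrightarrow> T > 0 \<and> (\<forall>t. c (t + T) = c t) \<and> inj_on c {0..<T}"

text \<open>
  \<open>\<Omega>\<close> is a strictly convex domain with smooth boundary of length \<open>l\<close>, and \<open>\<gamma>\<close> is a periodic
  arc-length parametrization of the boundary.  Positive orientation means that \<open>\<Omega>\<close> lies to the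
  left of every tangent; with this orientation and unit speed, the curvature of the boundary
  at \<open>\<gamma> s\<close> is \<open>cross2 (\<gamma>' s) (\<gamma>'' s)\<close>.
\<close>

definition billiard_table :: "(real^2) set \<Rightarrow> real \<Rightarrow> (real \<Rightarrow> real^2) \<Rightarrow> bool" where
  "billiard_table \<Omega> l \<gamma> \<longleftrightarrow>
     open \<Omega> \<and> convex \<Omega> \<and> bounded \<Omega> \<and> \<Omega> \<noteq> {} \<and>
     simple_closed_curve l \<gamma> \<and> range \<gamma> = frontier \<Omega> \<and>
     smooth_curve \<gamma> \<and> (\<forall>s. norm (curve_deriv \<gamma> s) = 1) \<and>
     (\<forall>s. \<forall>x\<in>\<Omega>. cross2 (curve_deriv \<gamma> s) (x - \<gamma> s) > 0) \<and>
     (\<forall>s. cross2 (curve_deriv \<gamma> s) (curve_deriv (curve_deriv \<gamma>) s) > 0)"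

definition gen_fun :: "(real \<Rightarrow> real^2) \<Rightarrow> real \<Rightarrow> real \<Rightarrow> real" where
  "gen_fun \<gamma> s s' = - dist (\<gamma> s) (\<gamma> s')"

text \<open>
  Bi-infinite sequences of lifted impact points of genuine trajectories.  The last condition is
  the reflection law: the incoming and the outgoing unit velocity make the same angle with
  the tangent, and the strict inequalities place this angle in the open interval from \<open>0\<close> to \<open>pi\<close>.
\<close>

definition billiard_orbit :: "real \<Rightarrow> (real \<Rightarrow> real^2) \<Rightarrow> (int \<Rightarrow> real) \<Rightarrow> bool" where
  "billiard_orbit l \<gamma> s \<longleftrightarrow>
     (\<forall>i. s i < s (i + 1) \<and> s (i + 1) < s i + l) \<and>
     (\<forall>i. sgn (\<gamma> (s i) - \<gamma> (s (i - 1))) \<bullet> curve_deriv \<gamma> (s i) =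
          sgn (\<gamma> (s (i + 1)) - \<gamma> (s i)) \<bullet> curve_deriv \<gamma> (s i))"

text \<open>
  The orbits of the billiard map on the two boundary components of the phase annulus, where
  it extends continuously by \<open>s' = s\<close> and by \<open>s' = s + l\<close>.
\<close>

definition boundary_orbit :: "real \<Rightarrow> (int \<Rightarrow> real) \<Rightarrow> bool" where
  "boundary_orbit l s \<longleftrightarrow> (\<forall>i. s (i + 1) = s i) \<or> (\<forall>i. s (i + 1) = s i + l)"

definition has_rotation_number :: "real \<Rightarrow> (int \<Rightarrow> real) \<Rightarrow> real \<Rightarrow> bool" where
  "has_rotation_number l s \<omega> \<longleftrightarrow>
     ((\<lambda>i. s i / (of_int i * l)) \<longlongrightarrow> \<omega>) at_top \<and>
     ((\<lambda>i. s i / (of_int i * l)) \<longlongrightarrow> \<omega>) at_bot"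

text \<open>
  The competitors in the minimization are restricted to the domain \<open>s \<le> s' \<le> s + l\<close> of
  the generating function.
\<close>

definition minimal_orbit :: "real \<Rightarrow> (real \<Rightarrow> real^2) \<Rightarrow> (int \<Rightarrow> real) \<Rightarrow> bool" where
  "minimal_orbit l \<gamma> s \<longleftrightarrow>
     (billiard_orbit l \<gamma> s \<or> boundary_orbit l s) \<and>
     (\<forall>m n t. m < n \<longrightarrow> t m = s m \<longrightarrow> t n = s n \<longrightarrow>
        (\<forall>i\<in>{m..<n}. t i \<le> t (i + 1) \<and> t (i + 1) \<le> t i + l) \<longrightarrow>
        (\<Sum>i\<in>{m..<n}. gen_fun \<gamma> (s i) (s (i + 1))) \<le> (\<Sum>i\<in>{m..<n}. gen_fun \<gamma> (t i) (t (i + 1))))"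

definition mather_beta :: "real \<Rightarrow> (real \<Rightarrow> real^2) \<Rightarrow> real \<Rightarrow> real" where
  "mather_beta l \<gamma> \<omega> =
     (THE b. \<exists>s. minimal_orbit l \<gamma> s \<and> has_rotation_number l s \<omega> \<and>
        (\<lambda>N. (\<Sum>i\<in>{- int N..int N - 1}. gen_fun \<gamma> (s i) (s (i + 1))) / (2 * real N)) \<longlonglongrightarrow> b)"

definition tangent_chord :: "(real \<Rightarrow> real^2) \<Rightarrow> real^2 \<Rightarrow> real^2 \<Rightarrow> bool" where
  "tangent_chord c p q \<longleftrightarrow>
     (\<exists>t. c t \<in> closed_segment p q \<and> cross2 (curve_deriv c t) (q - p) = 0)"

text \<open>
  A convex closed curve is one that bounds its own convex hull.
\<close>

definition caustic ::
    "(real^2) set \<Rightarrow> real \<Rightarrow> (real \<Rightarrow> real^2) \<Rightarrow> (real \<Rightarrow> real^2) \<Rightarrow> bool" where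
  "caustic \<Omega> l \<gamma> c \<longleftrightarrow>
     (\<exists>T. simple_closed_curve T c) \<and> smooth_curve c \<and> (\<forall>t. curve_deriv c t \<noteq> 0) \<and>
     range c = frontier (convex hull (range c)) \<and> range c \<subseteq> \<Omega> \<and>
     (\<forall>s i. billiard_orbit l \<gamma> s \<longrightarrow>
        tangent_chord c (\<gamma> (s i)) (\<gamma> (s (i + 1))) \<longrightarrow>
        tangent_chord c (\<gamma> (s (i + 1))) (\<gamma> (s (i + 2))))"

text \<open>
  Every trajectory tangent to a caustic can be run in both directions, which exchanges the
  rotation numbers \<open>\<omega>\<close> and \<open>1 - \<omega>\<close>.  The rotation number of the caustic is that of the
  trajectories which turn around it in the positive direction, leaving it on their left.
\<close>

definition positively_tangent_orbit ::
    "real \<Rightarrow> (real \<Rightarrow> real^2) \<Rightarrow> (real \<Rightarrow> real^2) \<Rightarrow> (int \<Rightarrow> real) \<Rightarrow> bool" where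
  "positively_tangent_orbit l \<gamma> c s \<longleftrightarrow> billiard_orbit l \<gamma> s \<and>
     (\<exists>i. tangent_chord c (\<gamma> (s i)) (\<gamma> (s (i + 1))) \<and>
          (\<forall>t. cross2 (\<gamma> (s (i + 1)) - \<gamma> (s i)) (c t - \<gamma> (s i)) \<ge> 0))"

definition caustic_rotation_number ::
    "real \<Rightarrow> (real \<Rightarrow> real^2) \<Rightarrow> (real \<Rightarrow> real^2) \<Rightarrow> real \<Rightarrow> bool" where
  "caustic_rotation_number l \<gamma> c \<omega> \<longleftrightarrow>
     (\<exists>s. positively_tangent_orbit l \<gamma> c s) \<and>
     (\<forall>s. positively_tangent_orbit l \<gamma> c s \<longrightarrow> has_rotation_number l s \<omega>)"

definition caustic_rotation_numbers ::
    "(real^2) set \<Rightarrow> real \<Rightarrow> (real \<Rightarrow> real^2) \<Rightarrow> real set" where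
  "caustic_rotation_numbers \<Omega> l \<gamma> =
     {\<omega>. \<exists>c. caustic \<Omega> l \<gamma> c \<and> caustic_rotation_number l \<gamma> c \<omega>}"

text \<open>
  Asymptotic expansion \<open>f x \<sim> (\<Sum>k. b k * x ^ k / k!)\<close> as \<open>x\<close> tends to \<open>0\<close> from the right
  within a set \<open>E\<close>.  As usual for expansions within a set, the expansion point has to be a
  limit point of the set: otherwise the filter is trivial and every sequence \<open>b\<close> would qualify.
  If \<open>E\<close> is the set of rotation numbers of caustics, this holds by Lazutkin's theorem.
\<close>

definition formal_taylor_expansion ::
    "real set \<Rightarrow> (real \<Rightarrow> real) \<Rightarrow> (nat \<Rightarrow> real) \<Rightarrow> bool" where
  "formal_taylor_expansion E f b \<longleftrightarrow>
     0 islimpt (E \<inter> {0<..}) \<and>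
     (\<forall>n. (\<lambda>x. f x - (\<Sum>k\<le>n. b k * x ^ k / fact k))
            \<in> O[at 0 within (E \<inter> {0<..})](\<lambda>x. x ^ (n + 1)))"

end

theory Submission
  imports Defs "HOL-Complex_Analysis.Great_Picard"
begin

text \<open>
  For all small \<open>\<omega> > 0\<close> one has
  \<open>\<beta>(\<omega>) = - l \<omega> + L\<^sup>3 \<omega>\<^sup>3 / 24 + o(\<omega>\<^sup>3)\<close>, where \<open>L\<close> is the integral of \<open>\<kappa>\<^bsup>2/3\<^esup>\<close> over the
  boundary. Hence \<open>\<beta>\<^sub>1 = - l\<close> and \<open>\<beta>\<^sub>3 = L\<^sup>3 / 4\<close>, and Hoelder's inequality with total curvature
  \<open>2 \<pi>\<close> gives \<open>L\<^sup>3 \<le> 4 \<pi>\<^sup>2 l\<close>, with equality iff \<open>\<kappa>\<close> is constant.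

  That \<open>\<beta>(\<omega>)\<close> is well defined is Aubry--Mather theory: minimal orbits of rotation number
  \<open>\<omega>\<close> are limits of periodic minimizers whose translates are totally ordered, and two minimal
  configurations with the same rotation number have the same average action, because each can
  be joined to the other at a cost that is negligible on average.

  For the expansion, a short chord is shorter than its arc by about \<open>(\<Delta>x)\<^sup>3 / 24\<close>, where
  \<open>dx = \<kappa>\<^bsup>2/3\<^esup> ds\<close>. The upper bound compares a minimal orbit with equal steps in \<open>x\<close>; the lower
  bound is convexity of the cube, applied to the steps of the orbit, whose mean is \<open>\<omega> L\<close>.
\<close>


section \<open>Minimal configurations of a twist cost\<close>

text \<open>\<open>mather_beta\<close> is a definite description, so it is accessible only once
  existence and uniqueness of the average action are known at the given \<omega>. Two obstacles
  shape that part. The cost is minus a distance, not differentiable where the points coincide; so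
  the twist condition enters in integrated form, as an inequality for crossing segments, and
  competitors may rest or make full turns. That minimizers do neither follows afterwards from the
  strict triangle inequality. And an arbitrary minimal orbit is only known to be o(N) away from a
  line, so two of them need not stay close; they are joined by truncation, whose cost grows linearly
  with the deviation and is thus o(N) over 2N steps. The constant 24: an arc of length \<delta> and
  curvature \<kappa> has a chord of about \<delta> - \<kappa>^2 \<delta>^3 / 24, and \<kappa>^2 ds^3
  is the cube of \<kappa>^(2/3) ds. The asymptotics are obtained as \<omega> tends to 0 through all
  positive reals and then restricted to the rotation numbers of caustics, where 0 being a limit
  point makes the coefficients unique.\<close>

lemma pointwise_bounded_convergent_subseq:
  fixes f :: "nat \<Rightarrow> 'a::countable \<Rightarrow> real"
  assumes "\<And>n i. \<bar>f n i\<bar> \<le> B i"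
  obtains k g where "strict_mono (k :: nat \<Rightarrow> nat)" "\<And>i. (\<lambda>n. f (k n) i) \<longlonglongrightarrow> g i"
proof -
  \<comment> \<open>The compactness theorem wants one bound for all indices, so each coordinate is
    divided by its own; adding 1 keeps the divisor positive.\<close>
  let ?f = "\<lambda>n i. f n i / (1 + \<bar>B i\<bar>)"
  have *: "norm (?f n i) \<le> 1" for n i
    using assms[of n i] by (auto simp: divide_le_eq_1)
  obtain k where k: "strict_mono (k :: nat \<Rightarrow> nat)" "\<And>i. i \<in> UNIV \<Longrightarrow> \<exists>g. (\<lambda>n. ?f (k n) i) \<longlonglongrightarrow> g"
    using function_convergent_subsequence[of UNIV ?f 1] * by blast
  then obtain g where g: "\<And>i. (\<lambda>n. ?f (k n) i) \<longlonglongrightarrow> g i"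
    by (metis UNIV_I)
  have lim: "(\<lambda>n. f (k n) i) \<longlonglongrightarrow> g i * (1 + \<bar>B i\<bar>)" for i
    using tendsto_mult_right[OF g[of i], of "1 + \<bar>B i\<bar>"] by (simp add: add_nonneg_eq_0_iff)
  show ?thesis by (rule that[OF k(1) lim])
qed

lemma sum_periodic_shift:
  fixes f :: "int \<Rightarrow> 'a::ab_group_add"
  assumes per: "\<And>i. f (i + Q) = f i" and Q: "0 < Q"
  shows "sum f {m..<m + Q} = sum f {0..<Q}"
proof -
  have step: "sum f {m + 1..<m + 1 + Q} = sum f {m..<m + Q}" for m
  proof -
    have 1: "{m..<m + Q} = insert m {m + 1..<m + Q}" and 2: "{m + 1..<m + 1 + Q} = insert (m + Q) {m + 1..<m + Q}"
      using Q by auto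
    show ?thesis unfolding 1 2 using per[of m] by simp
  qed
  show ?thesis
  proof (induction m rule: int_induct[where k = 0])
    case base show ?case by simp
  next
    case (step1 i) then show ?case using step[of i] by simp
  next
    case (step2 i) then show ?case using step[of "i - 1"] by simp
  qed
qed

lemma sum_periodic_mult:
  fixes f :: "int \<Rightarrow> real"
  assumes per: "\<And>i. f (i + Q) = f i" and Q: "0 < Q"
  shows "sum f {0..<int k * Q} = real k * sum f {0..<Q}"
proof (induction k)
  case (Suc k)
  have "{0..<int (Suc k) * Q} = {0..<int k * Q} \<union> {int k * Q..<int k * Q + Q}"
    using Q by (auto simp: algebra_simps) (smt (verit) mult_nonneg_nonneg of_nat_0_le_iff)
  then have "sum f {0..<int (Suc k) * Q} = sum f {0..<int k * Q} + sum f {int k * Q..<int k * Q + Q}"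
    by (simp add: sum.union_disjoint)
  then show ?case using Suc sum_periodic_shift[of f Q "int k * Q", OF per Q] by (simp add: algebra_simps)
qed simp

text \<open>\<open>h_submodular\<close> is the integrated form of the twist condition that the mixed
  second derivative of \<open>h\<close> is nonpositive: uncrossing two segments does not raise the
  cost. For minus the chord length it says that the diagonals of a quadrilateral are together at
  least as long as two opposite sides.\<close>

locale twist_cost =
  fixes l K :: real and h :: "real \<Rightarrow> real \<Rightarrow> real"
  assumes l_pos: "0 < l"
    and h_continuous: "continuous_on UNIV (\<lambda>(x, y). h x y)"
    and h_periodic: "h (x + l) (y + l) = h x y"
    and h_bounded: "\<bar>h x y\<bar> \<le> K"
    and h_submodular: "\<lbrakk>x \<le> y; y \<le> y'; y' \<le> x'; x' \<le> x + l\<rbrakk> \<Longrightarrow> h x y' + h y x' \<le> h x x' + h y y'"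
begin

definition admissible :: "int \<Rightarrow> int \<Rightarrow> (int \<Rightarrow> real) \<Rightarrow> bool" where
  "admissible m n t \<longleftrightarrow> (\<forall>i\<in>{m..<n}. t i \<le> t (i + 1) \<and> t (i + 1) \<le> t i + l)"

definition action :: "int \<Rightarrow> int \<Rightarrow> (int \<Rightarrow> real) \<Rightarrow> real" where
  "action m n t = (\<Sum>i\<in>{m..<n}. h (t i) (t (i + 1)))"

definition minimal :: "(int \<Rightarrow> real) \<Rightarrow> bool" where
  "minimal s \<longleftrightarrow> (\<forall>m n. admissible m n s) \<and>
     (\<forall>m n t. m < n \<longrightarrow> t m = s m \<longrightarrow> t n = s n \<longrightarrow> admissible m n t \<longrightarrow> action m n s \<le> action m n t)"

definition periodic_config :: "int \<Rightarrow> int \<Rightarrow> (int \<Rightarrow> real) \<Rightarrow> bool" where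
  "periodic_config P Q t \<longleftrightarrow>
     (\<forall>i. t i \<le> t (i + 1) \<and> t (i + 1) \<le> t i + l \<and> t (i + Q) = t i + of_int P * l)"

definition periodic_minimizer :: "int \<Rightarrow> int \<Rightarrow> (int \<Rightarrow> real) \<Rightarrow> bool" where
  "periodic_minimizer P Q t \<longleftrightarrow> periodic_config P Q t \<and>
     (\<forall>u. periodic_config P Q u \<longrightarrow> action 0 Q t \<le> action 0 Q u)"

lemma h_shift: "h (x + of_int k * l) (y + of_int k * l) = h x y"
proof (induction k rule: int_induct[where k = 0])
  case base show ?case by simp
next
  case (step1 i)
  then show ?case using h_periodic[of "x + of_int i * l" "y + of_int i * l"] by (simp add: algebra_simps)
next
  case (step2 i)
  then show ?case using h_periodic[of "x + of_int (i - 1) * l" "y + of_int (i - 1) * l"]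
    by (simp add: algebra_simps)
qed

lemma h_tendsto:
  assumes "(f \<longlongrightarrow> x) F" "(g \<longlongrightarrow> y) F"
  shows "((\<lambda>n. h (f n) (g n)) \<longlongrightarrow> h x y) F"
  using continuous_on_tendsto_compose[OF h_continuous tendsto_Pair[OF assms]] by simp

lemma action_tendsto:
  assumes "\<And>i. ((\<lambda>n. f n i) \<longlongrightarrow> g i) F"
  shows "((\<lambda>k. action m n (f k)) \<longlongrightarrow> action m n g) F"
  unfolding action_def by (intro tendsto_sum h_tendsto assms)

lemma action_shift: "action m n (\<lambda>i. t i + of_int k * l) = action m n t"
  unfolding action_def by (simp add: h_shift)

lemma action_translate: "action m n (\<lambda>i. t (i + a)) = action (m + a) (n + a) t"
  unfolding action_def
  by (rule sum.reindex_bij_witness[of _ "\<lambda>i. i - a" "\<lambda>i. i + a"]) (auto simp: algebra_simps)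

lemma action_split: "m \<le> j \<Longrightarrow> j \<le> n \<Longrightarrow> action m n t = action m j t + action j n t"
  unfolding action_def by (subst sum.union_disjoint[symmetric]) (auto intro!: sum.cong)

text \<open>If the two segments cross, maxima and minima uncross them; otherwise both sides agree.
  The action is thus submodular on the lattice of configurations.\<close>

lemma h_max_min:
  assumes "x \<le> x'" "x' \<le> x + l" "y \<le> y'" "y' \<le> y + l"
  shows "h (max x y) (max x' y') + h (min x y) (min x' y') \<le> h x x' + h y y'"
  using h_submodular[of x y y' x'] h_submodular[of y x x' y'] assms
  by (auto simp: max_def min_def)

lemma periodic_config_mult:
  assumes "periodic_config P Q t"
  shows "t (i + k * Q) = t i + of_int (k * P) * l"
proof (induction k rule: int_induct[where k = 0])
  case base show ?case by simp
next
  case (step1 k)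
  have "t (i + (k + 1) * Q) = t (i + k * Q + Q)" by (simp add: algebra_simps)
  also have "\<dots> = t (i + k * Q) + of_int P * l" using assms unfolding periodic_config_def by blast
  finally show ?case using step1 by (simp add: algebra_simps)
next
  case (step2 k)
  have "t (i + (k - 1) * Q + Q) = t (i + (k - 1) * Q) + of_int P * l"
    using assms unfolding periodic_config_def by blast
  moreover have "i + (k - 1) * Q + Q = i + k * Q" by (simp add: algebra_simps)
  ultimately show ?case using step2 by (simp add: algebra_simps)
qed

lemma periodic_config_multiple: "periodic_config P Q t \<Longrightarrow> periodic_config (k * P) (k * Q) t"
  using periodic_config_mult[of P Q t _ k] by (simp add: periodic_config_def)

lemma periodic_config_cost:
  assumes "periodic_config P Q t"
  shows "h (t (i + Q)) (t (i + Q + 1)) = h (t i) (t (i + 1))"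
proof -
  have "t (i + Q + 1) = t (i + 1 + Q)" by (simp add: algebra_simps)
  then show ?thesis using assms h_shift[of "t i" P "t (i + 1)"] unfolding periodic_config_def by simp
qed

lemma action_period:
  assumes "periodic_config P Q t" "0 < Q"
  shows "action m (m + Q) t = action 0 Q t"
  unfolding action_def
  using sum_periodic_shift[of "\<lambda>i. h (t i) (t (i + 1))" Q] periodic_config_cost[OF assms(1)] assms(2) by simp

lemma action_periods:
  assumes "periodic_config P Q t" "0 < Q"
  shows "action 0 (int k * Q) t = real k * action 0 Q t"
  unfolding action_def
  using sum_periodic_mult[of "\<lambda>i. h (t i) (t (i + 1))" Q] periodic_config_cost[OF assms(1)] assms(2) by simp

lemma action_ge: "- K * real (nat (n - m)) \<le> action m n t"
proof -
  have "(\<Sum>i\<in>{m..<n}. - K) \<le> action m n t"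
    unfolding action_def by (intro sum_mono) (metis abs_le_iff h_bounded minus_le_iff)
  then show ?thesis by (simp add: mult.commute)
qed

lemma growth_bound:
  assumes "\<And>i. t i \<le> t (i + 1) \<and> t (i + 1) \<le> t i + l"
  shows "\<bar>t i - t 0\<bar> \<le> \<bar>of_int i\<bar> * l"
proof (induction i rule: int_induct[where k = 0])
  case (step1 i)
  then show ?case using assms[of i] by (simp add: algebra_simps abs_if split: if_splits)
next
  case (step2 i)
  then show ?case using assms[of "i - 1"] by (simp add: algebra_simps abs_if split: if_splits)
qed simp

section \<open>Existence and ordering of periodic minimizers\<close>

lemma normalize_start:
  obtains k :: int where "0 \<le> x + of_int k * l" "x + of_int k * l < l"
proof -
  have "of_int \<lfloor>x / l\<rfloor> * l \<le> x" "x < (of_int \<lfloor>x / l\<rfloor> + 1) * l"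
    using l_pos floor_correct[of "x / l"] pos_le_divide_eq[of l] pos_divide_less_eq[of l] by (metis, metis of_int_1 of_int_add)
  then show ?thesis using that[of "- \<lfloor>x / l\<rfloor>"] by (simp add: algebra_simps)
qed

lemma configs_convergent_subseq:
  fixes t :: "nat \<Rightarrow> int \<Rightarrow> real"
  assumes adm: "\<And>n i. t n i \<le> t n (i + 1) \<and> t n (i + 1) \<le> t n i + l"
    and start: "\<And>n. 0 \<le> t n 0 \<and> t n 0 \<le> l"
  obtains k g where "strict_mono (k :: nat \<Rightarrow> nat)" "\<And>i. (\<lambda>n. t (k n) i) \<longlonglongrightarrow> g i"
    "\<And>i. g i \<le> g (i + 1) \<and> g (i + 1) \<le> g i + l"
proof -
  have "\<bar>t n i\<bar> \<le> l + \<bar>of_int i\<bar> * l" for n i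
    using growth_bound[of "t n" i] adm start[of n] by auto
  then obtain k g where k: "strict_mono (k :: nat \<Rightarrow> nat)" and g: "\<And>i. (\<lambda>n. t (k n) i) \<longlonglongrightarrow> g i"
    using pointwise_bounded_convergent_subseq[of t "\<lambda>i. l + \<bar>of_int i\<bar> * l"] by blast
  have "g i \<le> g (i + 1)" for i
    using g[of i] g[of "i + 1"] adm by (intro LIMSEQ_le) auto
  moreover have "g (i + 1) \<le> g i + l" for i
    using g[of "i + 1"] tendsto_add[OF g[of i] tendsto_const[of l]] adm by (intro LIMSEQ_le) auto
  ultimately show ?thesis using that k g by blast
qed

text \<open>The direct method: translation by multiples of \<open>l\<close> leaves the action alone
  and puts the start into a compact interval, and both the constraints and the action pass to
  pointwise limits.\<close>

lemma periodic_minimizer_exists: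
  assumes "0 \<le> P" "P \<le> Q" "0 < Q"
  obtains t where "periodic_minimizer P Q t"
proof -
  let ?S = "{action 0 Q t |t. periodic_config P Q t}"
  have "periodic_config P Q (\<lambda>i. of_int i * of_int P * l / of_int Q)"
    using assms l_pos unfolding periodic_config_def by (auto simp: field_simps)
  then have ne: "?S \<noteq> {}" by blast
  have bdd: "bdd_below ?S"
    using action_ge by (auto intro!: bdd_belowI)
  define v where "v = Inf ?S"
  have v_le: "v \<le> action 0 Q u" if "periodic_config P Q u" for u
    unfolding v_def using that by (intro cInf_lower[OF _ bdd]) blast
  have "\<exists>t. periodic_config P Q t \<and> 0 \<le> t 0 \<and> t 0 \<le> l \<and> action 0 Q t < v + 1 / real (Suc n)" for n
  proof -
    have "v < v + 1 / real (Suc n)" by simp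
    then obtain t where t: "periodic_config P Q t" "action 0 Q t < v + 1 / real (Suc n)"
      using cInf_lessD[OF ne] unfolding v_def by blast
    obtain k where k: "0 \<le> t 0 + of_int k * l" "t 0 + of_int k * l < l" by (rule normalize_start)
    show ?thesis
      using t k by (intro exI[of _ "\<lambda>i. t i + of_int k * l"])
        (auto simp: action_shift periodic_config_def)
  qed
  then obtain t where "\<forall>n. periodic_config P Q (t n) \<and> 0 \<le> t n 0 \<and> t n 0 \<le> l \<and> action 0 Q (t n) < v + 1 / real (Suc n)"
    using choice[of "\<lambda>n t. periodic_config P Q t \<and> 0 \<le> t 0 \<and> t 0 \<le> l \<and> action 0 Q t < v + 1 / real (Suc n)"] by blast
  then have t: "\<And>n. periodic_config P Q (t n)" "\<And>n. 0 \<le> t n 0 \<and> t n 0 \<le> l"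
    "\<And>n. action 0 Q (t n) < v + 1 / real (Suc n)"
    by auto
  obtain k g where k: "strict_mono (k :: nat \<Rightarrow> nat)" and g: "\<And>i. (\<lambda>n. t (k n) i) \<longlonglongrightarrow> g i"
    and adm: "\<And>i. g i \<le> g (i + 1) \<and> g (i + 1) \<le> g i + l"
    using configs_convergent_subseq[of t] t(1,2) unfolding periodic_config_def by blast
  have "g (i + Q) = g i + of_int P * l" for i
  proof (rule LIMSEQ_unique[OF g])
    show "(\<lambda>n. t (k n) (i + Q)) \<longlonglongrightarrow> g i + of_int P * l"
      using tendsto_add[OF g[of i] tendsto_const[of "of_int P * l"]] t(1) unfolding periodic_config_def by simp
  qed
  with adm have per: "periodic_config P Q g" unfolding periodic_config_def by blast
  have "action 0 Q g \<le> v"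
  proof (rule LIMSEQ_le)
    show "(\<lambda>n. action 0 Q (t (k n))) \<longlonglongrightarrow> action 0 Q g" by (rule action_tendsto[OF g])
    have "(\<lambda>n. v + 1 / real (Suc n)) \<longlonglongrightarrow> v + 0"
      by (intro tendsto_add tendsto_const LIMSEQ_Suc[OF lim_1_over_n])
    then show "(\<lambda>n. v + 1 / real (Suc (k n))) \<longlonglongrightarrow> v"
      using LIMSEQ_subseq_LIMSEQ[OF _ k, of "\<lambda>n. v + 1 / real (Suc n)" v] by (simp add: o_def)
    show "\<exists>N. \<forall>n\<ge>N. action 0 Q (t (k n)) \<le> v + 1 / real (Suc (k n))"
      using t(3) less_imp_le by blast
  qed
  then have "periodic_minimizer P Q g"
    unfolding periodic_minimizer_def using per v_le order_trans by blast
  then show ?thesis by (rule that)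
qed

text \<open>Maximum and minimum together cost at most as much as the two minimizers, and the minimum
  alone already costs at least as much as one of them.\<close>

lemma periodic_minimizer_max:
  assumes "periodic_minimizer P Q x" "periodic_minimizer P Q y"
  shows "periodic_minimizer P Q (\<lambda>i. max (x i) (y i))"
proof -
  have px: "periodic_config P Q x" and py: "periodic_config P Q y"
    using assms unfolding periodic_minimizer_def by auto
  have X: "x i \<le> x (i + 1)" "x (i + 1) \<le> x i + l" "x (i + Q) = x i + of_int P * l"
    and Y: "y i \<le> y (i + 1)" "y (i + 1) \<le> y i + l" "y (i + Q) = y i + of_int P * l" for i
    using px py unfolding periodic_config_def by blast+
  have pM: "periodic_config P Q (\<lambda>i. max (x i) (y i))"
    unfolding periodic_config_def
  proof (intro allI conjI)
    fix i
    show "max (x i) (y i) \<le> max (x (i + 1)) (y (i + 1))" "max (x (i + 1)) (y (i + 1)) \<le> max (x i) (y i) + l"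
      "max (x (i + Q)) (y (i + Q)) = max (x i) (y i) + of_int P * l"
      using X[of i] Y[of i] by linarith+
  qed
  have pm: "periodic_config P Q (\<lambda>i. min (x i) (y i))"
    unfolding periodic_config_def
  proof (intro allI conjI)
    fix i
    show "min (x i) (y i) \<le> min (x (i + 1)) (y (i + 1))" "min (x (i + 1)) (y (i + 1)) \<le> min (x i) (y i) + l"
      "min (x (i + Q)) (y (i + Q)) = min (x i) (y i) + of_int P * l"
      using X[of i] Y[of i] by linarith+
  qed
  have "action 0 Q (\<lambda>i. max (x i) (y i)) + action 0 Q (\<lambda>i. min (x i) (y i)) \<le> action 0 Q x + action 0 Q y"
    unfolding action_def sum.distrib[symmetric]
    by (intro sum_mono h_max_min) (use px py periodic_config_def in blast)+
  moreover have "action 0 Q x \<le> action 0 Q (\<lambda>i. min (x i) (y i))"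
    using assms(1) pm unfolding periodic_minimizer_def by blast
  ultimately have "action 0 Q (\<lambda>i. max (x i) (y i)) \<le> action 0 Q y" by linarith
  with pM assms(2) show ?thesis unfolding periodic_minimizer_def by fastforce
qed

lemma periodic_minimizer_Max:
  assumes "finite F" "F \<noteq> {}" "\<And>f. f \<in> F \<Longrightarrow> periodic_minimizer P Q f"
  shows "periodic_minimizer P Q (\<lambda>i. Max ((\<lambda>f. f i) ` F))"
  using assms
proof (induction rule: finite_ne_induct)
  case (insert x F)
  then show ?case using periodic_minimizer_max[of P Q x "\<lambda>i. Max ((\<lambda>f. f i) ` F)"] by simp
qed simp

lemma periodic_minimizer_translate:
  assumes "periodic_minimizer P Q x" "0 < Q"
  shows "periodic_minimizer P Q (\<lambda>i. x (i + a) + of_int b * l)"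
proof -
  have px: "periodic_config P Q x" using assms by (simp add: periodic_minimizer_def)
  have "x (i + Q + a) = x (i + a) + of_int P * l" for i
    using px unfolding periodic_config_def by (metis add.assoc add.commute)
  moreover have "x (i + a) \<le> x (i + 1 + a) \<and> x (i + 1 + a) \<le> x (i + a) + l" for i
    using px unfolding periodic_config_def by (metis add.assoc add.commute)
  ultimately have "periodic_config P Q (\<lambda>i. x (i + a) + of_int b * l)"
    unfolding periodic_config_def by auto
  moreover have "action 0 Q (\<lambda>i. x (i + a) + of_int b * l) = action 0 Q x"
    unfolding action_shift[of 0 Q "\<lambda>i. x (i + a)" b] action_translate[of 0 Q x a]
    using action_period[OF px assms(2), of a] by (simp add: add.commute)
  ultimately show ?thesis using assms(1) unfolding periodic_minimizer_def by simp
qed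

text \<open>
  Replacing a minimizer by the supremum of all its translates lying on one side of the line of
  slope \<open>p / q\<close> makes the family of its translates totally ordered.
\<close>

lemma ordered_periodic_minimizer:
  fixes p q k :: int
  assumes x: "periodic_minimizer (k * p) (k * q) x" and q: "0 < q" and k: "0 < k"
  obtains y where "periodic_minimizer (k * p) (k * q) y"
    "\<And>i c d. of_int c * (of_int p / of_int q) \<le> real_of_int d \<Longrightarrow> y (i + c) - of_int d * l \<le> y i"
    "\<And>i c d. real_of_int d \<le> of_int c * (of_int p / of_int q) \<Longrightarrow> y i \<le> y (i + c) - of_int d * l"
proof -
  define \<omega> where "\<omega> = real_of_int p / of_int q"
  define Q where "Q = k * q"
  have Q: "0 < Q" using q k by (simp add: Q_def)
  have px: "periodic_config (k * p) Q x" using x by (simp add: periodic_minimizer_def Q_def)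
  \<comment> \<open>Among the translates \<open>x (i + a) - b * l\<close> with
    \<open>a * \<omega> \<le> b\<close>, the highest for given \<open>a\<close> has the ceiling as
    \<open>b\<close>. Raising \<open>a\<close> by \<open>Q\<close> raises this ceiling by exactly
    \<open>k * p\<close> and reproduces the same translate, so the maximum over one period of
    \<open>a\<close> is the supremum of them all.\<close>
  define X where "X a i = x (i + a) + of_int (- \<lceil>of_int a * \<omega>\<rceil>) * l" for a i
  define y where "y i = Max ((\<lambda>f. f i) ` (X ` {0..<Q}))" for i
  have y_min: "periodic_minimizer (k * p) Q y"
    unfolding y_def X_def using Q x by (intro periodic_minimizer_Max) (auto intro!: periodic_minimizer_translate simp: Q_def simp del: of_int_minus)
  have upper: "x (i + a) - of_int b * l \<le> y i" if "of_int a * \<omega> \<le> real_of_int b" for a b i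
  proof -
    define a' j where "a' = a mod Q" and "j = a div Q"
    have a: "a = a' + j * Q" by (simp add: a'_def j_def)
    have a': "a' \<in> {0..<Q}" using Q by (simp add: a'_def)
    have "of_int a * \<omega> = of_int a' * \<omega> + of_int (j * (k * p))"
      using q by (simp add: a \<omega>_def Q_def field_simps)
    then have "\<lceil>of_int a' * \<omega>\<rceil> \<le> b - j * (k * p)" using that by (simp add: ceiling_le_iff)
    then have "real_of_int \<lceil>of_int a' * \<omega>\<rceil> \<le> of_int (b - j * (k * p))"
      by (simp only: of_int_le_iff)
    then have "of_int \<lceil>of_int a' * \<omega>\<rceil> * l \<le> of_int (b - j * (k * p)) * l"
      using l_pos by (intro mult_right_mono) auto
    then have "x (i + a) - of_int b * l \<le> X a' i"
      using periodic_config_mult[OF px, of "i + a'" j] by (simp add: X_def a algebra_simps)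
    also have "\<dots> \<le> y i" unfolding y_def using a' by (intro Max_ge) auto
    finally show ?thesis .
  qed
  have attained: "\<exists>a. y i = x (i + a) - of_int \<lceil>of_int a * \<omega>\<rceil> * l" for i
  proof -
    have "y i \<in> (\<lambda>f. f i) ` (X ` {0..<Q})" unfolding y_def using Q by (intro Max_in) auto
    then show ?thesis unfolding X_def by auto
  qed
  \<comment> \<open>The half-plane \<open>a * \<omega> \<le> b\<close> is closed under addition, so
    translating \<open>y\<close> by one of its members gives a supremum over a subfamily.\<close>
  have le: "y (i + c) - of_int d * l \<le> y i" if "of_int c * \<omega> \<le> real_of_int d" for i c d
  proof -
    obtain a where a: "y (i + c) = x (i + c + a) - of_int \<lceil>of_int a * \<omega>\<rceil> * l" using attained by blast
    have "of_int (c + a) * \<omega> \<le> of_int (d + \<lceil>of_int a * \<omega>\<rceil>)"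
      unfolding of_int_add distrib_right using that le_of_int_ceiling[of "of_int a * \<omega>"] by linarith
    from upper[OF this, of i] show ?thesis unfolding a by (simp add: algebra_simps)
  qed
  have ge: "y i \<le> y (i + c) - of_int d * l" if "real_of_int d \<le> of_int c * \<omega>" for i c d
    using le[of "- c" "- d" "i + c"] that by simp
  show ?thesis using that[of y] y_min le ge unfolding \<omega>_def Q_def by blast
qed

text \<open>Enlarging the period cannot lower the average action, because an ordered minimizer for
  the multiple period already has the smaller one.\<close>

lemma periodic_minimizer_multiple:
  assumes z: "periodic_minimizer p q z" and q: "0 < q" and k: "0 < k" and p: "0 \<le> p" "p \<le> q"
  shows "periodic_minimizer (int k * p) (int k * q) z"
proof -
  obtain x where "periodic_minimizer (int k * p) (int k * q) x"
    using periodic_minimizer_exists[of "int k * p" "int k * q"] p q k by (auto simp: mult_left_mono)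
  then obtain y where y: "periodic_minimizer (int k * p) (int k * q) y"
    "\<And>i c d. of_int c * (of_int p / of_int q) \<le> real_of_int d \<Longrightarrow> y (i + c) - of_int d * l \<le> y i"
    "\<And>i c d. real_of_int d \<le> of_int c * (of_int p / of_int q) \<Longrightarrow> y i \<le> y (i + c) - of_int d * l"
    by (rule ordered_periodic_minimizer) (use q k in auto)
  \<comment> \<open>The translation by \<open>(q, p)\<close> lies exactly on the line of slope
    \<open>p / q\<close>, so both order relations apply to it.\<close>
  have "y (i + q) = y i + of_int p * l" for i
    using y(2)[of q p i] y(3)[of p q i] q by simp
  then have py: "periodic_config p q y"
    using y(1) unfolding periodic_minimizer_def periodic_config_def by blast
  have pz: "periodic_config p q z" using z by (simp add: periodic_minimizer_def)
  have "action 0 (int k * q) z \<le> action 0 (int k * q) y"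
    unfolding action_periods[OF pz q] action_periods[OF py q]
    using z py unfolding periodic_minimizer_def by (intro mult_left_mono) auto
  then show ?thesis
    using y(1) periodic_config_multiple[OF pz] unfolding periodic_minimizer_def by fastforce
qed

end


text \<open>The averages over \<open>a\<close> and over \<open>b\<close> are both compared with the
  one over \<open>a * b\<close>, with errors \<open>C / a\<close> and \<open>C / b\<close>, which
  makes the sequence Cauchy.\<close>

lemma quasi_additive_average_converges:
  fixes F :: "nat \<Rightarrow> real"
  assumes qa: "\<And>a b. \<bar>F (b * a) - real b * F a\<bar> \<le> real b * C"
  obtains v where "(\<lambda>n. F n / real n) \<longlonglongrightarrow> v"
proof -
  have C: "0 \<le> C" using qa[of 1 0] by simp
  have *: "\<bar>F (b * a) / real (b * a) - F a / real a\<bar> \<le> C / real a" if "0 < a" "0 < b" for a b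
  proof -
    have "F (b * a) / real (b * a) - F a / real a = (F (b * a) - real b * F a) / (real b * real a)"
      using that by (simp add: field_simps)
    then have "\<bar>F (b * a) / real (b * a) - F a / real a\<bar> = \<bar>F (b * a) - real b * F a\<bar> / (real b * real a)"
      by (simp add: abs_mult)
    also have "\<dots> \<le> (real b * C) / (real b * real a)"
      using qa[where a=a and b=b] by (intro divide_right_mono) auto
    finally show ?thesis using that by simp
  qed
  have **: "\<bar>F a / real a - F b / real b\<bar> \<le> C / real a + C / real b" if "0 < a" "0 < b" for a b
    using *[OF that] *[OF that(2,1)] by (simp add: mult.commute)
  have "Cauchy (\<lambda>n. F n / real n)"
  proof (rule CauchyI)
    fix e :: real assume "0 < e"
    obtain N :: nat where N: "2 * C / e < real N" using reals_Archimedean2 by blast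
    then have N0: "0 < N"
      using C \<open>0 < e\<close> by (intro Nat.gr0I) (auto simp: divide_less_0_iff)
    have "norm (F m / real m - F n / real n) < e" if "N \<le> m" "N \<le> n" for m n
    proof -
      have "C / real m \<le> C / real N" "C / real n \<le> C / real N"
        using that N0 C by (auto intro!: divide_left_mono mult_pos_pos)
      moreover have "2 * (C / real N) < e" using N N0 \<open>0 < e\<close> by (simp add: field_simps)
      moreover have "\<bar>F m / real m - F n / real n\<bar> \<le> C / real m + C / real n" using ** that N0 by simp
      ultimately show ?thesis unfolding real_norm_def by linarith
    qed
    then show "\<exists>M. \<forall>m\<ge>M. \<forall>n\<ge>M. norm (F m / real m - F n / real n) < e" by blast
  qed
  then show ?thesis using that real_Cauchy_convergent convergent_def by metis
qed

lemma has_rotation_numberI: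
  assumes "0 < l" and bound: "\<And>i. \<bar>s i - of_int i * \<omega> * l\<bar> \<le> C"
  shows "has_rotation_number l s \<omega>"
proof -
  have lim: "((\<lambda>i. s i / (of_int i * l)) \<longlongrightarrow> \<omega>) F"
    if F: "filterlim (\<lambda>i::int. real_of_int i) at_infinity F" for F
  proof -
    have "((\<lambda>i. C / l / of_int i) \<longlongrightarrow> 0) F"
      by (rule tendsto_divide_0[OF tendsto_const F])
    then have 1: "((\<lambda>i. (s i - of_int i * \<omega> * l) / (of_int i * l)) \<longlongrightarrow> 0) F"
    proof (rule Lim_null_comparison[rotated, OF tendsto_rabs_zero])
      have "\<bar>s i - of_int i * \<omega> * l\<bar> / (\<bar>of_int i\<bar> * l) \<le> \<bar>C / l / of_int i\<bar>" for i
      proof -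
        have "\<bar>s i - of_int i * \<omega> * l\<bar> / (\<bar>of_int i\<bar> * l) \<le> \<bar>C\<bar> / (\<bar>of_int i\<bar> * l)"
          using bound[of i] assms(1) by (intro divide_right_mono) auto
        then show ?thesis using assms(1) by (simp add: abs_mult field_simps)
      qed
      then show "\<forall>\<^sub>F i in F. norm ((s i - of_int i * \<omega> * l) / (of_int i * l)) \<le> \<bar>C / l / of_int i\<bar>"
        using assms(1) by (simp add: abs_mult)
    qed
    have "\<forall>\<^sub>F i in F. norm (of_int i :: real) \<ge> 1"
      using F unfolding filterlim_at_infinity[OF order_refl] by simp
    then have "\<forall>\<^sub>F i in F. (s i - of_int i * \<omega> * l) / (of_int i * l) + \<omega> = s i / (of_int i * l)"
      by eventually_elim (use assms(1) in \<open>auto simp: field_simps\<close>)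
    then show ?thesis
      using Lim_transform_eventually[OF tendsto_add[OF 1 tendsto_const[of \<omega>]]] by simp
  qed
  have "filterlim (\<lambda>i::int. real_of_int i) at_infinity at_top"
    by (rule filterlim_at_top_imp_at_infinity) (rule filterlim_real_of_int_at_top)
  moreover have "filterlim (\<lambda>i::int. real_of_int i) at_infinity at_bot"
  proof (rule filterlim_at_bot_imp_at_infinity)
    show "filterlim (\<lambda>i::int. real_of_int i) at_bot at_bot"
      unfolding filterlim_at_bot eventually_at_bot_linorder
      by (metis le_floor_iff)
  qed
  ultimately show ?thesis using lim unfolding has_rotation_number_def by blast
qed

text \<open>The definition controls the error at \<open>i\<close> relative to \<open>|i|\<close>,
  and only for large \<open>|i|\<close>. Measuring it against the window size \<open>N\<close>
  absorbs the finitely many other indices, so the bound becomes uniform on the window.\<close>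

lemma has_rotation_number_uniform:
  assumes "0 < l" "has_rotation_number l s \<omega>" "0 < \<delta>"
  obtains N0 :: nat where "0 < N0"
    "\<And>N i. N0 \<le> N \<Longrightarrow> \<bar>i\<bar> \<le> int N \<Longrightarrow> \<bar>s i - of_int i * \<omega> * l\<bar> \<le> \<delta> * real N * l"
proof -
  have one: "\<bar>s i - of_int i * \<omega> * l\<bar> \<le> \<delta> * \<bar>of_int i\<bar> * l"
    if "\<bar>s i / (of_int i * l) - \<omega>\<bar> < \<delta>" "i \<noteq> 0" for i
  proof -
    have "\<bar>s i - of_int i * \<omega> * l\<bar> = \<bar>s i / (of_int i * l) - \<omega>\<bar> * (\<bar>of_int i\<bar> * l)"
    proof -
      have "s i - of_int i * \<omega> * l = (s i / (of_int i * l) - \<omega>) * (of_int i * l)"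
        using that assms(1) by (simp add: field_simps)
      then show ?thesis using assms(1) by (simp add: abs_mult)
    qed
    also have "\<dots> \<le> \<delta> * (\<bar>of_int i\<bar> * l)" using that assms(1) by (intro mult_right_mono) auto
    finally show ?thesis by (simp add: mult.assoc)
  qed
  have "\<forall>\<^sub>F i in at_top. \<bar>s i / (of_int i * l) - \<omega>\<bar> < \<delta>" "\<forall>\<^sub>F i in at_bot. \<bar>s i / (of_int i * l) - \<omega>\<bar> < \<delta>"
    using assms unfolding has_rotation_number_def tendsto_iff dist_real_def by blast+
  then obtain a b where ab: "\<And>i. a \<le> i \<Longrightarrow> \<bar>s i / (of_int i * l) - \<omega>\<bar> < \<delta>"
    "\<And>i. i \<le> b \<Longrightarrow> \<bar>s i / (of_int i * l) - \<omega>\<bar> < \<delta>"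
    unfolding eventually_at_top_linorder eventually_at_bot_linorder by blast
  \<comment> \<open>At index 0 the quotient is a division by zero with value 0 and carries no
    information on \<open>s 0\<close>, so 0 always joins the exceptional set.\<close>
  define S where "S = (\<Sum>i\<in>insert 0 {b..a}. \<bar>s i - of_int i * \<omega> * l\<bar>)"
  obtain N0 :: nat where N0: "S / (\<delta> * l) < real N0" using reals_Archimedean2 by blast
  show ?thesis
  proof (rule that[of "Suc N0"])
    fix N i assume N: "Suc N0 \<le> N" and i: "\<bar>i\<bar> \<le> int N"
    show "\<bar>s i - of_int i * \<omega> * l\<bar> \<le> \<delta> * real N * l"
    proof (cases "i \<in> insert 0 {b..a}")
      case True
      then have "\<bar>s i - of_int i * \<omega> * l\<bar> \<le> S" unfolding S_def by (intro member_le_sum) auto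
      also have "S \<le> \<delta> * l * real N0" using N0 assms by (simp add: field_simps)
      also have "\<dots> \<le> \<delta> * l * real N" using N assms by (intro mult_left_mono) auto
      finally show ?thesis by (simp add: mult_ac)
    next
      case False
      then have "\<bar>s i - of_int i * \<omega> * l\<bar> \<le> \<delta> * \<bar>of_int i\<bar> * l"
        using ab[of i] by (intro one) auto
      also have "\<dots> \<le> \<delta> * real N * l"
        using i assms by (intro mult_right_mono mult_left_mono) linarith+
      finally show ?thesis .
    qed
  qed simp
qed

section \<open>Minimal configurations and uniqueness of the average action\<close>

context twist_cost
begin

lemma minimalD:
  "minimal s \<Longrightarrow> m < n \<Longrightarrow> t m = s m \<Longrightarrow> t n = s n \<Longrightarrow> admissible m n t \<Longrightarrow> action m n s \<le> action m n t"
  by (simp add: minimal_def)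

text \<open>A better finite segment could be spliced into \<open>z\<close> and repeated with a
  multiple of the period that exceeds the segment, although \<open>z\<close> is also a minimizer for
  the multiple period.\<close>

lemma periodic_minimizer_minimal:
  assumes z: "periodic_minimizer p q z" and q: "0 < q" and p: "0 \<le> p" "p \<le> q"
  shows "minimal z"
  unfolding minimal_def
proof (intro conjI allI impI)
  have pz1: "periodic_config p q z" using z by (simp add: periodic_minimizer_def)
  then show "admissible m n z" for m n unfolding admissible_def periodic_config_def by blast
  fix m n :: int and t
  assume mn: "m < n" and tm: "t m = z m" and tn: "t n = z n" and adm: "admissible m n t"
  \<comment> \<open>As \<open>q \<ge> 1\<close>, this many periods are longer than
    \<open>n - m\<close>.\<close>
  define k where "k = Suc (nat (n - m))"
  define Q where "Q = int k * q"
  define P where "P = int k * p"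
  have "int k * 1 \<le> Q" unfolding Q_def using q by (intro mult_left_mono) auto
  then have nQ: "n < m + Q" using mn by (simp add: k_def)
  then have Q: "0 < Q" using mn by linarith
  have zm: "periodic_minimizer P Q z"
    unfolding P_def Q_def by (rule periodic_minimizer_multiple) (use z q p k_def in auto)
  then have pz: "periodic_config P Q z" by (simp add: periodic_minimizer_def)
  define v where "v r = (if r \<le> n then t r else z r)" for r
  have v_end: "v (m + Q) = v m + of_int P * l"
    using pz nQ mn tm unfolding v_def periodic_config_def by auto
  have v_step: "v r \<le> v (r + 1) \<and> v (r + 1) \<le> v r + l" if "m \<le> r" for r
  proof (cases "r < n")
    case True then show ?thesis using adm that unfolding admissible_def v_def by auto
  next
    case False
    then have "v r = z r" "v (r + 1) = z (r + 1)" using tn unfolding v_def by auto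
    then show ?thesis using pz unfolding periodic_config_def by simp
  qed
  \<comment> \<open>The window from \<open>m\<close> to \<open>m + Q\<close>, continued
    periodically; the quotient counts the windows passed.\<close>
  define t' where "t' i = v (m + (i - m) mod Q) + of_int ((i - m) div Q * P) * l" for i
  have t'_next: "t' (i + 1) = v (m + (i - m) mod Q + 1) + of_int ((i - m) div Q * P) * l" for i
  proof -
    define r d where "r = (i - m) mod Q" and "d = (i - m) div Q"
    have i: "i + 1 - m = (r + 1) + d * Q" by (simp add: r_def d_def)
    have r: "0 \<le> r" "r < Q" using Q by (auto simp: r_def)
    show ?thesis
    proof (cases "r + 1 = Q")
      case True
      have "(i + 1 - m) mod Q = 0" "(i + 1 - m) div Q = d + 1" unfolding i True using Q by auto
      then show ?thesis unfolding t'_def r_def[symmetric] d_def[symmetric]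
        using v_end True[symmetric] by (simp add: algebra_simps)
    next
      case False
      then have "(i + 1 - m) mod Q = r + 1" "(i + 1 - m) div Q = d" unfolding i using Q r by auto
      then show ?thesis unfolding t'_def r_def[symmetric] d_def[symmetric] by (simp add: algebra_simps)
    qed
  qed
  have pt': "periodic_config P Q t'"
    unfolding periodic_config_def
  proof (intro allI conjI)
    fix i
    have "m \<le> m + (i - m) mod Q" using Q by simp
    from v_step[OF this] show "t' i \<le> t' (i + 1)" "t' (i + 1) \<le> t' i + l"
      unfolding t'_next by (simp_all add: t'_def)
    have "i + Q - m = (i - m) + Q" by simp
    then show "t' (i + Q) = t' i + of_int P * l"
      unfolding t'_def using Q by (simp only: div_add_self2 mod_add_self2) (simp add: algebra_simps)
  qed
  have t'_eq: "t' i = v i" "t' (i + 1) = v (i + 1)" if "m \<le> i" "i < m + Q" for i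
    using that t'_next[of i] by (auto simp: t'_def)
  have "action 0 Q t' = action m n t' + action n (m + Q) t'"
    using action_period[OF pt' Q, of m] action_split[of m n "m + Q" t'] mn nQ by simp
  moreover have "action m n t' = action m n t"
    unfolding action_def using nQ by (intro sum.cong) (auto simp: t'_eq v_def)
  moreover have "action n (m + Q) t' = action n (m + Q) z"
    unfolding action_def using mn tn by (intro sum.cong) (auto simp: t'_eq v_def)
  moreover have "action 0 Q z = action m n z + action n (m + Q) z"
    using action_period[OF pz Q, of m] action_split[of m n "m + Q" z] mn nQ by simp
  moreover have "action 0 Q z \<le> action 0 Q t'" using zm pt' unfolding periodic_minimizer_def by blast
  ultimately show "action m n z \<le> action m n t" by linarith
qed

lemma admissible_bounds:
  assumes "admissible m n s" "m \<le> i" "i \<le> j" "j \<le> n"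
  shows "s i \<le> s j" "s j \<le> s i + of_int (j - i) * l"
proof -
  have "s i \<le> s j \<and> s j \<le> s i + of_int (j - i) * l"
    using assms(3,4)
  proof (induction j rule: int_ge_induct)
    case (step j)
    moreover have "s j \<le> s (j + 1) \<and> s (j + 1) \<le> s j + l"
      using assms(1,2) step unfolding admissible_def by auto
    ultimately show ?case by (auto simp: algebra_simps)
  qed simp
  then show "s i \<le> s j" "s j \<le> s i + of_int (j - i) * l" by auto
qed

text \<open>An admissible configuration with value \<open>A\<close> at \<open>m\<close> and
  \<open>B\<close> at \<open>n\<close> lies between \<open>A\<close> and
  \<open>A + (i - m) * l\<close>, and between \<open>B - (n - i) * l\<close> and \<open>B\<close>.
  Pushing \<open>u\<close> into this range repairs the endpoints and keeps admissibility, because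
  the barriers are admissible themselves and maxima and minima preserve it.\<close>

definition clamp :: "int \<Rightarrow> int \<Rightarrow> real \<Rightarrow> real \<Rightarrow> (int \<Rightarrow> real) \<Rightarrow> int \<Rightarrow> real" where
  "clamp m n A B u i = max (min (max (u i) A) (min B (A + of_int (i - m) * l))) (B - of_int (n - i) * l)"

lemma clamp_start: "A \<le> B \<Longrightarrow> B \<le> A + of_int (n - m) * l \<Longrightarrow> clamp m n A B u m = A"
  by (simp add: clamp_def)

lemma clamp_end: "A \<le> B \<Longrightarrow> B \<le> A + of_int (n - m) * l \<Longrightarrow> clamp m n A B u n = B"
  by (simp add: clamp_def)

lemma clamp_admissible: "admissible m n u \<Longrightarrow> admissible m n (clamp m n A B u)"
proof -
  have "clamp m n A B u i \<le> clamp m n A B u (i + 1) \<and> clamp m n A B u (i + 1) \<le> clamp m n A B u i + l"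
    if "u i \<le> u (i + 1) \<and> u (i + 1) \<le> u i + l" for i
  proof -
    have 1: "of_int (i + 1 - m) * l = of_int (i - m) * l + l" "of_int (n - i) * l = of_int (n - (i + 1)) * l + l"
      by (simp_all add: algebra_simps)
    show ?thesis unfolding clamp_def 1 using that l_pos by linarith
  qed
  then show "admissible m n u \<Longrightarrow> admissible m n (clamp m n A B u)" unfolding admissible_def by blast
qed

lemma clamp_eq:
  assumes "A \<le> u i" "u i \<le> B" "u i \<le> A + of_int (i - m) * l" "B - of_int (n - i) * l \<le> u i"
  shows "clamp m n A B u i = u i"
  using assms by (simp add: clamp_def)

text \<open>A competitor of the limit has the wrong endpoints for the approximants. Clamping
  corrects them, depends continuously on them, and changes nothing in the limit.\<close>

lemma minimal_limit:
  assumes min: "\<And>k :: nat. minimal (f k)" and lim: "\<And>i. (\<lambda>k. f k i) \<longlonglongrightarrow> g i"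
  shows "minimal g"
  unfolding minimal_def
proof (intro conjI allI impI)
  have adm: "f k i \<le> f k (i + 1) \<and> f k (i + 1) \<le> f k i + l" for k i
    using min[of k] unfolding minimal_def admissible_def by (meson atLeastLessThan_iff order_refl zless_add1_eq)
  show gadm: "admissible m n g" for m n
    unfolding admissible_def
  proof (intro ballI conjI)
    fix i
    show "g i \<le> g (i + 1)" using adm lim[of i] lim[of "i + 1"] by (intro LIMSEQ_le) auto
    show "g (i + 1) \<le> g i + l"
      using adm lim[of "i + 1"] tendsto_add[OF lim[of i] tendsto_const[of l]] by (intro LIMSEQ_le) auto
  qed
  fix m n :: int and t
  assume mn: "m < n" and tm: "t m = g m" and tn: "t n = g n" and t: "admissible m n t"
  have le: "action m n (f k) \<le> action m n (clamp m n (f k m) (f k n) t)" for k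
  proof -
    have "f k m \<le> f k n" "f k n \<le> f k m + of_int (n - m) * l"
      using admissible_bounds[of m n "f k" m n] min[of k] mn unfolding minimal_def by auto
    then show ?thesis
      by (intro minimalD[OF min mn] clamp_start clamp_end clamp_admissible[OF t])
  qed
  have "action m n g \<le> action m n (clamp m n (g m) (g n) t)"
  proof (rule LIMSEQ_le)
    show "(\<lambda>k. action m n (f k)) \<longlonglongrightarrow> action m n g" by (rule action_tendsto[OF lim])
    show "(\<lambda>k. action m n (clamp m n (f k m) (f k n) t)) \<longlonglongrightarrow> action m n (clamp m n (g m) (g n) t)"
      unfolding clamp_def
      by (intro action_tendsto tendsto_max tendsto_min tendsto_add tendsto_diff tendsto_const lim)
    show "\<exists>N. \<forall>k\<ge>N. action m n (f k) \<le> action m n (clamp m n (f k m) (f k n) t)" using le by blast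
  qed
  moreover have "clamp m n (g m) (g n) t i = t i" if "m \<le> i" "i \<le> n" for i
    using admissible_bounds[OF t order_refl that] admissible_bounds[OF t that order_refl] tm tn
    by (intro clamp_eq) auto
  then have "action m n (clamp m n (g m) (g n) t) = action m n t"
    unfolding action_def by (intro sum.cong) auto
  ultimately show "action m n g \<le> action m n t" by simp
qed

text \<open>Rational approximation of \<omega>. The total order of the translates keeps periodic
  minimizers within \<open>l\<close> of a line, whatever their period, so the bound survives the
  limit.\<close>

lemma minimal_exists:
  assumes \<omega>: "0 < \<omega>" "\<omega> < 1"
  obtains z where "minimal z" "\<And>i. \<bar>z i - z 0 - of_int i * \<omega> * l\<bar> \<le> l"
proof -
  define p where "p n = \<lfloor>real (Suc n) * \<omega>\<rfloor>" for n
  define \<rho> where "\<rho> n = of_int (p n) / real (Suc n)" for n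
  have \<rho>: "\<rho> \<longlonglongrightarrow> \<omega>"
  proof (rule LIMSEQ_I)
    fix e :: real assume "0 < e"
    then obtain N where N: "N \<noteq> 0" "inverse (real N) < e" using real_arch_inverse by metis
    have "norm (\<rho> n - \<omega>) < e" if "n \<ge> N" for n
    proof -
      have "\<rho> n - \<omega> = (of_int (p n) - real (Suc n) * \<omega>) / real (Suc n)"
        by (simp add: \<rho>_def diff_divide_distrib)
      moreover have "\<bar>of_int (p n) - real (Suc n) * \<omega>\<bar> \<le> 1" unfolding p_def by linarith
      ultimately have "\<bar>\<rho> n - \<omega>\<bar> \<le> 1 / real (Suc n)"
        using divide_right_mono[of "\<bar>of_int (p n) - real (Suc n) * \<omega>\<bar>" 1 "real (Suc n)"] by simp
      also have "\<dots> \<le> inverse (real N)" using that N by (simp add: field_simps)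
      finally show ?thesis using N by simp
    qed
    then show "\<exists>N. \<forall>n\<ge>N. norm (\<rho> n - \<omega>) < e" by blast
  qed
  have "\<exists>y. minimal y \<and> 0 \<le> y 0 \<and> y 0 \<le> l \<and> (\<forall>i. \<bar>y i - y 0 - of_int i * \<rho> n * l\<bar> \<le> l)" for n
  proof -
    have p: "0 \<le> p n" "p n \<le> int (Suc n)"
    proof -
      show "0 \<le> p n" unfolding p_def using \<omega> by simp
      have "real (Suc n) * \<omega> \<le> real (Suc n)" using \<omega> by (intro mult_left_le) auto
      then have "p n \<le> \<lfloor>real (Suc n)\<rfloor>" unfolding p_def by (rule floor_mono)
      then show "p n \<le> int (Suc n)" by simp
    qed
    obtain x where "periodic_minimizer (p n) (int (Suc n)) x"
      using periodic_minimizer_exists[OF p] by auto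
    then have "periodic_minimizer (1 * p n) (1 * int (Suc n)) x" by simp
    then obtain y where y: "periodic_minimizer (1 * p n) (1 * int (Suc n)) y"
      "\<And>i c d. of_int c * (of_int (p n) / of_int (int (Suc n))) \<le> real_of_int d \<Longrightarrow> y (i + c) - of_int d * l \<le> y i"
      "\<And>i c d. real_of_int d \<le> of_int c * (of_int (p n) / of_int (int (Suc n))) \<Longrightarrow> y i \<le> y (i + c) - of_int d * l"
      by (rule ordered_periodic_minimizer) simp_all
    \<comment> \<open>Rounding \<open>i * \<rho>\<close> up or down to an integer loses at most one
      period in each order relation.\<close>
    have width: "\<bar>y i - y 0 - of_int i * \<rho> n * l\<bar> \<le> l" for i
    proof -
      have \<rho>_eq: "\<rho> n = of_int (p n) / of_int (int (Suc n))" by (simp add: \<rho>_def)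
      have "y i - of_int \<lceil>of_int i * \<rho> n\<rceil> * l \<le> y 0"
        using y(2)[of i "\<lceil>of_int i * \<rho> n\<rceil>" 0, folded \<rho>_eq] by simp
      moreover have "y 0 \<le> y i - of_int \<lfloor>of_int i * \<rho> n\<rfloor> * l"
        using y(3)[of "\<lfloor>of_int i * \<rho> n\<rfloor>" i 0, folded \<rho>_eq] by simp
      moreover have "of_int \<lceil>of_int i * \<rho> n\<rceil> * l \<le> (of_int i * \<rho> n + 1) * l"
        using l_pos by (intro mult_right_mono) linarith+
      moreover have "(of_int i * \<rho> n - 1) * l \<le> of_int \<lfloor>of_int i * \<rho> n\<rfloor> * l"
        using l_pos by (intro mult_right_mono) linarith+
      ultimately show ?thesis unfolding distrib_right left_diff_distrib by linarith
    qed
    obtain k where k: "0 \<le> y 0 + of_int k * l" "y 0 + of_int k * l < l" by (rule normalize_start)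
    let ?y = "\<lambda>i. y i + of_int k * l"
    have "periodic_minimizer (p n) (int (Suc n)) ?y"
      using periodic_minimizer_translate[of "p n" "int (Suc n)" y 0 k] y(1) by simp
    then have "minimal ?y" by (rule periodic_minimizer_minimal) (use p in auto)
    then show ?thesis using k width by (intro exI[of _ ?y]) simp
  qed
  then obtain y where "\<forall>n. minimal (y n) \<and> 0 \<le> y n 0 \<and> y n 0 \<le> l \<and> (\<forall>i. \<bar>y n i - y n 0 - of_int i * \<rho> n * l\<bar> \<le> l)"
    using choice[of "\<lambda>n y. minimal y \<and> 0 \<le> y 0 \<and> y 0 \<le> l \<and> (\<forall>i. \<bar>y i - y 0 - of_int i * \<rho> n * l\<bar> \<le> l)"] by blast
  then have y: "\<And>n. minimal (y n)" "\<And>n. 0 \<le> y n 0 \<and> y n 0 \<le> l"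
    "\<And>n i. \<bar>y n i - y n 0 - of_int i * \<rho> n * l\<bar> \<le> l"
    by auto
  have "y n i \<le> y n (i + 1) \<and> y n (i + 1) \<le> y n i + l" for n i
    using y(1)[of n] unfolding minimal_def admissible_def by (meson atLeastLessThan_iff order_refl zless_add1_eq)
  from configs_convergent_subseq[of y, OF this y(2)]
  obtain k z where k: "strict_mono (k :: nat \<Rightarrow> nat)" and z: "\<And>i. (\<lambda>n. y (k n) i) \<longlonglongrightarrow> z i" by metis
  have "minimal z" by (rule minimal_limit[OF y(1) z])
  moreover have "\<bar>z i - z 0 - of_int i * \<omega> * l\<bar> \<le> l" for i
  proof (rule LIMSEQ_le_const2)
    have "(\<lambda>n. \<rho> (k n)) \<longlonglongrightarrow> \<omega>" using LIMSEQ_subseq_LIMSEQ[OF \<rho> k] by (simp add: o_def)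
    then show "(\<lambda>n. \<bar>y (k n) i - y (k n) 0 - of_int i * \<rho> (k n) * l\<bar>) \<longlonglongrightarrow> \<bar>z i - z 0 - of_int i * \<omega> * l\<bar>"
      by (intro tendsto_intros z)
  qed (use y(3) in blast)
  ultimately show ?thesis by (rule that)
qed

text \<open>The competitor for \<open>s\<close> is \<open>s'\<close>, translated to start less than
  \<open>l\<close> above \<open>s\<close> and clamped to the endpoints of \<open>s\<close>. The
  barriers of the clamp have slopes 0 and \<open>l\<close> and separate from the line of slope
  \<open>\<omega> * l\<close> at rate at least \<open>min \<omega> (1 - \<omega>) * l\<close>. So
  they interfere only within \<open>(1 + 2 * e) / min \<omega> (1 - \<omega>)\<close> indices of the
  ends, with 1 for the offset of the starts and \<open>2 * e\<close> for the two displacement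
  errors. Every altered term costs at most \<open>2 * K\<close>.\<close>

lemma minimal_action_comparison:
  fixes N :: nat
  assumes s: "minimal s" and s': "admissible m' (m' + int N) s'" and \<omega>: "0 < \<omega>" "\<omega> < 1"
    and e: "0 \<le> e"
    and disp: "\<bar>s (m + int N) - s m - real N * \<omega> * l\<bar> \<le> e * l"
    and disp': "\<And>j. 0 \<le> j \<Longrightarrow> j \<le> int N \<Longrightarrow> \<bar>s' (m' + j) - s' m' - of_int j * \<omega> * l\<bar> \<le> e * l"
  shows "action m (m + int N) s \<le> action m' (m' + int N) s' + 4 * K * ((1 + 2 * e) / min \<omega> (1 - \<omega>) + 1)"
proof -
  have K: "0 \<le> K" using h_bounded[of 0 0] by linarith
  define \<mu> where "\<mu> = min \<omega> (1 - \<omega>)"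
  have \<mu>: "0 < \<mu>" "\<mu> \<le> \<omega>" "\<mu> \<le> 1 - \<omega>" using \<omega> by (auto simp: \<mu>_def)
  define \<kappa> where "\<kappa> = (1 + 2 * e) / \<mu>"
  have \<kappa>: "0 < \<kappa>" using e \<mu> by (simp add: \<kappa>_def)
  show ?thesis
  proof (cases "N = 0")
    case True then show ?thesis using K \<kappa> by (simp add: action_def \<kappa>_def \<mu>_def)
  next
    case False
    define n where "n = m + int N"
    have mn: "m < n" using False by (simp add: n_def)
    define A B where "A = s m" and "B = s n"
    have sadm: "admissible m n s" using s by (simp add: minimal_def)
    have AB: "A \<le> B" "B \<le> A + of_int (n - m) * l"
      using admissible_bounds[OF sadm, of m n] mn by (auto simp: A_def B_def)
    obtain c :: int where c: "0 \<le> s' m' - A + of_int c * l" "s' m' - A + of_int c * l < l"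
      by (rule normalize_start)
    define u where "u i = s' (i + (m' - m)) + of_int c * l" for i
    have au: "action m n u = action m' (m' + int N) s'"
      unfolding u_def action_shift[of m n "\<lambda>i. s' (i + (m' - m))" c] action_translate[of m n s' "m' - m"]
      by (simp add: n_def add.commute)
    have uadm: "admissible m n u"
      unfolding admissible_def
    proof
      fix i assume "i \<in> {m..<n}"
      then have "i + (m' - m) \<in> {m'..<m' + int N}" by (auto simp: n_def)
      moreover have eq: "i + 1 + (m' - m) = i + (m' - m) + 1" by simp
      ultimately show "u i \<le> u (i + 1) \<and> u (i + 1) \<le> u i + l"
        using s'[unfolded admissible_def, rule_format, of "i + (m' - m)"] unfolding u_def eq by simp
    qed
    define t where "t = clamp m n A B u"
    have "action m n s \<le> action m n t"
      unfolding t_def using clamp_start[OF AB] clamp_end[OF AB] clamp_admissible[OF uadm]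
      by (intro minimalD[OF s mn]) (simp_all add: A_def B_def)
    have tu: "t i = u i" if i: "m \<le> i" "i \<le> n" "\<kappa> \<le> of_int (i - m)" "\<kappa> \<le> of_int (n - i)" for i
      unfolding t_def
    proof (rule clamp_eq)
      define j where "j = i - m"
      have big: "1 + 2 * e \<le> \<mu> * of_int j" "1 + 2 * e \<le> \<mu> * (real N - of_int j)"
      proof -
        have "\<kappa> \<le> of_int j" "\<kappa> \<le> real N - of_int j" using i by (auto simp: j_def n_def)
        then show "1 + 2 * e \<le> \<mu> * of_int j" "1 + 2 * e \<le> \<mu> * (real N - of_int j)"
          using \<mu> by (simp_all add: \<kappa>_def pos_divide_le_eq mult.commute)
      qed
      have j: "0 \<le> real_of_int j" "0 \<le> real N - of_int j" using i by (auto simp: j_def n_def)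
      have ui: "\<bar>u i - u m - of_int j * \<omega> * l\<bar> \<le> e * l"
      proof -
        have eq: "i + (m' - m) = m' + j" by (simp add: j_def)
        have "0 \<le> j" "j \<le> int N" using i by (auto simp: j_def n_def)
        then show ?thesis using disp'[of j] by (simp add: u_def eq)
      qed
      have um: "A \<le> u m" "u m < A + l" using c by (auto simp: u_def)
      have B: "\<bar>B - A - real N * \<omega> * l\<bar> \<le> e * l" using disp by (simp add: A_def B_def n_def)
      show "A \<le> u i" using admissible_bounds(1)[OF uadm, of m i] i um by simp
      have "1 + 2 * e \<le> (1 - \<omega>) * of_int j" "1 + 2 * e \<le> \<omega> * (real N - of_int j)"
        "1 + 2 * e \<le> (1 - \<omega>) * (real N - of_int j)"
        using big \<mu> j by (meson mult_right_mono order_trans)+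
      then have "(1 + 2 * e) * l \<le> (1 - \<omega>) * of_int j * l" "(1 + 2 * e) * l \<le> \<omega> * (real N - of_int j) * l"
        "(1 + 2 * e) * l \<le> (1 - \<omega>) * (real N - of_int j) * l"
        using l_pos by (auto intro!: mult_right_mono)
      moreover have "0 \<le> e * l" using e l_pos by simp
      moreover have "of_int (i - m) * l = of_int j * l" "of_int (n - i) * l = real N * l - of_int j * l"
        by (auto simp: j_def n_def algebra_simps)
      ultimately show "u i \<le> A + of_int (i - m) * l" "u i \<le> B" "B - of_int (n - i) * l \<le> u i"
        using ui um B l_pos by (auto simp: algebra_simps abs_le_iff)
    qed
    define D where "D = {m..<m + \<lceil>\<kappa>\<rceil>} \<union> {n - \<lceil>\<kappa>\<rceil>..<n}"
    have "action m n t - action m n u \<le> (\<Sum>i\<in>{m..<n}. if i \<in> D then 2 * K else 0)"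
      unfolding action_def sum_subtractf[symmetric]
    proof (rule sum_mono)
      fix i assume i: "i \<in> {m..<n}"
      show "h (t i) (t (i + 1)) - h (u i) (u (i + 1)) \<le> (if i \<in> D then 2 * K else 0)"
      proof (cases "i \<in> D")
        case True
        then show ?thesis using h_bounded[of "t i" "t (i + 1)"] h_bounded[of "u i" "u (i + 1)"] by auto
      next
        case False
        then have "\<lceil>\<kappa>\<rceil> \<le> i - m" "\<lceil>\<kappa>\<rceil> \<le> n - (i + 1)" using i by (auto simp: D_def)
        then have 1: "\<kappa> \<le> of_int (i - m)" "\<kappa> \<le> of_int (n - (i + 1))" by (simp_all only: ceiling_le_iff)
        then have "t i = u i" using i by (intro tu) auto
        moreover have "t (i + 1) = u (i + 1)" using i 1 by (intro tu) auto
        ultimately show ?thesis using False by simp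
      qed
    qed
    also have "\<dots> = 2 * K * real (card ({m..<n} \<inter> D))"
      by (simp add: sum.If_cases)
    also have "\<dots> \<le> 2 * K * (2 * (\<kappa> + 1))"
    proof (rule mult_left_mono)
      have "card ({m..<n} \<inter> D) \<le> card D" by (intro card_mono) (auto simp: D_def)
      also have "\<dots> \<le> nat \<lceil>\<kappa>\<rceil> + nat \<lceil>\<kappa>\<rceil>" unfolding D_def by (rule order_trans[OF card_Un_le]) simp
      finally have "real (card ({m..<n} \<inter> D)) \<le> 2 * real (nat \<lceil>\<kappa>\<rceil>)" by linarith
      also have "\<dots> \<le> 2 * (\<kappa> + 1)" using \<kappa> by (intro mult_left_mono) linarith+
      finally show "real (card ({m..<n} \<inter> D)) \<le> 2 * (\<kappa> + 1)" .
    qed (use K in simp)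
    also have "\<dots> = 4 * K * (\<kappa> + 1)" by simp
    finally have "action m n s \<le> action m' (m' + int N) s' + 4 * K * (\<kappa> + 1)"
      using \<open>action m n s \<le> action m n t\<close> au by linarith
    then show ?thesis unfolding n_def \<kappa>_def \<mu>_def .
  qed
qed

text \<open>Any two windows of equal length have the same action up to a constant, so the action is
  quasi-additive in the window length.\<close>

lemma minimal_average_converges:
  assumes z: "minimal z" and \<omega>: "0 < \<omega>" "\<omega> < 1" and width: "\<And>i. \<bar>z i - z 0 - of_int i * \<omega> * l\<bar> \<le> l"
  obtains b where "(\<lambda>N. action (- int N) (int N) z / (2 * real N)) \<longlonglongrightarrow> b"
proof -
  \<comment> \<open>The last 2 in \<open>1 + 2 * 2\<close> is the value of \<open>e\<close>: a
    displacement is a difference of two positions, each within \<open>l\<close> of the line.\<close>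
  define C where "C = 4 * K * ((1 + 2 * 2) / min \<omega> (1 - \<omega>) + 1)"
  have w2: "\<bar>z (m + j) - z m - of_int j * \<omega> * l\<bar> \<le> 2 * l" for m j
    using width[of "m + j"] width[of m] by (simp add: algebra_simps abs_le_iff)
  have cmp: "action m (m + int N) z \<le> action m' (m' + int N) z + C" for m m' N
    unfolding C_def using z w2[of m "int N"] w2[of m'] \<omega>
    by (intro minimal_action_comparison) (auto simp: minimal_def)
  have cmp': "\<bar>action m (m + int N) z - action m' (m' + int N) z\<bar> \<le> C" for m m' N
    using cmp[of m N m'] cmp[of m' N m] by linarith
  define F where "F n = action 0 (int n) z" for n
  have "\<bar>F (b * a) - real b * F a\<bar> \<le> real b * C" for a b
  proof (induction b)
    case 0 then show ?case by (simp add: F_def action_def)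
  next
    case (Suc b)
    have "F (Suc b * a) = F (b * a) + action (int (b * a)) (int (b * a) + int a) z"
      unfolding F_def using action_split[of 0 "int (b * a)" "int (Suc b * a)" z] by (simp add: algebra_simps)
    moreover have "\<bar>action (int (b * a)) (int (b * a) + int a) z - F a\<bar> \<le> C"
      using cmp'[of "int (b * a)" a 0] by (simp add: F_def)
    ultimately have "\<bar>F (Suc b * a) - real b * F a - F a\<bar> \<le> real b * C + C" using Suc by linarith
    then show ?case by (simp add: algebra_simps)
  qed
  then obtain v where v: "(\<lambda>n. F n / real n) \<longlonglongrightarrow> v" using quasi_additive_average_converges by blast
  have "(\<lambda>N. F (2 * N) / real (2 * N)) \<longlonglongrightarrow> v"
    using LIMSEQ_subseq_LIMSEQ[OF v, of "\<lambda>N. 2 * N"] by (simp add: o_def strict_mono_def)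
  moreover have "(\<lambda>N. (action (- int N) (int N) z - F (2 * N)) / (2 * real N)) \<longlonglongrightarrow> 0"
  proof (rule Lim_null_comparison)
    show "\<forall>\<^sub>F N in sequentially. norm ((action (- int N) (int N) z - F (2 * N)) / (2 * real N)) \<le> C / (2 * real N)"
    proof (rule always_eventually, rule allI)
      fix N :: nat
      have "\<bar>action (- int N) (int N) z - F (2 * N)\<bar> \<le> C"
        using cmp'[of "- int N" "2 * N" 0] by (simp add: F_def)
      then show "norm ((action (- int N) (int N) z - F (2 * N)) / (2 * real N)) \<le> C / (2 * real N)"
        by (simp add: divide_right_mono)
    qed
    have "(\<lambda>N. C / 2 * (1 / real N)) \<longlonglongrightarrow> C / 2 * 0" by (intro tendsto_mult tendsto_const lim_1_over_n)
    then show "(\<lambda>N. C / (2 * real N)) \<longlonglongrightarrow> 0" by simp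
  qed
  ultimately have "(\<lambda>N. F (2 * N) / real (2 * N) + (action (- int N) (int N) z - F (2 * N)) / (2 * real N)) \<longlonglongrightarrow> v + 0"
    by (rule tendsto_add)
  then show ?thesis using that by (simp add: diff_divide_distrib)
qed

text \<open>Only the rotation number is known here, so over 2N steps the displacement error is a
  small multiple of N rather than bounded. Joining the configurations costs a multiple of that,
  still small after division by 2N.\<close>

lemma minimal_average_le:
  assumes s: "minimal s" and s': "minimal s'" and \<omega>: "0 < \<omega>" "\<omega> < 1"
    and rot: "has_rotation_number l s \<omega>" and rot': "has_rotation_number l s' \<omega>"
    and b: "(\<lambda>N. action (- int N) (int N) s / (2 * real N)) \<longlonglongrightarrow> b"
    and b': "(\<lambda>N. action (- int N) (int N) s' / (2 * real N)) \<longlonglongrightarrow> b'"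
  shows "b \<le> b'"
proof (rule field_le_epsilon)
  fix \<epsilon> :: real assume "0 < \<epsilon>"
  define \<mu> where "\<mu> = min \<omega> (1 - \<omega>)"
  have \<mu>: "0 < \<mu>" using \<omega> by (simp add: \<mu>_def)
  have K: "0 \<le> K" using h_bounded[of 0 0] by linarith
  \<comment> \<open>Chosen so that the surviving term \<open>8 * K * \<delta> / \<mu>\<close> is at
    most \<epsilon>; \<open>K + 1\<close> avoids a division by zero.\<close>
  define \<delta> where "\<delta> = \<epsilon> * \<mu> / (8 * (K + 1))"
  have \<delta>: "0 < \<delta>" using \<open>0 < \<epsilon>\<close> \<mu> K by (simp add: \<delta>_def)
  obtain M where M: "0 < M" "\<And>N i. M \<le> N \<Longrightarrow> \<bar>i\<bar> \<le> int N \<Longrightarrow> \<bar>s i - of_int i * \<omega> * l\<bar> \<le> \<delta> * real N * l"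
    using has_rotation_number_uniform[OF l_pos rot \<delta>] by metis
  obtain M' where M': "0 < M'" "\<And>N i. M' \<le> N \<Longrightarrow> \<bar>i\<bar> \<le> int N \<Longrightarrow> \<bar>s' i - of_int i * \<omega> * l\<bar> \<le> \<delta> * real N * l"
    using has_rotation_number_uniform[OF l_pos rot' \<delta>] by metis
  have cmp: "action (- int N) (int N) s / (2 * real N) \<le>
      action (- int N) (int N) s' / (2 * real N) + 2 * K * (1 / \<mu> + 1) * (1 / real N) + 8 * K * \<delta> / \<mu>"
    if N: "max M M' \<le> N" for N
  proof -
    have N0: "0 < N" using N M(1) by linarith
    define e where "e = 2 * \<delta> * real N"
    have "action (- int N) (- int N + int (2 * N)) s \<le> action (- int N) (- int N + int (2 * N)) s' + 4 * K * ((1 + 2 * e) / min \<omega> (1 - \<omega>) + 1)"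
    proof (rule minimal_action_comparison[OF s _ \<omega>])
      show "admissible (- int N) (- int N + int (2 * N)) s'" using s' by (simp add: minimal_def)
      show "0 \<le> e" using \<delta> by (simp add: e_def)
      show "\<bar>s (- int N + int (2 * N)) - s (- int N) - real (2 * N) * \<omega> * l\<bar> \<le> e * l"
        using M(2)[of N "int N"] M(2)[of N "- int N"] N by (simp add: e_def abs_le_iff algebra_simps)
      show "\<bar>s' (- int N + j) - s' (- int N) - of_int j * \<omega> * l\<bar> \<le> e * l" if "0 \<le> j" "j \<le> int (2 * N)" for j
        using M'(2)[of N "- int N + j"] M'(2)[of N "- int N"] N that by (simp add: e_def abs_le_iff algebra_simps)
    qed
    moreover have "- int N + int (2 * N) = int N" by simp
    ultimately have "action (- int N) (int N) s \<le> action (- int N) (int N) s' + 4 * K * ((1 + 2 * e) / \<mu> + 1)"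
      by (simp add: \<mu>_def)
    from divide_right_mono[OF this, of "2 * real N"] N0 \<mu> show ?thesis
      by (simp add: e_def field_simps)
  qed
  have "b \<le> b' + 2 * K * (1 / \<mu> + 1) * 0 + 8 * K * \<delta> / \<mu>"
  proof (rule LIMSEQ_le[OF b])
    show "(\<lambda>N. action (- int N) (int N) s' / (2 * real N) + 2 * K * (1 / \<mu> + 1) * (1 / real N) + 8 * K * \<delta> / \<mu>)
        \<longlonglongrightarrow> b' + 2 * K * (1 / \<mu> + 1) * 0 + 8 * K * \<delta> / \<mu>"
      by (intro tendsto_add tendsto_mult[OF tendsto_const] b' tendsto_const lim_1_over_n)
    show "\<exists>M. \<forall>N\<ge>M. action (- int N) (int N) s / (2 * real N) \<le>
      action (- int N) (int N) s' / (2 * real N) + 2 * K * (1 / \<mu> + 1) * (1 / real N) + 8 * K * \<delta> / \<mu>"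
      using cmp by blast
  qed
  moreover have "8 * K * \<delta> / \<mu> = \<epsilon> * (K / (K + 1))" proof -
    have "K + 1 \<noteq> 0" using K by simp
    then show ?thesis using \<mu> by (simp add: \<delta>_def divide_simps)
  qed
  moreover have "\<epsilon> * (K / (K + 1)) \<le> \<epsilon>" using \<open>0 < \<epsilon>\<close> K by (intro mult_left_le) auto
  ultimately show "b \<le> b' + \<epsilon>" by simp
qed

end


section \<open>Geometry of the billiard table\<close>

lemma inner_real2: "u \<bullet> v = u $ 1 * v $ 1 + u $ 2 * v $ 2" for u v :: "real^2"
  by (simp add: inner_vec_def sum_2)

lemma vec_eq_2: "u = v \<longleftrightarrow> u $ 1 = v $ 1 \<and> u $ 2 = v $ 2" for u v :: "real^2"
  by (simp add: vec_eq_iff forall_2)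

lemma cross2_simps:
  "cross2 u (v + w) = cross2 u v + cross2 u w" "cross2 u (v - w) = cross2 u v - cross2 u w"
  "cross2 u (c *\<^sub>R v) = c * cross2 u v" "cross2 u 0 = 0" "cross2 u (- v) = - cross2 u v"
  by (simp_all add: cross2_def algebra_simps)

lemma bounded_linear_cross2: "bounded_linear (cross2 u)"
  unfolding cross2_def
  by (intro bounded_linear_sub bounded_linear_const_mult bounded_linear_vec_nth)

lemma cross2_has_real_derivative:
  assumes "(f has_vector_derivative f') (at t)"
  shows "((\<lambda>t. cross2 u (f t)) has_real_derivative cross2 u f') (at t)"
  using bounded_linear.has_vector_derivative[OF bounded_linear_cross2 assms]
  by (simp add: has_real_derivative_iff_has_vector_derivative)

lemma inner_has_real_derivative:
  fixes f g :: "real \<Rightarrow> 'a::real_inner"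
  assumes "(f has_vector_derivative f') (at t)" "(g has_vector_derivative g') (at t)"
  shows "((\<lambda>t. f t \<bullet> g t) has_real_derivative f t \<bullet> g' + f' \<bullet> g t) (at t)"
  using bounded_bilinear.has_vector_derivative[OF bounded_bilinear_inner assms]
  by (simp add: has_real_derivative_iff_has_vector_derivative)

lemma vec_nth_has_real_derivative:
  fixes f :: "real \<Rightarrow> real^'n"
  assumes "(f has_vector_derivative f') (at t)"
  shows "((\<lambda>t. f t $ i) has_real_derivative f' $ i) (at t)"
  using bounded_linear.has_vector_derivative[OF bounded_linear_vec_nth assms]
  by (simp add: has_real_derivative_iff_has_vector_derivative)

lemma dist_has_real_derivative:
  fixes f :: "real \<Rightarrow> 'a::real_inner"
  assumes "(f has_vector_derivative f') (at t)" "f t \<noteq> p"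
  shows "((\<lambda>t. dist p (f t)) has_real_derivative sgn (f t - p) \<bullet> f') (at t)"
proof -
  have "((\<lambda>t. f t - p) has_derivative (\<lambda>x. x *\<^sub>R f')) (at t)"
    using assms(1) unfolding has_vector_derivative_def by (auto intro!: derivative_eq_intros)
  from has_derivative_compose[OF this has_derivative_norm] assms(2)
  have "((\<lambda>t. norm (f t - p)) has_derivative (\<lambda>x. (x *\<^sub>R f') \<bullet> sgn (f t - p))) (at t)" by simp
  then show ?thesis
    by (simp add: has_field_derivative_def dist_norm norm_minus_commute inner_commute mult_commute_abs)
qed

lemma antiderivative_exists:
  fixes f :: "real \<Rightarrow> real"
  assumes "continuous_on UNIV f"
  obtains F where "\<And>x. (F has_real_derivative f x) (at x)"
proof -
  have "isCont f x" for x using assms continuous_on_eq_continuous_at by blast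
  then show ?thesis
    using einterval_antiderivative[of "-\<infinity>" "\<infinity>" f] that
    by (auto simp: has_real_derivative_iff_has_vector_derivative)
qed

text \<open>The diagonals meet, in a point \<open>P\<close>; the triangle inequality is applied to its two halves.\<close>

lemma quadrilateral_diagonals:
  fixes A B C D :: "real^2"
  assumes pos: "0 < cross2 (B - A) (C - A)" "0 < cross2 (B - A) (D - A)"
    "0 < cross2 (C - A) (D - A)" "0 < cross2 (C - B) (D - B)"
  shows "dist A D + dist B C \<le> dist A C + dist B D"
proof -
  \<comment> \<open>Twice the areas of the triangles BCD, ACD, ABD and ABC. Both
    \<open>a + c\<close> and \<open>b + d\<close> are twice the area of the quadrilateral, and
    \<open>P\<close> has weights \<open>a\<close>, \<open>c\<close> on one diagonal and
    \<open>b\<close>, \<open>d\<close> on the other.\<close>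
  define a b c d where "a = cross2 (C - B) (D - B)" and "b = cross2 (C - A) (D - A)"
    and "c = cross2 (B - A) (D - A)" and "d = cross2 (B - A) (C - A)"
  have ac: "a + c = b + d" by (simp add: a_def b_def c_def d_def cross2_def algebra_simps)
  have pos': "0 < a" "0 < b" "0 < c" "0 < d" using pos by (simp_all add: a_def b_def c_def d_def)
  have id: "a *\<^sub>R A + c *\<^sub>R C = b *\<^sub>R B + d *\<^sub>R D"
    unfolding vec_eq_2 by (simp add: a_def b_def c_def d_def cross2_def algebra_simps)
  define P where "P = (1 / (a + c)) *\<^sub>R (a *\<^sub>R A + c *\<^sub>R C)"
  have "P \<in> closed_segment A C"
    unfolding closed_segment_def using pos'
    by (intro CollectI exI[of _ "c / (a + c)"]) (simp add: P_def scaleR_add_right diff_divide_distrib[symmetric] field_simps)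
  moreover have "P \<in> closed_segment B D"
    unfolding closed_segment_def using pos'
    by (intro CollectI exI[of _ "d / (b + d)"]) (simp add: P_def id ac scaleR_add_right field_simps)
  ultimately have "dist A C = dist A P + dist P C" "dist B D = dist B P + dist P D"
    using between between_mem_segment by metis+
  moreover have "dist A D \<le> dist A P + dist P D" "dist B C \<le> dist B P + dist P C"
    by (rule dist_triangle)+
  ultimately show ?thesis by linarith
qed

section \<open>Frenet frame and strict convexity of the boundary\<close>

locale billiard =
  fixes \<Omega> :: "(real^2) set" and l :: real and \<gamma> :: "real \<Rightarrow> real^2"
  assumes table: "billiard_table \<Omega> l \<gamma>"
begin

definition deriv_n :: "nat \<Rightarrow> real \<Rightarrow> real^2" where
  "deriv_n n = (curve_deriv ^^ n) \<gamma>"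

abbreviation \<gamma>1 :: "real \<Rightarrow> real^2" where "\<gamma>1 \<equiv> curve_deriv \<gamma>"
abbreviation \<gamma>2 :: "real \<Rightarrow> real^2" where "\<gamma>2 \<equiv> curve_deriv \<gamma>1"

definition \<kappa> :: "real \<Rightarrow> real" where "\<kappa> s = cross2 (\<gamma>1 s) (\<gamma>2 s)"

lemma l_pos: "0 < l"
  using table by (simp add: billiard_table_def simple_closed_curve_def)

lemma \<gamma>_period: "\<gamma> (t + l) = \<gamma> t"
  using table by (simp add: billiard_table_def simple_closed_curve_def)

lemma \<kappa>_pos: "0 < \<kappa> s"
  using table by (simp add: billiard_table_def \<kappa>_def)

lemma unit_speed: "\<gamma>1 s \<bullet> \<gamma>1 s = 1"
  using table by (simp add: billiard_table_def norm_eq_1)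

lemma deriv_n_simps [simp]: "deriv_n 0 = \<gamma>" "deriv_n (Suc 0) = \<gamma>1" "deriv_n 2 = \<gamma>2"
  by (simp_all add: deriv_n_def numeral_2_eq_2)

lemma deriv_n_has_derivative: "(deriv_n n has_vector_derivative deriv_n (Suc n) t) (at t)"
proof -
  have "deriv_n n differentiable (at t)"
    using table unfolding billiard_table_def smooth_curve_def deriv_n_def by blast
  then show ?thesis by (simp add: deriv_n_def curve_deriv_def vector_derivative_works[symmetric])
qed

lemma \<gamma>_has_derivative: "(\<gamma> has_vector_derivative \<gamma>1 t) (at t)"
  and \<gamma>1_has_derivative: "(\<gamma>1 has_vector_derivative \<gamma>2 t) (at t)"
  using deriv_n_has_derivative[of 0 t] deriv_n_has_derivative[of 1 t] by (simp_all add: numeral_2_eq_2[symmetric])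

lemma deriv_n_continuous: "continuous_on S (deriv_n n)"
  by (intro continuous_at_imp_continuous_on ballI has_vector_derivative_continuous[OF deriv_n_has_derivative])

lemma deriv_n_period: "deriv_n n (t + l) = deriv_n n t"
proof (induction n arbitrary: t)
  case 0 then show ?case by (simp add: \<gamma>_period)
next
  case (Suc n)
  have "((\<lambda>x. deriv_n n (x + l)) has_vector_derivative deriv_n (Suc n) (t + l)) (at t)"
    using vector_diff_chain_at[of "\<lambda>x. x + l" 1 t "deriv_n n" "deriv_n (Suc n) (t + l)"]
      deriv_n_has_derivative[of n "t + l"]
      has_vector_derivative_add[OF has_vector_derivative_id has_vector_derivative_const[of l], of "at t"]
    by (simp add: o_def)
  then have "(deriv_n n has_vector_derivative deriv_n (Suc n) (t + l)) (at t)"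
    using Suc by simp
  then show ?case using deriv_n_has_derivative vector_derivative_unique_at by blast
qed

lemma \<gamma>1_orthogonal: "\<gamma>1 s \<bullet> \<gamma>2 s = 0"
proof -
  have "((\<lambda>t. \<gamma>1 t \<bullet> \<gamma>1 t) has_real_derivative \<gamma>1 s \<bullet> \<gamma>2 s + \<gamma>2 s \<bullet> \<gamma>1 s) (at s)"
    by (intro inner_has_real_derivative \<gamma>1_has_derivative)
  then have "((\<lambda>t. 1) has_real_derivative \<gamma>1 s \<bullet> \<gamma>2 s + \<gamma>2 s \<bullet> \<gamma>1 s) (at s)"
    by (simp add: unit_speed)
  then have "\<gamma>1 s \<bullet> \<gamma>2 s + \<gamma>2 s \<bullet> \<gamma>1 s = 0" using DERIV_unique DERIV_const by blast
  then show ?thesis by (simp add: inner_commute)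
qed

lemma frenet: "\<gamma>2 s $ 1 = - \<kappa> s * \<gamma>1 s $ 2" "\<gamma>2 s $ 2 = \<kappa> s * \<gamma>1 s $ 1"
proof -
  have u: "\<gamma>1 s $ 1 * \<gamma>1 s $ 1 + \<gamma>1 s $ 2 * \<gamma>1 s $ 2 = 1" using unit_speed[of s] by (simp add: inner_real2)
  have o: "\<gamma>1 s $ 1 * \<gamma>2 s $ 1 + \<gamma>1 s $ 2 * \<gamma>2 s $ 2 = 0" using \<gamma>1_orthogonal[of s] by (simp add: inner_real2)
  have k: "\<kappa> s = \<gamma>1 s $ 1 * \<gamma>2 s $ 2 - \<gamma>1 s $ 2 * \<gamma>2 s $ 1" by (simp add: \<kappa>_def cross2_def)
  show "\<gamma>2 s $ 1 = - \<kappa> s * \<gamma>1 s $ 2" "\<gamma>2 s $ 2 = \<kappa> s * \<gamma>1 s $ 1"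
    using u o k by algebra+
qed

lemma curvature_norm: "\<gamma>2 s \<bullet> \<gamma>2 s = (\<kappa> s)\<^sup>2"
proof -
  have "\<gamma>2 s \<bullet> \<gamma>2 s = (\<kappa> s)\<^sup>2 * (\<gamma>1 s \<bullet> \<gamma>1 s)"
    unfolding inner_real2 frenet by (simp add: power2_eq_square algebra_simps)
  then show ?thesis by (simp add: unit_speed)
qed

lemma \<gamma>_continuous: "continuous_on S \<gamma>"
  using deriv_n_continuous[of S 0] by simp

lemma \<kappa>_continuous: "continuous_on S \<kappa>"
  using deriv_n_continuous[of S 1] deriv_n_continuous[of S 2]
  unfolding \<kappa>_def cross2_def by (auto intro!: continuous_intros)

lemma \<kappa>_period: "\<kappa> (t + l) = \<kappa> t"
  using deriv_n_period[of 1 t] deriv_n_period[of 2 t] by (simp add: \<kappa>_def)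

text \<open>By the Frenet equations, the tangent turned back by an antiderivative of \<kappa> is a
  constant unit vector; its angle is the constant of integration.\<close>

lemma tangent_angle_exists:
  obtains \<theta> where "\<And>s. (\<theta> has_real_derivative \<kappa> s) (at s)"
    "\<And>s. \<gamma>1 s $ 1 = cos (\<theta> s)" "\<And>s. \<gamma>1 s $ 2 = sin (\<theta> s)"
proof -
  obtain T where T: "\<And>s. (T has_real_derivative \<kappa> s) (at s)"
    using antiderivative_exists[OF \<kappa>_continuous] by blast
  define C S where "C s = \<gamma>1 s $ 1 * cos (T s) + \<gamma>1 s $ 2 * sin (T s)"
    and "S s = \<gamma>1 s $ 2 * cos (T s) - \<gamma>1 s $ 1 * sin (T s)" for s
  note d = vec_nth_has_real_derivative[OF \<gamma>1_has_derivative]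
  have "(C has_real_derivative 0) (at s)" for s
    unfolding C_def
    by (rule derivative_eq_intros d T refl)+ (simp add: frenet algebra_simps)
  then have C: "C s = C 0" for s using DERIV_isconst_all by blast
  have "(S has_real_derivative 0) (at s)" for s
    unfolding S_def
    by (rule derivative_eq_intros d T refl)+ (simp add: frenet algebra_simps)
  then have S: "S s = S 0" for s using DERIV_isconst_all by blast
  have cs: "(cos (T s))\<^sup>2 + (sin (T s))\<^sup>2 = 1" for s by simp
  have u: "(\<gamma>1 0 $ 1)\<^sup>2 + (\<gamma>1 0 $ 2)\<^sup>2 = 1" using unit_speed[of 0] by (simp add: inner_real2 power2_eq_square)
  have "(C 0)\<^sup>2 + (S 0)\<^sup>2 = 1"
    using u cs[of 0] unfolding C_def S_def by algebra
  then obtain \<phi> where \<phi>: "C 0 = cos \<phi>" "S 0 = sin \<phi>" using sincos_total_2pi by metis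
  have 1: "\<gamma>1 s $ 1 = C s * cos (T s) - S s * sin (T s)" "\<gamma>1 s $ 2 = S s * cos (T s) + C s * sin (T s)" for s
    using cs[of s] unfolding C_def S_def by algebra+
  show ?thesis
  proof (rule that[of "\<lambda>s. \<phi> + T s"])
    show "((\<lambda>s. \<phi> + T s) has_real_derivative \<kappa> s) (at s)" for s
      by (rule derivative_eq_intros T refl)+ simp
    show "\<gamma>1 s $ 1 = cos (\<phi> + T s)" "\<gamma>1 s $ 2 = sin (\<phi> + T s)" for s
      unfolding 1 C[of s] S[of s] \<phi> cos_add sin_add by simp_all
  qed
qed

lemma support: "x \<in> closure \<Omega> \<Longrightarrow> 0 \<le> cross2 (\<gamma>1 s) (x - \<gamma> s)"
proof -
  have "closed {x. 0 \<le> cross2 (\<gamma>1 s) (x - \<gamma> s)}"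
    by (intro closed_Collect_le continuous_intros
      bounded_linear.continuous_on[OF bounded_linear_cross2])
  moreover have "\<Omega> \<subseteq> {x. 0 \<le> cross2 (\<gamma>1 s) (x - \<gamma> s)}"
    using table unfolding billiard_table_def by (blast intro: less_imp_le)
  ultimately show "x \<in> closure \<Omega> \<Longrightarrow> 0 \<le> cross2 (\<gamma>1 s) (x - \<gamma> s)"
    using closure_minimal by blast
qed

lemma range_\<gamma>: "range \<gamma> = frontier \<Omega>"
  using table by (simp add: billiard_table_def)

lemma \<gamma>_in_closure: "\<gamma> t \<in> closure \<Omega>"
  using range_\<gamma> by (metis Diff_iff frontier_def rangeI)

lemma support_\<gamma>: "0 \<le> cross2 (\<gamma>1 s) (\<gamma> t - \<gamma> s)"
  by (rule support[OF \<gamma>_in_closure])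

text \<open>
  Otherwise a whole segment of the boundary lies on the tangent line, although the tangent
  direction is parallel to that line at countably many parameters only.
\<close>

lemma strict_support: "\<gamma> t \<noteq> \<gamma> s \<Longrightarrow> 0 < cross2 (\<gamma>1 s) (\<gamma> t - \<gamma> s)"
proof (rule ccontr)
  assume ne: "\<gamma> t \<noteq> \<gamma> s" and "\<not> 0 < cross2 (\<gamma>1 s) (\<gamma> t - \<gamma> s)"
  then have zero: "cross2 (\<gamma>1 s) (\<gamma> t - \<gamma> s) = 0" using support_\<gamma>[of s t] by linarith
  obtain \<theta> where \<theta>: "\<And>s. (\<theta> has_real_derivative \<kappa> s) (at s)"
    "\<And>s. \<gamma>1 s $ 1 = cos (\<theta> s)" "\<And>s. \<gamma>1 s $ 2 = sin (\<theta> s)"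
    using tangent_angle_exists by blast
  have mono: "\<theta> a < \<theta> b" if "a < b" for a b
    by (rule DERIV_pos_imp_increasing[OF that]) (use \<theta>(1) \<kappa>_pos in blast)
  define Z where "Z = {u. cross2 (\<gamma>1 s) (\<gamma> u - \<gamma> s) = 0}"
  have "inj_on \<theta> Z" using mono by (metis inj_onI linorder_less_linear less_irrefl)
  moreover have "\<theta> ` Z \<subseteq> range (\<lambda>i::int. \<theta> s + of_int i * pi)"
  proof
    fix y assume "y \<in> \<theta> ` Z"
    then obtain u where u: "y = \<theta> u" "cross2 (\<gamma>1 s) (\<gamma> u - \<gamma> s) = 0" by (auto simp: Z_def)
    \<comment> \<open>On \<open>Z\<close> the nonnegative support function attains its minimum 0, so
      its derivative vanishes and the tangents at \<open>u\<close> and \<open>s\<close> are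
      parallel.\<close>
    have "((\<lambda>u. \<gamma> u - \<gamma> s) has_vector_derivative \<gamma>1 u) (at u)"
      using has_vector_derivative_diff[OF \<gamma>_has_derivative[of u] has_vector_derivative_const[of "\<gamma> s"]] by simp
    from cross2_has_real_derivative[OF this, of "\<gamma>1 s"]
    have "cross2 (\<gamma>1 s) (\<gamma>1 u) = 0"
      using DERIV_local_min[of "\<lambda>u. cross2 (\<gamma>1 s) (\<gamma> u - \<gamma> s)" _ u 1] support_\<gamma> u(2) by simp
    then have "sin (\<theta> u - \<theta> s) = 0"
      by (simp add: cross2_def \<theta> sin_diff mult.commute)
    then obtain i :: int where "\<theta> u - \<theta> s = of_int i * pi" by (auto simp: sin_zero_iff_int2)
    then show "y \<in> range (\<lambda>i::int. \<theta> s + of_int i * pi)" using u(1) by (auto simp: algebra_simps)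
  qed
  then have "countable (\<theta> ` Z)" by (rule countable_subset) simp
  ultimately have "countable (\<gamma> ` Z)" using countable_image_inj_on by blast
  moreover have "closed_segment (\<gamma> s) (\<gamma> t) \<subseteq> \<gamma> ` Z"
  proof
    fix x assume x: "x \<in> closed_segment (\<gamma> s) (\<gamma> t)"
    then obtain v where "x = (1 - v) *\<^sub>R \<gamma> s + v *\<^sub>R \<gamma> t" by (auto simp: closed_segment_def)
    then have "x - \<gamma> s = v *\<^sub>R (\<gamma> t - \<gamma> s)" by (simp add: algebra_simps)
    then have x0: "cross2 (\<gamma>1 s) (x - \<gamma> s) = 0" using zero by (simp add: cross2_simps(3))
    \<comment> \<open>The segment stays in the closure and on the tangent line, which misses the
      open domain, so all its points are boundary points.\<close>
    have "convex (closure \<Omega>)" using table by (simp add: billiard_table_def convex_closure)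
    then have "x \<in> closure \<Omega>" using x \<gamma>_in_closure closed_segment_subset by blast
    moreover have "x \<notin> \<Omega>" using x0 table unfolding billiard_table_def by (metis less_irrefl)
    moreover have "interior \<Omega> = \<Omega>" using table by (simp add: billiard_table_def interior_open)
    ultimately have "x \<in> range \<gamma>" unfolding range_\<gamma> frontier_def by simp
    then show "x \<in> \<gamma> ` Z" using x0 by (auto simp: Z_def)
  qed
  ultimately have "countable (closed_segment (\<gamma> s) (\<gamma> t))" using countable_subset by blast
  then show False using uncountable_closed_segment ne by metis
qed

lemma \<gamma>_period_int: "\<gamma> (t + of_int k * l) = \<gamma> t"
proof (induction k rule: int_induct[where k = 0])
  case (step1 i) then show ?case using \<gamma>_period[of "t + of_int i * l"] by (simp add: algebra_simps)
next
  case (step2 i) then show ?case using \<gamma>_period[of "t + of_int (i - 1) * l"] by (simp add: algebra_simps)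
qed simp

lemma \<gamma>_neq: "s < t \<Longrightarrow> t < s + l \<Longrightarrow> \<gamma> s \<noteq> \<gamma> t"
proof
  assume st: "s < t" "t < s + l" and eq: "\<gamma> s = \<gamma> t"
  define r where "r x = x - of_int \<lfloor>x / l\<rfloor> * l" for x
  have r: "r x \<in> {0..<l}" for x
    using l_pos floor_divide_lower[of l x] floor_divide_upper[of l x] by (simp add: r_def algebra_simps)
  have "\<gamma> (r x) = \<gamma> x" for x
    using \<gamma>_period_int[of x "- \<lfloor>x / l\<rfloor>"] by (simp add: r_def)
  then have "r s = r t"
    using eq r table unfolding billiard_table_def simple_closed_curve_def inj_on_def by metis
  then have "t - s = of_int (\<lfloor>t / l\<rfloor> - \<lfloor>s / l\<rfloor>) * l" by (simp add: r_def algebra_simps)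
  then have "0 < of_int (\<lfloor>t / l\<rfloor> - \<lfloor>s / l\<rfloor>) * l" "of_int (\<lfloor>t / l\<rfloor> - \<lfloor>s / l\<rfloor>) * l < 1 * l"
    using st by linarith+
  then have "0 < real_of_int (\<lfloor>t / l\<rfloor> - \<lfloor>s / l\<rfloor>)" "real_of_int (\<lfloor>t / l\<rfloor> - \<lfloor>s / l\<rfloor>) < 1"
    using l_pos by (simp_all only: zero_less_mult_iff mult_less_cancel_right) auto
  then have "0 < \<lfloor>t / l\<rfloor> - \<lfloor>s / l\<rfloor>" "\<lfloor>t / l\<rfloor> - \<lfloor>s / l\<rfloor> < 1"
    by (simp_all only: of_int_0_less_iff of_int_less_1_iff)
  then show False by linarith
qed

text \<open>Testing with the tangent at the middle point writes 0 as a convex combination of two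
  nonnegative support values; both vanish, and strict support identifies the points.\<close>

lemma not_strictly_between:
  assumes "\<gamma> m = (1 - u) *\<^sub>R \<gamma> p + u *\<^sub>R \<gamma> r" "0 < u" "u < 1"
  shows "\<gamma> p = \<gamma> m" "\<gamma> r = \<gamma> m"
proof -
  have "(1 - u) *\<^sub>R (\<gamma> p - \<gamma> m) + u *\<^sub>R (\<gamma> r - \<gamma> m) = 0"
    by (subst (1 2) assms(1)) (simp add: algebra_simps)
  then have "(1 - u) * cross2 (\<gamma>1 m) (\<gamma> p - \<gamma> m) + u * cross2 (\<gamma>1 m) (\<gamma> r - \<gamma> m) = 0"
    by (metis cross2_simps(1,3,4))
  moreover have "0 \<le> (1 - u) * cross2 (\<gamma>1 m) (\<gamma> p - \<gamma> m)" "0 \<le> u * cross2 (\<gamma>1 m) (\<gamma> r - \<gamma> m)"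
    using assms(2,3) support_\<gamma> by simp_all
  ultimately have "(1 - u) * cross2 (\<gamma>1 m) (\<gamma> p - \<gamma> m) = 0" "u * cross2 (\<gamma>1 m) (\<gamma> r - \<gamma> m) = 0"
    by linarith+
  then show "\<gamma> p = \<gamma> m" "\<gamma> r = \<gamma> m"
    using assms strict_support[of p m] strict_support[of r m] by auto
qed

lemma boundary_not_in_open_segment: "\<gamma> m \<notin> open_segment (\<gamma> p) (\<gamma> r)"
proof
  assume "\<gamma> m \<in> open_segment (\<gamma> p) (\<gamma> r)"
  then obtain u where "\<gamma> p \<noteq> \<gamma> r" "0 < u" "u < 1" "\<gamma> m = (1 - u) *\<^sub>R \<gamma> p + u *\<^sub>R \<gamma> r"
    unfolding in_segment by blast
  then show False using not_strictly_between[of m u p r] by metis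
qed

text \<open>The closed bound \<open>r \<le> p + l\<close> admits a full turn, where the left side is
  0.\<close>

lemma strict_triangle:
  assumes "p < y" "y < r" "r \<le> p + l"
  shows "dist (\<gamma> p) (\<gamma> r) < dist (\<gamma> p) (\<gamma> y) + dist (\<gamma> y) (\<gamma> r)"
proof (rule ccontr)
  assume "\<not> ?thesis"
  then have "dist (\<gamma> p) (\<gamma> r) = dist (\<gamma> p) (\<gamma> y) + dist (\<gamma> y) (\<gamma> r)"
    using dist_triangle[of "\<gamma> p" "\<gamma> r" "\<gamma> y"] by linarith
  then have "\<gamma> y \<in> closed_segment (\<gamma> p) (\<gamma> r)"
    unfolding between_mem_segment[symmetric] between .
  moreover have "\<gamma> p \<noteq> \<gamma> y" "\<gamma> y \<noteq> \<gamma> r" using assms \<gamma>_neq[of p y] \<gamma>_neq[of y r] by simp_all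
  ultimately show False using boundary_not_in_open_segment[of y p r] by (simp add: open_segment_def)
qed

text \<open>One of three collinear points lies between the other two, which strict convexity
  excludes; the cases locate \<open>\<gamma> c\<close> on the line through \<open>\<gamma> a\<close>
  and \<open>\<gamma> b\<close>.\<close>

lemma noncollinear:
  assumes "\<gamma> a \<noteq> \<gamma> b" "\<gamma> b \<noteq> \<gamma> c" "\<gamma> a \<noteq> \<gamma> c"
  shows "cross2 (\<gamma> b - \<gamma> a) (\<gamma> c - \<gamma> a) \<noteq> 0"
proof
  assume 0: "cross2 (\<gamma> b - \<gamma> a) (\<gamma> c - \<gamma> a) = 0"
  define v w where "v = \<gamma> b - \<gamma> a" and "w = \<gamma> c - \<gamma> a"
  have v: "v \<noteq> 0" using assms by (simp add: v_def)
  define r where "r = (v \<bullet> w) / (v \<bullet> v)"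
  have vv: "v \<bullet> v \<noteq> 0" using v by simp
  have c0: "v $ 1 * w $ 2 = v $ 2 * w $ 1" using 0 by (simp add: v_def w_def cross2_def)
  have "(v \<bullet> v) *\<^sub>R w = (v \<bullet> w) *\<^sub>R v"
    unfolding vec_eq_2 inner_real2 using c0 by (simp, algebra)
  then have w: "w = r *\<^sub>R v"
    using vv by (metis divide_inverse_commute r_def scaleR_left_imp_eq scaleR_scaleR nonzero_mult_div_cancel_left times_divide_eq_right)
  have c: "\<gamma> c = (1 - r) *\<^sub>R \<gamma> a + r *\<^sub>R \<gamma> b" using w by (simp add: v_def w_def algebra_simps)
  consider "r < 0" | "r = 0" | "0 < r" "r < 1" | "r = 1" | "1 < r" by linarith
  then show False
  proof cases
    case 1
    have "(1 - r) *\<^sub>R \<gamma> a = (1 - r) *\<^sub>R ((1 - (- r / (1 - r))) *\<^sub>R \<gamma> c + (- r / (1 - r)) *\<^sub>R \<gamma> b)"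
    proof -
      have "(1 - r) * (1 - (- r / (1 - r))) = 1" "(1 - r) * (- r / (1 - r)) = - r" using 1 by (simp_all add: field_simps)
      then show ?thesis unfolding scaleR_add_right scaleR_scaleR by (simp add: c)
    qed
    then have "\<gamma> a = (1 - (- r / (1 - r))) *\<^sub>R \<gamma> c + (- r / (1 - r)) *\<^sub>R \<gamma> b" using 1 by (simp del: scaleR_add_right)
    from not_strictly_between[OF this] 1 assms show False by (simp add: divide_simps)
  next
    case 3
    from not_strictly_between[OF c] 3 assms show False by simp
  next
    case 5
    have "r *\<^sub>R \<gamma> b = r *\<^sub>R ((1 - 1 / r) *\<^sub>R \<gamma> a + (1 / r) *\<^sub>R \<gamma> c)"
    proof -
      have "r * (1 - 1 / r) = r - 1" "r * (1 / r) = 1" using 5 by (simp_all add: field_simps)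
      then show ?thesis unfolding scaleR_add_right scaleR_scaleR by (simp add: c algebra_simps)
    qed
    then have "\<gamma> b = (1 - 1 / r) *\<^sub>R \<gamma> a + (1 / r) *\<^sub>R \<gamma> c" using 5 by (simp del: scaleR_add_right)
    from not_strictly_between[OF this] 5 assms show False by simp
  qed (use c assms in auto)
qed

text \<open>Just after \<open>b\<close> the sign is positive by strict support at \<open>b\<close>;
  a nonpositive value at \<open>c\<close> would produce a collinear triple on the way.\<close>

lemma positively_oriented:
  assumes "a < b" "b < c" "c < a + l"
  shows "0 < cross2 (\<gamma> b - \<gamma> a) (\<gamma> c - \<gamma> a)"
proof (rule ccontr)
  define F where "F x = cross2 (\<gamma> b - \<gamma> a) (\<gamma> x - \<gamma> a)" for x
  assume "\<not> 0 < cross2 (\<gamma> b - \<gamma> a) (\<gamma> c - \<gamma> a)"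
  then have Fc: "F c \<le> 0" by (simp add: F_def)
  have ab: "\<gamma> a \<noteq> \<gamma> b" using assms \<gamma>_neq[of a b] by simp
  have F_deriv: "(F has_real_derivative cross2 (\<gamma> b - \<gamma> a) (\<gamma>1 x)) (at x)" for x
  proof -
    have "((\<lambda>x. \<gamma> x - \<gamma> a) has_vector_derivative \<gamma>1 x) (at x)"
      using has_vector_derivative_diff[OF \<gamma>_has_derivative[of x] has_vector_derivative_const[of "\<gamma> a"]] by simp
    then show ?thesis unfolding F_def by (rule cross2_has_real_derivative)
  qed
  have "cross2 (\<gamma> b - \<gamma> a) (\<gamma>1 b) = cross2 (\<gamma>1 b) (\<gamma> a - \<gamma> b)"
    by (simp add: cross2_def algebra_simps)
  also have "\<dots> > 0" using strict_support[of a b] ab by simp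
  finally obtain d where d: "0 < d" "\<And>h. 0 < h \<Longrightarrow> h < d \<Longrightarrow> F b < F (b + h)"
    using DERIV_pos_inc_right[OF F_deriv] by blast
  have Fb: "F b = 0" by (simp add: F_def cross2_def)
  define h where "h = min (d / 2) ((c - b) / 2)"
  have h: "0 < h" "h < d" "b + h < c" using d assms by (auto simp: h_def min_def field_simps)
  have "0 < F (b + h)" using d(2)[OF h(1,2)] Fb by simp
  moreover have "continuous_on {b + h..c} F"
    using F_deriv DERIV_isCont continuous_at_imp_continuous_on by blast
  ultimately obtain x where x: "b + h \<le> x" "x \<le> c" "F x = 0"
    using IVT2'[of F c 0 "b + h"] Fc h by auto
  have "\<gamma> b \<noteq> \<gamma> x" "\<gamma> a \<noteq> \<gamma> x" using x h assms \<gamma>_neq[of b x] \<gamma>_neq[of a x] by simp_all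
  then show False using noncollinear[OF ab] x(3) by (simp add: F_def)
qed

lemma gen_fun_submodular:
  assumes "x \<le> y" "y \<le> y'" "y' \<le> x'" "x' \<le> x + l"
  shows "gen_fun \<gamma> x y' + gen_fun \<gamma> y x' \<le> gen_fun \<gamma> x x' + gen_fun \<gamma> y y'"
proof -
  have "dist (\<gamma> x) (\<gamma> x') + dist (\<gamma> y) (\<gamma> y') \<le> dist (\<gamma> x) (\<gamma> y') + dist (\<gamma> y) (\<gamma> x')"
  proof (cases "x = y \<or> y = y' \<or> y' = x' \<or> x' = x + l")
    \<comment> \<open>For a degenerate quadrilateral the claim is an equality or a triangle
      inequality.\<close>
    case True
    then show ?thesis
      using dist_triangle[of "\<gamma> x" "\<gamma> x'" "\<gamma> y"] dist_triangle[of "\<gamma> y" "\<gamma> y'" "\<gamma> x"] \<gamma>_period[of x]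
      by (auto simp: dist_commute)
  next
    case False
    then have *: "x < y" "y < y'" "y' < x'" "x' < x + l" using assms by auto
    show ?thesis
      by (rule quadrilateral_diagonals; rule positively_oriented) (use * in auto)
  qed
  then show ?thesis by (simp add: gen_fun_def)
qed

end


section \<open>From minimal configurations to billiard orbits and Mather's function\<close>

context billiard
begin

lemma range_\<gamma>_bounded: "bounded (range \<gamma>)"
proof -
  have "bounded (closure \<Omega>)" using table by (simp add: billiard_table_def bounded_closure)
  then show ?thesis by (rule bounded_subset) (use \<gamma>_in_closure in blast)
qed

sublocale twist: twist_cost l "diameter (range \<gamma>)" "gen_fun \<gamma>"
proof
  show "0 < l" by (rule l_pos)
  have "continuous_on UNIV (\<lambda>p. \<gamma> (fst p))" "continuous_on UNIV (\<lambda>p. \<gamma> (snd p))"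
    by (intro continuous_on_compose2[OF \<gamma>_continuous[of UNIV]] continuous_intros; simp)+
  then show "continuous_on UNIV (\<lambda>(x, y). gen_fun \<gamma> x y)"
    unfolding gen_fun_def case_prod_unfold by (intro continuous_intros)
  show "gen_fun \<gamma> (x + l) (y + l) = gen_fun \<gamma> x y" for x y by (simp add: gen_fun_def \<gamma>_period)
  show "\<bar>gen_fun \<gamma> x y\<bar> \<le> diameter (range \<gamma>)" for x y
    using diameter_bounded_bound[OF range_\<gamma>_bounded, of "\<gamma> x" "\<gamma> y"] by (simp add: gen_fun_def)
  show "gen_fun \<gamma> x y' + gen_fun \<gamma> y x' \<le> gen_fun \<gamma> x x' + gen_fun \<gamma> y y'"
    if "x \<le> y" "y \<le> y'" "y' \<le> x'" "x' \<le> x + l" for x y x' y'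
    using that by (rule gen_fun_submodular)
qed

lemma minimal_step:
  assumes "twist.minimal s"
  shows "s i \<le> s (i + 1)" "s (i + 1) \<le> s i + l"
proof -
  have "twist.admissible i (i + 1) s" using assms by (simp add: twist.minimal_def)
  then show "s i \<le> s (i + 1)" "s (i + 1) \<le> s i + l" by (auto simp: twist.admissible_def)
qed

lemma minimal_three_points:
  assumes s: "twist.minimal s" and y: "s (i - 1) \<le> y" "y \<le> s (i - 1) + l" "y \<le> s (i + 1)" "s (i + 1) \<le> y + l"
  shows "dist (\<gamma> (s (i - 1))) (\<gamma> y) + dist (\<gamma> y) (\<gamma> (s (i + 1)))
    \<le> dist (\<gamma> (s (i - 1))) (\<gamma> (s i)) + dist (\<gamma> (s i)) (\<gamma> (s (i + 1)))"
proof -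
  have I: "{i - 1..<i + 1} = {i - 1, i}" by auto
  have "twist.action (i - 1) (i + 1) s \<le> twist.action (i - 1) (i + 1) (s(i := y))"
    using y by (intro twist.minimalD[OF s]) (auto simp: twist.admissible_def I)
  then show ?thesis by (simp add: twist.action_def I gen_fun_def)
qed

text \<open>If a vanishing step has a nonzero neighbour, moving their shared point into the arc of
  the neighbour strictly lengthens the broken line. So one vanishing step makes the whole
  configuration constant.\<close>

lemma collapsed_propagates:
  assumes s: "twist.minimal s" and eq: "s (i + 1) = s i"
  shows "s (j + 1) = s j"
proof -
  have up: "s (i + 1 + 1) = s (i + 1)" if eq: "s (i + 1) = s i" for i
  proof (rule ccontr)
    define y where "y = (s (i + 1) + s (i + 1 + 1)) / 2"
    assume "s (i + 1 + 1) \<noteq> s (i + 1)"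
    then have lt: "s (i + 1) < s (i + 1 + 1)" using minimal_step(1)[OF s, of "i + 1"] by linarith
    have y: "s (i + 1) < y" "y < s (i + 1 + 1)" using lt by (auto simp: y_def)
    have "s (i + 1 + 1) \<le> s (i + 1) + l" by (rule minimal_step[OF s])
    with y minimal_three_points[OF s, of "i + 1" y] strict_triangle[of "s (i + 1)" y "s (i + 1 + 1)"] eq
    show False by simp
  qed
  have down: "s (i - 1 + 1) = s (i - 1)" if eq: "s (i + 1) = s i" for i
  proof (rule ccontr)
    define y where "y = (s (i - 1) + s i) / 2"
    assume "s (i - 1 + 1) \<noteq> s (i - 1)"
    then have lt: "s (i - 1) < s i" using minimal_step(1)[OF s, of "i - 1"] by simp
    have y: "s (i - 1) < y" "y < s i" using lt by (auto simp: y_def)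
    have "s i \<le> s (i - 1) + l" using minimal_step(2)[OF s, of "i - 1"] by simp
    with y minimal_three_points[OF s, of i y] strict_triangle[of "s (i - 1)" y "s i"] eq
    show False by simp
  qed
  show ?thesis
  proof (induction j rule: int_induct[where k = i])
    case base show ?case by (rule eq)
  next
    case (step1 j) show ?case by (rule up[OF step1(2)])
  next
    case (step2 j) show ?case by (rule down[OF step2(2)])
  qed
qed

text \<open>A full turn also has a chord of length 0; here the shared point is moved into the arc by
  which the neighbouring step falls short of a full turn.\<close>

lemma full_turn_propagates:
  assumes s: "twist.minimal s" and eq: "s (i + 1) = s i + l"
  shows "s (j + 1) = s j + l"
proof -
  have up: "s (i + 1 + 1) = s (i + 1) + l" if eq: "s (i + 1) = s i + l" for i
  proof (rule ccontr)
    define y where "y = (s (i + 1) + (s (i + 1 + 1) - l)) / 2"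
    assume "s (i + 1 + 1) \<noteq> s (i + 1) + l"
    then have lt: "s (i + 1 + 1) < s (i + 1) + l" using minimal_step(2)[OF s, of "i + 1"] by linarith
    have y: "s (i + 1 + 1) - l < y" "y < s (i + 1)" using lt by (auto simp: y_def)
    have le: "s (i + 1) \<le> s (i + 1 + 1)" by (rule minimal_step[OF s])
    have "\<gamma> (s (i + 1 + 1) - l) = \<gamma> (s (i + 1 + 1))" "\<gamma> (s i) = \<gamma> (s (i + 1))"
      using \<gamma>_period[of "s (i + 1 + 1) - l"] \<gamma>_period[of "s i"] eq by simp_all
    with y le minimal_three_points[OF s, of "i + 1" y] strict_triangle[of "s (i + 1 + 1) - l" y "s (i + 1)"] eq
    show False by (simp add: dist_commute)
  qed
  have down: "s (i - 1 + 1) = s (i - 1) + l" if eq: "s (i + 1) = s i + l" for i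
  proof (rule ccontr)
    define y where "y = (s i + (s (i - 1) + l)) / 2"
    assume "s (i - 1 + 1) \<noteq> s (i - 1) + l"
    then have lt: "s i < s (i - 1) + l" using minimal_step(2)[OF s, of "i - 1"] by simp
    have y: "s i < y" "y < s (i - 1) + l" using lt by (auto simp: y_def)
    have le: "s (i - 1) \<le> s i" using minimal_step(1)[OF s, of "i - 1"] by simp
    have "\<gamma> (s (i - 1) + l) = \<gamma> (s (i - 1))" "\<gamma> (s (i + 1)) = \<gamma> (s i)"
      using \<gamma>_period[of "s (i - 1)"] \<gamma>_period[of "s i"] eq by simp_all
    with y le minimal_three_points[OF s, of i y] strict_triangle[of "s i" y "s (i - 1) + l"] eq
    show False by (simp add: dist_commute)
  qed
  show ?thesis
  proof (induction j rule: int_induct[where k = i])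
    case base show ?case by (rule eq)
  next
    case (step1 j) show ?case by (rule up[OF step1(2)])
  next
    case (step2 j) show ?case by (rule down[OF step2(2)])
  qed
qed

lemma constant_step_rotation_number:
  assumes step: "\<And>i. s (i + 1) = s i + \<rho> * l" and rot: "has_rotation_number l s \<omega>"
  shows "\<omega> = \<rho>"
proof -
  have form: "s i = s 0 + of_int i * \<rho> * l" for i
  proof (induction i rule: int_induct[where k = 0])
    case (step1 i) then show ?case using step[of i] by (simp add: algebra_simps)
  next
    case (step2 i) then show ?case using step[of "i - 1"] by (simp add: algebra_simps)
  qed simp
  have "has_rotation_number l s \<rho>"
  proof (rule has_rotation_numberI[OF l_pos])
    show "\<bar>s i - of_int i * \<rho> * l\<bar> \<le> \<bar>s 0\<bar>" for i using form[of i] by linarith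
  qed
  then have "((\<lambda>i. s i / (of_int i * l)) \<longlongrightarrow> \<rho>) at_top" "((\<lambda>i. s i / (of_int i * l)) \<longlongrightarrow> \<omega>) at_top"
    using rot by (simp_all add: has_rotation_number_def)
  then show ?thesis using tendsto_unique[OF trivial_limit_at_top_linorder] by metis
qed

text \<open>With strict steps the middle point can move both ways, so the length of the two chords
  has an interior maximum there; its vanishing derivative is the reflection law.\<close>

lemma minimal_reflection_law:
  assumes s: "twist.minimal s" and strict: "\<And>i. s i < s (i + 1) \<and> s (i + 1) < s i + l"
  shows "sgn (\<gamma> (s i) - \<gamma> (s (i - 1))) \<bullet> \<gamma>1 (s i) = sgn (\<gamma> (s (i + 1)) - \<gamma> (s i)) \<bullet> \<gamma>1 (s i)"
proof -
  define p x r where "p = s (i - 1)" and "x = s i" and "r = s (i + 1)"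
  have px: "p < x" "x < p + l" and xr: "x < r" "r < x + l"
    using strict[of i] strict[of "i - 1"] by (auto simp: p_def x_def r_def)
  define F where "F y = dist (\<gamma> p) (\<gamma> y) + dist (\<gamma> r) (\<gamma> y)" for y
  have ne: "\<gamma> x \<noteq> \<gamma> p" "\<gamma> x \<noteq> \<gamma> r" using \<gamma>_neq[of p x] \<gamma>_neq[of x r] px xr by auto
  have "(F has_real_derivative sgn (\<gamma> x - \<gamma> p) \<bullet> \<gamma>1 x + sgn (\<gamma> x - \<gamma> r) \<bullet> \<gamma>1 x) (at x)"
    unfolding F_def by (intro DERIV_add dist_has_real_derivative \<gamma>_has_derivative ne)
  moreover define d where "d = min (min (x - p) (p + l - x)) (min (r - x) (x + l - r))"
  have "0 < d" using px xr by (simp add: d_def)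
  moreover have "\<forall>y. \<bar>x - y\<bar> < d \<longrightarrow> F y \<le> F x"
  proof (intro allI impI)
    fix y assume "\<bar>x - y\<bar> < d"
    then have "p \<le> y" "y \<le> p + l" "y \<le> r" "r \<le> y + l" by (auto simp: d_def)
    then show "F y \<le> F x" using minimal_three_points[OF s, of i y] by (simp add: F_def p_def x_def r_def dist_commute)
  qed
  ultimately have "sgn (\<gamma> x - \<gamma> p) \<bullet> \<gamma>1 x + sgn (\<gamma> x - \<gamma> r) \<bullet> \<gamma>1 x = 0" using DERIV_local_max by blast
  moreover have "sgn (\<gamma> x - \<gamma> r) = - sgn (\<gamma> r - \<gamma> x)" by (metis minus_diff_eq sgn_minus)
  ultimately show ?thesis by (simp add: p_def x_def r_def)
qed

text \<open>A rotation number strictly between 0 and 1 excludes configurations with all steps 0 or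
  all steps \<open>l\<close>, and hence, by propagation, every single degenerate step.\<close>

lemma minimal_imp_minimal_orbit:
  assumes s: "twist.minimal s" and rot: "has_rotation_number l s \<omega>" and \<omega>: "0 < \<omega>" "\<omega> < 1"
  shows "minimal_orbit l \<gamma> s"
proof -
  have "s i < s (i + 1) \<and> s (i + 1) < s i + l" for i
  proof -
    have "s (i + 1) \<noteq> s i"
      using collapsed_propagates[OF s, of i] constant_step_rotation_number[of s 0 \<omega>] rot \<omega> by auto
    moreover have "s (i + 1) \<noteq> s i + l"
      using full_turn_propagates[OF s, of i] constant_step_rotation_number[of s 1 \<omega>] rot \<omega> by auto
    ultimately show ?thesis using minimal_step[OF s, of i] by linarith
  qed
  then have "billiard_orbit l \<gamma> s" unfolding billiard_orbit_def using minimal_reflection_law[OF s] by blast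
  then show ?thesis
    using s unfolding minimal_orbit_def twist.minimal_def twist.admissible_def twist.action_def by blast
qed

lemma minimal_orbit_imp_minimal:
  assumes "minimal_orbit l \<gamma> s"
  shows "twist.minimal s"
proof -
  have step: "s i \<le> s (i + 1) \<and> s (i + 1) \<le> s i + l" for i
  proof -
    consider "s i < s (i + 1)" "s (i + 1) < s i + l" | "s (i + 1) = s i" | "s (i + 1) = s i + l"
      using assms unfolding minimal_orbit_def billiard_orbit_def boundary_orbit_def by blast
    then show ?thesis using l_pos by cases auto
  qed
  show ?thesis
    unfolding twist.minimal_def
  proof (intro conjI allI impI)
    show "twist.admissible m n s" for m n unfolding twist.admissible_def using step by blast
    show "twist.action m n s \<le> twist.action m n t"
      if "m < n" "t m = s m" "t n = s n" "twist.admissible m n t" for m n t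
      using assms that unfolding minimal_orbit_def twist.admissible_def twist.action_def by blast
  qed
qed

lemma average_eq_action:
  "(\<Sum>i\<in>{- int N..int N - 1}. gen_fun \<gamma> (s i) (s (i + 1))) = twist.action (- int N) (int N) s"
  unfolding twist.action_def by (rule sum.cong) auto

text \<open>Opens the definite description: existence comes from limits of periodic minimizers,
  uniqueness from comparing averages in both directions.\<close>

lemma mather_beta_attained:
  assumes \<omega>: "0 < \<omega>" "\<omega> < 1"
  obtains s where "twist.minimal s" "has_rotation_number l s \<omega>"
    "(\<lambda>N. twist.action (- int N) (int N) s / (2 * real N)) \<longlonglongrightarrow> mather_beta l \<gamma> \<omega>"
proof -
  obtain z where z: "twist.minimal z" "\<And>i. \<bar>z i - z 0 - of_int i * \<omega> * l\<bar> \<le> l"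
    using twist.minimal_exists[OF \<omega>] by metis
  obtain b where b: "(\<lambda>N. twist.action (- int N) (int N) z / (2 * real N)) \<longlonglongrightarrow> b"
    using twist.minimal_average_converges[OF z(1) \<omega> z(2)] by blast
  have rot: "has_rotation_number l z \<omega>"
  proof (rule has_rotation_numberI[OF l_pos])
    show "\<bar>z i - of_int i * \<omega> * l\<bar> \<le> l + \<bar>z 0\<bar>" for i using z(2)[of i] by linarith
  qed
  have "mather_beta l \<gamma> \<omega> = b"
    unfolding mather_beta_def average_eq_action
  proof (rule the_equality)
    show "\<exists>s. minimal_orbit l \<gamma> s \<and> has_rotation_number l s \<omega> \<and>
        (\<lambda>N. twist.action (- int N) (int N) s / (2 * real N)) \<longlonglongrightarrow> b"
      using minimal_imp_minimal_orbit[OF z(1) rot \<omega>] rot b by blast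
    fix b' assume "\<exists>s. minimal_orbit l \<gamma> s \<and> has_rotation_number l s \<omega> \<and>
        (\<lambda>N. twist.action (- int N) (int N) s / (2 * real N)) \<longlonglongrightarrow> b'"
    then obtain s where s: "twist.minimal s" "has_rotation_number l s \<omega>"
      "(\<lambda>N. twist.action (- int N) (int N) s / (2 * real N)) \<longlonglongrightarrow> b'"
      using minimal_orbit_imp_minimal by blast
    show "b' = b"
      using twist.minimal_average_le[OF s(1) z(1) \<omega> s(2) rot s(3) b]
        twist.minimal_average_le[OF z(1) s(1) \<omega> rot s(2) b s(3)] by simp
  qed
  with that z(1) rot b show ?thesis by blast
qed

end


section \<open>Short chords and the Lazutkin parameter\<close>

lemma has_vector_derivative_lipschitz:
  fixes f :: "real \<Rightarrow> 'a::real_normed_vector"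
  assumes f: "\<And>t. (f has_vector_derivative f' t) (at t)" and B: "\<And>t. norm (f' t) \<le> B"
  shows "norm (f s - f t) \<le> B * \<bar>s - t\<bar>"
proof -
  have "norm (f s - f t) \<le> B * norm (s - t)"
  proof (rule differentiable_bound[of UNIV f "\<lambda>x h. h *\<^sub>R f' x"])
    show "onorm (\<lambda>h. h *\<^sub>R f' x) \<le> B" for x
      by (rule onorm_le) (simp add: mult.commute[of B] mult_left_mono B)
  qed (use f has_vector_derivative_def in auto)
  then show ?thesis by simp
qed

lemma one_minus_sqrt_bounds:
  fixes r :: real
  assumes "0 \<le> r" "r \<le> 1"
  shows "r / 2 \<le> 1 - sqrt (1 - r)" "1 - sqrt (1 - r) \<le> r / 2 * (1 + r)"
proof -
  have "1 - r \<le> (1 - r / 2)\<^sup>2" by (simp add: power2_eq_square algebra_simps)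
  then show "r / 2 \<le> 1 - sqrt (1 - r)"
    using real_le_lsqrt[of "1 - r / 2" "1 - r"] assms by simp
  have "(1 - r / 2 * (1 + r))\<^sup>2 = 1 - r - r * r * (3 - 2 * r - r * r) / 4"
    by (simp add: power2_eq_square field_simps)
  moreover have "0 \<le> r * r * (3 - 2 * r - r * r)"
  proof (rule mult_nonneg_nonneg)
    have "r * r \<le> 1" using assms by (simp add: mult_le_one)
    then show "0 \<le> 3 - 2 * r - r * r" using assms by linarith
  qed simp
  ultimately have "(1 - r / 2 * (1 + r))\<^sup>2 \<le> 1 - r" by linarith
  then show "1 - sqrt (1 - r) \<le> r / 2 * (1 + r)"
    using real_le_rsqrt[of "1 - r / 2 * (1 + r)" "1 - r"] by simp
qed

lemma sum_int_telescope:
  fixes f :: "int \<Rightarrow> real"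
  assumes "m \<le> n"
  shows "(\<Sum>i\<in>{m..<n}. f (i + 1) - f i) = f n - f m"
  using assms
proof (induction n rule: int_ge_induct)
  case (step n)
  have "{m..<n + 1} = insert n {m..<n}" using step by auto
  then show ?case using step by simp
qed simp

lemma cube_tangent_le:
  fixes a w :: real
  assumes "0 \<le> a" "0 \<le> w"
  shows "3 * w\<^sup>2 * a - 2 * w ^ 3 \<le> a ^ 3"
proof -
  have "a ^ 3 - (3 * w\<^sup>2 * a - 2 * w ^ 3) = (a - w)\<^sup>2 * (a + 2 * w)"
    by (simp add: power2_eq_square power3_eq_cube algebra_simps)
  moreover have "0 \<le> (a - w)\<^sup>2 * (a + 2 * w)" using assms by simp
  ultimately show ?thesis by linarith
qed

section \<open>Taylor expansion of short chords\<close>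

context billiard
begin

lemma reduce_mod_period:
  obtains r where "0 \<le> r" "r < l" "\<And>n. deriv_n n r = deriv_n n t"
proof -
  obtain k where k: "0 \<le> t + of_int k * l" "t + of_int k * l < l" by (rule twist.normalize_start)
  have "deriv_n n (t + of_int k * l) = deriv_n n t" for n
  proof (induction k rule: int_induct[where k = 0])
    case (step1 i) then show ?case using deriv_n_period[of n "t + of_int i * l"] by (simp add: algebra_simps)
  next
    case (step2 i) then show ?case using deriv_n_period[of n "t + of_int (i - 1) * l"] by (simp add: algebra_simps)
  qed simp
  with k that show ?thesis by blast
qed

lemma deriv_n_bounded:
  obtains M where "0 < M" "\<And>t. norm (deriv_n n t) \<le> M"
proof -
  have "compact (deriv_n n ` {0..l})"
    by (intro compact_continuous_image deriv_n_continuous compact_Icc)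
  then obtain M where M: "\<And>x. x \<in> {0..l} \<Longrightarrow> norm (deriv_n n x) \<le> M"
    using compact_imp_bounded[THEN bounded_iff[THEN iffD1]] by (meson imageI)
  have "norm (deriv_n n t) \<le> max M 1" for t
  proof -
    obtain r where r: "0 \<le> r" "r < l" "\<And>n. deriv_n n r = deriv_n n t" by (rule reduce_mod_period[of t]) blast
    then show ?thesis using M[of r] r(3)[of n] by simp
  qed
  then show ?thesis using that[of "max M 1"] by auto
qed

lemma \<kappa>_bounded_below:
  obtains k where "0 < k" "\<And>t. k \<le> \<kappa> t"
proof -
  obtain x where x: "\<And>y. y \<in> {0..l} \<Longrightarrow> \<kappa> x \<le> \<kappa> y"
    using continuous_attains_inf[OF compact_Icc _ \<kappa>_continuous, of 0 l] l_pos by force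
  have "\<kappa> x \<le> \<kappa> t" for t
  proof -
    obtain r where r: "0 \<le> r" "r < l" "\<And>n. deriv_n n r = deriv_n n t" by (rule reduce_mod_period[of t]) blast
    then have "\<kappa> r = \<kappa> t" using r(3)[of 1] r(3)[of 2] by (simp add: \<kappa>_def)
    then show ?thesis using x[of r] r by simp
  qed
  then show ?thesis using that[of "\<kappa> x"] \<kappa>_pos by blast
qed

lemma chord_le_arc: "s \<le> s' \<Longrightarrow> dist (\<gamma> s) (\<gamma> s') \<le> s' - s"
  using has_vector_derivative_lipschitz[OF \<gamma>_has_derivative, of 1 s' s] table
  by (simp add: billiard_table_def dist_norm norm_minus_commute)

lemma curvature_sq_lipschitz:
  obtains C where "0 < C" "\<And>s t. \<bar>(\<kappa> s)\<^sup>2 - (\<kappa> t)\<^sup>2\<bar> \<le> C * \<bar>s - t\<bar>"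
proof -
  obtain M2 where M2: "0 < M2" "\<And>t. norm (deriv_n 2 t) \<le> M2" using deriv_n_bounded[of 2] by blast
  obtain M3 where M3: "0 < M3" "\<And>t. norm (deriv_n 3 t) \<le> M3" using deriv_n_bounded[of 3] by blast
  have "((\<lambda>t. (\<kappa> t)\<^sup>2) has_vector_derivative 2 * (deriv_n 2 t \<bullet> deriv_n 3 t)) (at t)" for t
  proof -
    have "(deriv_n 2 has_vector_derivative deriv_n 3 t) (at t)"
      using deriv_n_has_derivative[of 2 t] by (simp add: numeral_3_eq_3 numeral_2_eq_2)
    from inner_has_real_derivative[OF this this]
    have "((\<lambda>t. deriv_n 2 t \<bullet> deriv_n 2 t) has_real_derivative 2 * (deriv_n 2 t \<bullet> deriv_n 3 t)) (at t)"
      by (simp add: inner_commute)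
    then show ?thesis using curvature_norm by (simp add: has_real_derivative_iff_has_vector_derivative)
  qed
  moreover have "norm (2 * (deriv_n 2 t \<bullet> deriv_n 3 t)) \<le> 2 * (M2 * M3)" for t
  proof -
    have "\<bar>deriv_n 2 t \<bullet> deriv_n 3 t\<bar> \<le> norm (deriv_n 2 t) * norm (deriv_n 3 t)"
      by (rule Cauchy_Schwarz_ineq2)
    also have "\<dots> \<le> M2 * M3" using M2 M3 by (intro mult_mono) auto
    finally show ?thesis by (simp add: abs_mult)
  qed
  ultimately have "\<bar>(\<kappa> s)\<^sup>2 - (\<kappa> t)\<^sup>2\<bar> \<le> 2 * (M2 * M3) * \<bar>s - t\<bar>" for s t
    using has_vector_derivative_lipschitz[of "\<lambda>t. (\<kappa> t)\<^sup>2" "\<lambda>t. 2 * (deriv_n 2 t \<bullet> deriv_n 3 t)" "2 * (M2 * M3)" s t]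
    by simp
  then show ?thesis using that[of "2 * (M2 * M3)"] M2 M3 by simp
qed

text \<open>The squared chord is expanded because, unlike the chord, it is smooth at length 0. Unit
  speed leaves only the orders 2 and 4, and the factor 1/12 is 2/4!.\<close>

lemma chord_sq_taylor:
  assumes "0 < \<delta>"
  obtains t where "0 < t" "t < \<delta>"
    "(dist (\<gamma> s) (\<gamma> (s + \<delta>)))\<^sup>2 = \<delta>\<^sup>2 * (1 - \<delta>\<^sup>2 / 12 * ((\<kappa> (s + t))\<^sup>2 - (\<gamma> (s + t) - \<gamma> s) \<bullet> deriv_n 4 (s + t)))"
proof -
  define w where "w x = \<gamma> (s + x) - \<gamma> s" for x
  define D where "D n x = deriv_n n (s + x)" for n x
  have D_deriv: "(D n has_vector_derivative D (Suc n) x) (at x)" for n x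
    unfolding D_def
    using vector_diff_chain_at[of "\<lambda>x. s + x" 1 x "deriv_n n" "deriv_n (Suc n) (s + x)"]
      deriv_n_has_derivative[of n "s + x"]
      has_vector_derivative_add[OF has_vector_derivative_const[of s] has_vector_derivative_id, of "at x"]
    by (simp add: o_def)
  have w_deriv: "(w has_vector_derivative D (Suc 0) x) (at x)" for x
    using has_vector_derivative_diff[OF D_deriv[of 0 x] has_vector_derivative_const[of "\<gamma> s"]]
    by (simp add: w_def[abs_def] D_def)
  have num: "Suc (Suc 0) = 2" "Suc 2 = 3" "Suc 3 = 4" by simp_all
  have unit: "D (Suc 0) x \<bullet> D (Suc 0) x = 1" and orth: "D (Suc 0) x \<bullet> D 2 x = 0" and curv: "D 2 x \<bullet> D 2 x = (\<kappa> (s + x))\<^sup>2" for x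
    using unit_speed \<gamma>1_orthogonal curvature_norm by (simp_all add: D_def)
  have jerk: "D (Suc 0) x \<bullet> D 3 x = - (\<kappa> (s + x))\<^sup>2" for x
  proof -
    have "((\<lambda>x. D (Suc 0) x \<bullet> D 2 x) has_real_derivative D (Suc 0) x \<bullet> D 3 x + D 2 x \<bullet> D 2 x) (at x)"
      using D_deriv[of "Suc 0" x] D_deriv[of 2 x] unfolding num by (rule inner_has_real_derivative)
    then have "((\<lambda>x. 0) has_real_derivative D (Suc 0) x \<bullet> D 3 x + D 2 x \<bullet> D 2 x) (at x)" by (simp add: orth)
    then have "D (Suc 0) x \<bullet> D 3 x + D 2 x \<bullet> D 2 x = 0" using DERIV_unique DERIV_const by blast
    then show ?thesis by (simp add: curv)
  qed
  have wD: "((\<lambda>x. w x \<bullet> D n x) has_real_derivative w x \<bullet> D (Suc n) x + D (Suc 0) x \<bullet> D n x) (at x)" for n x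
    by (rule inner_has_real_derivative[OF w_deriv D_deriv])
  \<comment> \<open>The successive derivatives of \<open>w \<bullet> w\<close>, already simplified
    by \<open>unit\<close>, \<open>orth\<close> and \<open>jerk\<close>; the last branch is the
    fourth.\<close>
  define diff where "diff m x = (if m = 0 then w x \<bullet> w x else if m = 1 then 2 * (w x \<bullet> D (Suc 0) x)
    else if m = 2 then 2 * (w x \<bullet> D 2 x + 1) else if m = 3 then 2 * (w x \<bullet> D 3 x)
    else 2 * (w x \<bullet> D 4 x - (\<kappa> (s + x))\<^sup>2))" for m :: nat and x
  have diff_deriv: "(diff m has_real_derivative diff (Suc m) x) (at x)" if "m < 4" for m x
  proof -
    have "(diff 0 has_real_derivative diff (Suc 0) x) (at x)"
      using inner_has_real_derivative[OF w_deriv[of x] w_deriv[of x]] by (simp add: diff_def[abs_def] inner_commute)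
    moreover have "(diff (Suc 0) has_real_derivative diff (Suc (Suc 0)) x) (at x)"
      using DERIV_cmult[OF wD[of "Suc 0" x], of 2] by (simp add: diff_def[abs_def] unit num)
    moreover have "(diff 2 has_real_derivative diff (Suc 2) x) (at x)"
      using DERIV_cmult[OF DERIV_add[OF wD[of 2 x] DERIV_const[of 1]], of 2] by (simp add: diff_def[abs_def] orth num)
    moreover have "(diff 3 has_real_derivative diff (Suc 3) x) (at x)"
      using DERIV_cmult[OF wD[of 3 x], of 2] by (simp add: diff_def[abs_def] jerk num)
    moreover have "m = 0 \<or> m = Suc 0 \<or> m = 2 \<or> m = 3" using that by auto
    ultimately show ?thesis by auto
  qed
  have "diff 0 = (\<lambda>x. w x \<bullet> w x)" by (simp add: diff_def[abs_def])
  then have "\<exists>t>0. t < \<delta> \<and> w \<delta> \<bullet> w \<delta> = (\<Sum>m<4. diff m 0 / fact m * \<delta> ^ m) + diff 4 t / fact 4 * \<delta> ^ 4"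
    using Maclaurin[of \<delta> 4 diff "\<lambda>x. w x \<bullet> w x"] assms diff_deriv by (simp only:) simp
  then obtain t where t: "0 < t" "t < \<delta>"
    "w \<delta> \<bullet> w \<delta> = (\<Sum>m<4. diff m 0 / fact m * \<delta> ^ m) + diff 4 t / fact 4 * \<delta> ^ 4" by blast
  have w0: "w 0 = 0" by (simp add: w_def)
  have "(\<Sum>m<4. diff m 0 / fact m * \<delta> ^ m) = \<delta>\<^sup>2"
    by (simp add: eval_nat_numeral diff_def w0)
  moreover have "diff 4 t / fact 4 * \<delta> ^ 4 = \<delta>\<^sup>2 * (- \<delta>\<^sup>2 / 12 * ((\<kappa> (s + t))\<^sup>2 - w t \<bullet> D 4 t))"
  proof -
    define A where "A = (\<kappa> (s + t))\<^sup>2 - w t \<bullet> D 4 t"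
    have "diff 4 t = - 2 * A" by (simp add: diff_def A_def)
    moreover have "fact 4 = (24 :: real)" by (simp add: fact_numeral)
    moreover have "\<delta> ^ 4 = \<delta>\<^sup>2 * \<delta>\<^sup>2" by (simp add: power_add[symmetric])
    ultimately show ?thesis unfolding A_def[symmetric] by simp
  qed
  ultimately have "w \<delta> \<bullet> w \<delta> = \<delta>\<^sup>2 * (1 - \<delta>\<^sup>2 / 12 * ((\<kappa> (s + t))\<^sup>2 - w t \<bullet> D 4 t))"
    using t(3) by (simp add: algebra_simps)
  moreover have "(dist (\<gamma> s) (\<gamma> (s + \<delta>)))\<^sup>2 = w \<delta> \<bullet> w \<delta>"
    unfolding w_def power2_norm_eq_inner[symmetric] by (simp add: dist_norm norm_minus_commute)
  ultimately show ?thesis using that[OF t(1,2)] by (simp add: w_def D_def)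
qed

end

text \<open>\<open>X\<close> is Lazutkin's parameter, in which short chords all lose \<open>(X s' - X s)\<^sup>3 / 24\<close> to the arc.\<close>

locale lazutkin = billiard +
  fixes X :: "real \<Rightarrow> real"
  assumes X_deriv: "(X has_real_derivative \<kappa> s powr (2/3)) (at s)"
begin

definition L :: real where "L = X l - X 0"

lemma powr_cube: "0 < x \<Longrightarrow> (x powr (2/3)) ^ 3 = x\<^sup>2" for x :: real
  by (simp add: powr_power powr_numeral)

lemma X_mean_value:
  assumes "s < s'"
  obtains \<xi> where "s < \<xi>" "\<xi> < s'" "X s' - X s = (s' - s) * \<kappa> \<xi> powr (2/3)"
  using MVT2[OF assms X_deriv] by blast

lemma X_less: "s < s' \<Longrightarrow> X s < X s'"
proof (rule DERIV_pos_imp_increasing[of _ _ X])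
  fix x
  have "0 < \<kappa> x powr (2/3)" using \<kappa>_pos[of x] by simp
  then show "\<exists>y. (X has_real_derivative y) (at x) \<and> 0 < y" using X_deriv by blast
qed

lemma X_le_iff: "X s \<le> X s' \<longleftrightarrow> s \<le> s'"
  using X_less[of s s'] X_less[of s' s] by (cases s s' rule: linorder_cases) auto

lemma X_period: "X (s + l) = X s + L"
proof -
  have "((\<lambda>s. X (s + l) - X s) has_real_derivative 0) (at s)" for s
    using DERIV_diff[OF _ X_deriv[of s]] X_deriv[of "s + l"] \<kappa>_period[of s]
    by (fastforce simp: DERIV_shift)
  then have "X (s + l) - X s = X (0 + l) - X 0" by (intro DERIV_isconst_all) blast
  then show ?thesis by (simp add: L_def)
qed

lemma L_pos: "0 < L"
  using X_less[of 0 l] l_pos by (simp add: L_def)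

lemma X_period_int: "X (s + of_int k * l) = X s + of_int k * L"
proof (induction k rule: int_induct[where k = 0])
  case (step1 i) then show ?case using X_period[of "s + of_int i * l"] by (simp add: algebra_simps)
next
  case (step2 i) then show ?case using X_period[of "s + of_int (i - 1) * l"] by (simp add: algebra_simps)
qed simp

text \<open>\<open>X\<close> grows by \<open>L\<close> per period, so it stays at bounded distance
  from a linear function of slope \<open>L / l\<close>; this transfers rotation numbers from arc
  length to \<open>X\<close>.\<close>

lemma X_linear_growth: "\<bar>X s - X 0 - s * (L / l)\<bar> \<le> L"
proof -
  obtain k where k: "0 \<le> s + of_int k * l" "s + of_int k * l < l" by (rule twist.normalize_start)
  then have "X 0 \<le> X (s + of_int k * l)" "X (s + of_int k * l) \<le> X l" using X_le_iff by simp_all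
  then have *: "0 \<le> X s + of_int k * L - X 0" "X s + of_int k * L - X 0 \<le> L"
    by (simp_all add: X_period_int L_def)
  have "(s + of_int k * l) * (L / l) = s * (L / l) + of_int k * L" using l_pos by (simp add: field_simps)
  moreover have "0 \<le> (s + of_int k * l) * (L / l)" using k L_pos l_pos by simp
  moreover have "(s + of_int k * l) * (L / l) \<le> l * (L / l)" using k L_pos l_pos by (intro mult_right_mono) auto
  moreover have "l * (L / l) = L" using l_pos by simp
  ultimately show ?thesis using * by linarith
qed

lemma X_surj:
  obtains s where "X s = x"
proof -
  obtain k :: nat where k: "\<bar>x - X 0\<bar> / L < real k" using reals_Archimedean2 by blast
  then have "\<bar>x - X 0\<bar> < real k * L" using L_pos by (simp add: field_simps)
  moreover have "X (0 + of_int (int k) * l) = X 0 + of_int (int k) * L" "X (0 + of_int (- int k) * l) = X 0 + of_int (- int k) * L"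
    by (rule X_period_int)+
  ultimately have "X (- real k * l) \<le> x" "x \<le> X (real k * l)" by simp_all
  moreover have "- real k * l \<le> real k * l" using l_pos by simp
  moreover have "continuous_on {- real k * l..real k * l} X"
    using X_deriv DERIV_isCont by (intro continuous_at_imp_continuous_on) blast
  ultimately show ?thesis using IVT'[of X "- real k * l" x "real k * l"] that by blast
qed

text \<open>By the mean value theorem the cube of the \<open>X\<close>-increment is
  \<open>\<delta> ^ 3\<close> times a squared curvature on the arc, and the deficit is
  \<open>\<delta> ^ 3 / 24\<close> times nearly the same. The Lipschitz bound on the squared
  curvature makes this uniform along the boundary.\<close>

lemma arc_chord_deficit:
  assumes "0 < \<epsilon>" "\<epsilon> < 1"
  obtains \<eta> where "0 < \<eta>"
    "\<And>s s'. s \<le> s' \<Longrightarrow> s' \<le> s + \<eta> \<Longrightarrow> (1 - \<epsilon>) / 24 * (X s' - X s) ^ 3 \<le> s' - s - dist (\<gamma> s) (\<gamma> s')"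
    "\<And>s s'. s \<le> s' \<Longrightarrow> s' \<le> s + \<eta> \<Longrightarrow> s' - s - dist (\<gamma> s) (\<gamma> s') \<le> (1 + \<epsilon>) / 24 * (X s' - X s) ^ 3"
proof -
  obtain C where C: "0 < C" "\<And>s t. \<bar>(\<kappa> s)\<^sup>2 - (\<kappa> t)\<^sup>2\<bar> \<le> C * \<bar>s - t\<bar>" by (rule curvature_sq_lipschitz) blast
  obtain M where M: "0 < M" "\<And>t. norm (deriv_n 4 t) \<le> M" using deriv_n_bounded[of 4] by blast
  obtain M2 where M2: "0 < M2" "\<And>t. norm (deriv_n 2 t) \<le> M2" using deriv_n_bounded[of 2] by blast
  obtain k where k: "0 < k" "\<And>t. k \<le> \<kappa> t" by (rule \<kappa>_bounded_below) blast
  define C1 where "C1 = C + M"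
  \<comment> \<open>The second bound gives \<open>A\<close> and \<open>B\<close> a relative
    difference of at most \<open>\<epsilon> / 3\<close>, the third gives
    \<open>r \<le> \<epsilon> / 3\<close>, and the square of \<open>1 + \<epsilon> / 3\<close> is at
    most \<open>1 + \<epsilon>\<close>. The bound 1 serves
    \<open>\<delta>\<^sup>2 \<le> \<eta>\<close>.\<close>
  define \<eta> where "\<eta> = min 1 (min (\<epsilon> * k\<^sup>2 / (3 * C1)) (\<epsilon> / M2\<^sup>2))"
  have C1: "0 < C1" using C M by (simp add: C1_def)
  have \<eta>: "0 < \<eta>" "\<eta> \<le> 1" "C1 * \<eta> \<le> \<epsilon> / 3 * k\<^sup>2" "\<eta> * M2\<^sup>2 \<le> \<epsilon>"
  proof -
    show "0 < \<eta>" "\<eta> \<le> 1" using assms k C1 M2 by (simp_all add: \<eta>_def)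
    have "C1 * \<eta> \<le> C1 * (\<epsilon> * k\<^sup>2 / (3 * C1))" using C1 by (intro mult_left_mono) (auto simp: \<eta>_def)
    then show "C1 * \<eta> \<le> \<epsilon> / 3 * k\<^sup>2" using C1 by simp
    have "\<eta> * M2\<^sup>2 \<le> \<epsilon> / M2\<^sup>2 * M2\<^sup>2" by (intro mult_right_mono) (auto simp: \<eta>_def)
    then show "\<eta> * M2\<^sup>2 \<le> \<epsilon>" using M2 by simp
  qed
  have main: "(1 - \<epsilon>) / 24 * (X s' - X s) ^ 3 \<le> s' - s - dist (\<gamma> s) (\<gamma> s') \<and>
      s' - s - dist (\<gamma> s) (\<gamma> s') \<le> (1 + \<epsilon>) / 24 * (X s' - X s) ^ 3" if ss': "s \<le> s'" "s' \<le> s + \<eta>" for s s'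
  proof (cases "s = s'")
    case True then show ?thesis by simp
  next
    case False
    define \<delta> where "\<delta> = s' - s"
    have \<delta>: "0 < \<delta>" "\<delta> \<le> \<eta>" "s' = s + \<delta>" using False ss' by (auto simp: \<delta>_def)
    obtain \<xi> where \<xi>: "s < \<xi>" "\<xi> < s'" "X s' - X s = (s' - s) * \<kappa> \<xi> powr (2/3)"
      using X_mean_value[of s s'] \<delta> by auto
    define B where "B = (\<kappa> \<xi>)\<^sup>2"
    have X3: "(X s' - X s) ^ 3 = \<delta> ^ 3 * B"
      unfolding \<xi>(3) power_mult_distrib powr_cube[OF \<kappa>_pos] by (simp add: B_def \<delta>_def)
    obtain t where t: "0 < t" "t < \<delta>"
      "(dist (\<gamma> s) (\<gamma> s'))\<^sup>2 = \<delta>\<^sup>2 * (1 - \<delta>\<^sup>2 / 12 * ((\<kappa> (s + t))\<^sup>2 - (\<gamma> (s + t) - \<gamma> s) \<bullet> deriv_n 4 (s + t)))"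
      using chord_sq_taylor[OF \<delta>(1), of s] \<delta>(3) by metis
    define A where "A = (\<kappa> (s + t))\<^sup>2 - (\<gamma> (s + t) - \<gamma> s) \<bullet> deriv_n 4 (s + t)"
    have AB: "\<bar>A - B\<bar> \<le> C1 * \<eta>"
    proof -
      have "\<bar>(\<kappa> (s + t))\<^sup>2 - B\<bar> \<le> C * \<bar>s + t - \<xi>\<bar>" unfolding B_def by (rule C)
      also have "\<dots> \<le> C * \<eta>" using t \<xi> \<delta> C by (intro mult_left_mono) auto
      finally have 1: "\<bar>(\<kappa> (s + t))\<^sup>2 - B\<bar> \<le> C * \<eta>" .
      have "\<bar>(\<gamma> (s + t) - \<gamma> s) \<bullet> deriv_n 4 (s + t)\<bar> \<le> norm (\<gamma> (s + t) - \<gamma> s) * norm (deriv_n 4 (s + t))"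
        by (rule Cauchy_Schwarz_ineq2)
      also have "\<dots> \<le> \<eta> * M"
      proof (rule mult_mono)
        show "norm (\<gamma> (s + t) - \<gamma> s) \<le> \<eta>"
          using chord_le_arc[of s "s + t"] t \<delta> by (simp add: dist_norm norm_minus_commute)
      qed (use M \<eta> in auto)
      finally show ?thesis using 1 by (simp add: A_def C1_def algebra_simps)
    qed
    have B: "k\<^sup>2 \<le> B" "B \<le> M2\<^sup>2"
    proof -
      show "k\<^sup>2 \<le> B" unfolding B_def using k by (intro power_mono) auto
      have "B = (norm (deriv_n 2 \<xi>))\<^sup>2" using curvature_norm[of \<xi>] by (simp add: B_def power2_norm_eq_inner)
      also have "\<dots> \<le> M2\<^sup>2" using M2 by (intro power_mono) auto
      finally show "B \<le> M2\<^sup>2" .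
    qed
    have Bpos: "0 < B" using B(1) k by (smt (verit) zero_less_power)
    have "C1 * \<eta> \<le> \<epsilon> / 3 * B" using \<eta>(3) mult_left_mono[OF B(1), of "\<epsilon> / 3"] assms by linarith
    then have A: "(1 - \<epsilon> / 3) * B \<le> A" "A \<le> (1 + \<epsilon> / 3) * B" using AB by (auto simp: algebra_simps abs_le_iff)
    define r where "r = \<delta>\<^sup>2 / 12 * A"
    have A0: "0 \<le> A" using A(1) Bpos assms by (smt (verit) mult_nonneg_nonneg divide_le_eq_1)
    have A2: "A \<le> 2 * B" using A(2) mult_right_mono[of "1 + \<epsilon> / 3" 2 B] Bpos assms by linarith
    have r: "0 \<le> r" "r \<le> \<epsilon> / 3"
    proof -
      show "0 \<le> r" using A0 by (simp add: r_def)
      have "\<delta>\<^sup>2 \<le> \<eta>" using \<delta> \<eta> mult_mono[of \<delta> \<eta> \<delta> 1] by (simp add: power2_eq_square)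
      then have "\<delta>\<^sup>2 * A \<le> \<eta> * (2 * M2\<^sup>2)" using A0 A2 B \<eta> by (intro mult_mono) auto
      also have "\<dots> \<le> 2 * \<epsilon>" using \<eta>(4) by simp
      finally show "r \<le> \<epsilon> / 3" using assms unfolding r_def by linarith
    qed
    have r1: "r \<le> 1" using r assms by simp
    have "dist (\<gamma> s) (\<gamma> s') = sqrt (\<delta>\<^sup>2 * (1 - r))"
      using t(3) by (simp add: A_def r_def real_sqrt_unique[symmetric])
    also have "\<dots> = \<delta> * sqrt (1 - r)" using \<delta> by (simp add: real_sqrt_mult)
    finally have deficit: "s' - s - dist (\<gamma> s) (\<gamma> s') = \<delta> * (1 - sqrt (1 - r))" by (simp add: \<delta>_def algebra_simps)
    have \<delta>r: "\<delta> * (r / 2) = \<delta> ^ 3 / 24 * A" by (simp add: r_def power2_eq_square power3_eq_cube)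
    have \<delta>3: "0 \<le> \<delta> ^ 3 / 24" using \<delta> by simp
    have "(1 - \<epsilon>) * B \<le> A" using A(1) mult_right_mono[of "1 - \<epsilon>" "1 - \<epsilon> / 3" B] Bpos assms by linarith
    then have "\<delta> ^ 3 / 24 * ((1 - \<epsilon>) * B) \<le> \<delta> ^ 3 / 24 * A" using \<delta>3 by (rule mult_left_mono)
    also have "\<dots> \<le> \<delta> * (1 - sqrt (1 - r))"
      unfolding \<delta>r[symmetric] using \<delta> one_minus_sqrt_bounds(1)[OF r(1) r1] by (intro mult_left_mono) auto
    finally have lower: "(1 - \<epsilon>) / 24 * (X s' - X s) ^ 3 \<le> s' - s - dist (\<gamma> s) (\<gamma> s')"
      unfolding deficit X3 by (simp add: algebra_simps)
    have "A * (1 + r) \<le> ((1 + \<epsilon> / 3) * B) * (1 + \<epsilon> / 3)" using A A0 r Bpos assms by (intro mult_mono) auto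
    also have "\<dots> = (1 + 2 * \<epsilon> / 3 + \<epsilon> * \<epsilon> / 9) * B" by (simp add: field_simps)
    also have "\<dots> \<le> (1 + \<epsilon>) * B"
    proof (rule mult_right_mono)
      have "\<epsilon> * \<epsilon> \<le> \<epsilon>" using assms by (simp add: mult_left_le)
      then show "1 + 2 * \<epsilon> / 3 + \<epsilon> * \<epsilon> / 9 \<le> 1 + \<epsilon>" using assms by linarith
    qed (use Bpos in simp)
    finally have "\<delta> ^ 3 / 24 * (A * (1 + r)) \<le> \<delta> ^ 3 / 24 * ((1 + \<epsilon>) * B)" using \<delta>3 by (rule mult_left_mono)
    moreover have "\<delta> * (1 - sqrt (1 - r)) \<le> \<delta> * (r / 2 * (1 + r))"
      using \<delta> one_minus_sqrt_bounds(2)[OF r(1) r1] by (intro mult_left_mono) auto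
    moreover have "\<delta> * (r / 2 * (1 + r)) = \<delta> ^ 3 / 24 * (A * (1 + r))" using \<delta>r by (simp add: mult.assoc[symmetric])
    ultimately have "s' - s - dist (\<gamma> s) (\<gamma> s') \<le> (1 + \<epsilon>) / 24 * (X s' - X s) ^ 3"
      unfolding deficit X3 by (simp add: algebra_simps)
    with lower show ?thesis by blast
  qed
  show ?thesis by (rule that[OF \<eta>(1)]) (use main in auto)
qed

end


section \<open>Expansion coefficients and total curvature\<close>

text \<open>Multiplying the quotient by falling powers of \<open>x\<close> isolates one coefficient
  after the other. Orders 0 and 2 are included because the formal expansion leaves their
  coefficients open.\<close>

lemma cubic_coefficients_unique:
  fixes a b c d :: real and F :: "real filter"
  assumes F: "F \<noteq> bot" and id: "((\<lambda>x. x) \<longlongrightarrow> 0) F" and pos: "\<forall>\<^sub>F x in F. 0 < x"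
    and lim: "((\<lambda>x. (a + b * x + c * x ^ 2 + d * x ^ 3) / x ^ 3) \<longlongrightarrow> 0) F"
  shows "a = 0" "b = 0" "c = 0" "d = 0"
proof -
  have shift: "((\<lambda>x. (a + b * x + c * x ^ 2 + d * x ^ 3) / x ^ 3 * x ^ k) \<longlongrightarrow> 0 * 0 ^ k) F" for k
    by (intro tendsto_mult tendsto_power lim id)
  have "((\<lambda>x. a + b * x + c * x ^ 2 + d * x ^ 3) \<longlongrightarrow> a + b * 0 + c * 0 ^ 2 + d * 0 ^ 3) F"
    by (intro tendsto_intros id)
  moreover have "\<forall>\<^sub>F x in F. (a + b * x + c * x ^ 2 + d * x ^ 3) / x ^ 3 * x ^ 3 = a + b * x + c * x ^ 2 + d * x ^ 3"
    using pos by eventually_elim simp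
  then have "((\<lambda>x. a + b * x + c * x ^ 2 + d * x ^ 3) \<longlongrightarrow> 0) F"
    using Lim_transform_eventually[OF shift[of 3]] by simp
  ultimately show a: "a = 0" using tendsto_unique[OF F] by fastforce
  have "((\<lambda>x. b + c * x + d * x ^ 2) \<longlongrightarrow> b + c * 0 + d * 0 ^ 2) F"
    by (intro tendsto_intros id)
  moreover have "\<forall>\<^sub>F x in F. (a + b * x + c * x ^ 2 + d * x ^ 3) / x ^ 3 * x ^ 2 = b + c * x + d * x ^ 2"
    using pos by eventually_elim (simp add: a field_simps eval_nat_numeral)
  then have "((\<lambda>x. b + c * x + d * x ^ 2) \<longlongrightarrow> 0) F"
    using Lim_transform_eventually[OF shift[of 2]] by simp
  ultimately show b: "b = 0" using tendsto_unique[OF F] by fastforce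
  have "((\<lambda>x. c + d * x) \<longlongrightarrow> c + d * 0) F"
    by (intro tendsto_intros id)
  moreover have "\<forall>\<^sub>F x in F. (a + b * x + c * x ^ 2 + d * x ^ 3) / x ^ 3 * x ^ 1 = c + d * x"
    using pos by eventually_elim (simp add: a b field_simps eval_nat_numeral)
  then have "((\<lambda>x. c + d * x) \<longlongrightarrow> 0) F"
    using Lim_transform_eventually[OF shift[of 1]] by simp
  ultimately show c: "c = 0" using tendsto_unique[OF F] by fastforce
  have "((\<lambda>x. d) \<longlongrightarrow> d) F" by (rule tendsto_const)
  moreover have "\<forall>\<^sub>F x in F. (a + b * x + c * x ^ 2 + d * x ^ 3) / x ^ 3 = d"
    using pos by eventually_elim (simp add: a b c)
  then have "((\<lambda>x. d) \<longlongrightarrow> 0) F"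
    using Lim_transform_eventually[OF lim] by simp
  ultimately show "d = 0" using tendsto_unique[OF F] by blast
qed

text \<open>The ball and the exterior of the closed ball miss the frontier and are connected, the
  latter in dimension at least 2, so each lies inside \<open>S\<close> or outside it. Boundedness
  puts the exterior outside.\<close>

lemma open_bounded_frontier_sphere:
  fixes S :: "'a::euclidean_space set"
  assumes "open S" "bounded S" "S \<noteq> {}" "frontier S \<subseteq> sphere z r" "2 \<le> DIM('a)"
  shows "S = ball z r"
proof -
  have disj: "ball z r \<inter> frontier S = {}" "- cball z r \<inter> frontier S = {}"
    using assms(4) by auto
  have "S \<inter> - cball z r = {}"
  proof (rule ccontr)
    assume "S \<inter> - cball z r \<noteq> {}"
    moreover have "connected (- cball z r)"
      using assms(5) by (intro connected_complement_bounded_convex) auto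
    ultimately have "- cball z r \<subseteq> S" using connected_Int_frontier[of "- cball z r" S] disj by blast
    then have "bounded (- cball z r)" using assms(2) bounded_subset by blast
    then have "bounded (UNIV :: 'a set)"
      using bounded_Un[of "cball z r" "- cball z r"] by simp
    then show False by simp
  qed
  then have "S \<subseteq> interior (cball z r)" using assms(1) by (intro interior_maximal) auto
  then have sub: "S \<subseteq> ball z r" by simp
  then have "ball z r - S = {}"
    using connected_Int_frontier[of "ball z r" S] disj assms(3) by blast
  with sub show ?thesis by blast
qed

section \<open>Total curvature and the characterization of discs\<close>

context billiard
begin

text \<open>Over a period the tangent angle gains a positive multiple of 2 pi. If the gain were 4 pi
  or more, the tangent direction at \<open>s\<close> would recur at another boundary point, and
  strict support at these two points is contradictory.\<close>

lemma total_curvature: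
  obtains \<theta> where "\<And>s. (\<theta> has_real_derivative \<kappa> s) (at s)" "\<And>s. \<theta> (s + l) = \<theta> s + 2 * pi"
proof -
  obtain \<theta> where \<theta>: "\<And>s. (\<theta> has_real_derivative \<kappa> s) (at s)"
    "\<And>s. \<gamma>1 s $ 1 = cos (\<theta> s)" "\<And>s. \<gamma>1 s $ 2 = sin (\<theta> s)"
    by (rule tangent_angle_exists) blast
  have mono: "\<theta> a < \<theta> b" if "a < b" for a b
    by (rule DERIV_pos_imp_increasing[OF that]) (use \<theta>(1) \<kappa>_pos in blast)
  have "\<theta> (s + l) = \<theta> s + 2 * pi" for s
  proof -
    have "\<gamma>1 (s + l) = \<gamma>1 s" using deriv_n_period[of 1 s] by simp
    then have "sin (\<theta> (s + l)) = sin (\<theta> s)" "cos (\<theta> (s + l)) = cos (\<theta> s)" using \<theta>(2,3) by metis+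
    then obtain m :: int where m: "\<theta> (s + l) = \<theta> s + 2 * pi * of_int m" using sin_cos_eq_iff by blast
    have "0 < 2 * pi * of_int m" using mono[of s "s + l"] l_pos m by simp
    then have "0 < m" by (simp add: zero_less_mult_iff)
    moreover have "\<not> 2 \<le> m"
    proof
      assume "2 \<le> m"
      then have "2 * pi * 2 \<le> 2 * pi * of_int m" by (intro mult_left_mono) auto
      then have "\<theta> s + 2 * pi < \<theta> (s + l)" using m pi_gt_zero by linarith
      moreover have "continuous_on {s..s + l} \<theta>"
        using \<theta>(1) DERIV_isCont by (intro continuous_at_imp_continuous_on) blast
      ultimately obtain u where u: "s \<le> u" "u \<le> s + l" "\<theta> u = \<theta> s + 2 * pi"
        using IVT'[of \<theta> s "\<theta> s + 2 * pi" "s + l"] l_pos by auto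
      have "u \<noteq> s" "u \<noteq> s + l" using u(3) \<open>\<theta> s + 2 * pi < \<theta> (s + l)\<close> by auto
      then have "\<gamma> s \<noteq> \<gamma> u" using u \<gamma>_neq[of s u] by simp
      then have "0 < cross2 (\<gamma>1 s) (\<gamma> u - \<gamma> s)" "0 < cross2 (\<gamma>1 u) (\<gamma> s - \<gamma> u)"
        using strict_support[of u s] strict_support[of s u] by auto
      moreover have "\<gamma>1 u = \<gamma>1 s" unfolding vec_eq_2 \<theta>(2,3) u(3) by simp
      ultimately show False by (simp add: cross2_simps(2))
    qed
    ultimately have "m = 1" by linarith
    with m show ?thesis by simp
  qed
  with \<theta>(1) that show ?thesis by blast
qed

lemma constant_curvature_imp_ball:
  assumes \<kappa>: "\<And>s. \<kappa> s = a"
  obtains z where "\<Omega> = ball z (1 / a)"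
proof -
  have a: "0 < a" using \<kappa>_pos[of 0] \<kappa> by simp
  note d0 = vec_nth_has_real_derivative[OF \<gamma>_has_derivative]
  note d1 = vec_nth_has_real_derivative[OF \<gamma>1_has_derivative]
  \<comment> \<open>Coordinates of the centre of curvature, which stays fixed when \<kappa> is
    constant.\<close>
  define z1 z2 where "z1 s = \<gamma> s $ 1 - \<gamma>1 s $ 2 / a" and "z2 s = \<gamma> s $ 2 + \<gamma>1 s $ 1 / a" for s
  have "(z1 has_real_derivative \<gamma>1 s $ 1 - \<gamma>2 s $ 2 / a) (at s)" for s
    unfolding z1_def by (intro DERIV_diff DERIV_cdivide d0 d1)
  then have "(z1 has_real_derivative 0) (at s)" for s using a by (simp add: frenet \<kappa>)
  then have z1: "z1 s = z1 0" for s using DERIV_isconst_all by blast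
  have "(z2 has_real_derivative \<gamma>1 s $ 2 + \<gamma>2 s $ 1 / a) (at s)" for s
    unfolding z2_def by (intro DERIV_add DERIV_cdivide d0 d1)
  then have "(z2 has_real_derivative 0) (at s)" for s using a by (simp add: frenet \<kappa>)
  then have z2: "z2 s = z2 0" for s using DERIV_isconst_all by blast
  define z :: "real^2" where "z = vector [z1 0, z2 0]"
  have "dist z (\<gamma> s) = 1 / a" for s
  proof -
    have c: "(z - \<gamma> s) $ 1 = - \<gamma>1 s $ 2 / a" "(z - \<gamma> s) $ 2 = \<gamma>1 s $ 1 / a"
      using z1[of s] z2[of s] by (simp_all add: z_def vector_2 z1_def z2_def)
    have "(dist z (\<gamma> s))\<^sup>2 = (z - \<gamma> s) \<bullet> (z - \<gamma> s)" by (simp add: dist_norm power2_norm_eq_inner)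
    also have "\<dots> = (\<gamma>1 s \<bullet> \<gamma>1 s) / a\<^sup>2"
      unfolding inner_real2 c by (simp add: power2_eq_square add_divide_distrib)
    also have "\<dots> = (1 / a)\<^sup>2" by (simp add: unit_speed power_divide)
    finally show ?thesis using a by (simp add: power2_eq_iff_nonneg)
  qed
  then have "frontier \<Omega> \<subseteq> sphere z (1 / a)" unfolding range_\<gamma>[symmetric] by auto
  then have "\<Omega> = ball z (1 / a)"
    using table by (intro open_bounded_frontier_sphere) (auto simp: billiard_table_def)
  then show ?thesis by (rule that)
qed

text \<open>Differentiating the equation of the circle twice gives
  \<open>\<kappa> s * q = 1\<close>, where \<open>q\<close> is the normal component of the radius
  vector. The radius vector is orthogonal to the tangent, so \<open>|q| = r\<close>, and positive
  curvature fixes the sign.\<close>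

lemma ball_imp_constant_curvature:
  assumes ball: "\<Omega> = ball z r" and r: "0 < r"
  shows "\<kappa> s = 1 / r"
proof -
  have "\<gamma> t \<in> sphere z r" for t using range_\<gamma> r unfolding ball frontier_ball[OF r] by blast
  then have "(\<gamma> t - z) \<bullet> (\<gamma> t - z) = r\<^sup>2" for t
    by (simp add: power2_norm_eq_inner[symmetric] dist_norm norm_minus_commute)
  note sq = this
  define p where "p t = \<gamma> t - z" for t
  have p: "(p has_vector_derivative \<gamma>1 t) (at t)" for t
    unfolding p_def[abs_def]
    using has_vector_derivative_diff[OF \<gamma>_has_derivative[of t] has_vector_derivative_const[of z]] by simp
  have "p t \<bullet> \<gamma>1 t = 0" for t
  proof -
    have "((\<lambda>t. r\<^sup>2) has_real_derivative p t \<bullet> \<gamma>1 t + \<gamma>1 t \<bullet> p t) (at t)"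
      using inner_has_real_derivative[OF p[of t] p[of t]] sq by (simp add: p_def)
    then have "p t \<bullet> \<gamma>1 t + \<gamma>1 t \<bullet> p t = 0" using DERIV_unique DERIV_const by blast
    then show ?thesis by (simp add: inner_commute)
  qed
  note orth = this
  have "((\<lambda>t. 0) has_real_derivative p s \<bullet> \<gamma>2 s + \<gamma>1 s \<bullet> \<gamma>1 s) (at s)"
    using inner_has_real_derivative[OF p[of s] \<gamma>1_has_derivative[of s]] orth by simp
  then have "p s \<bullet> \<gamma>2 s + \<gamma>1 s \<bullet> \<gamma>1 s = 0" using DERIV_unique DERIV_const by blast
  then have 1: "\<kappa> s * (p s $ 1 * \<gamma>1 s $ 2 - p s $ 2 * \<gamma>1 s $ 1) = 1"
    unfolding unit_speed inner_real2[of "p s"] frenet by (simp add: algebra_simps)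
  define q where "q = p s $ 1 * \<gamma>1 s $ 2 - p s $ 2 * \<gamma>1 s $ 1"
  have "q\<^sup>2 + (p s \<bullet> \<gamma>1 s)\<^sup>2 = (p s \<bullet> p s) * (\<gamma>1 s \<bullet> \<gamma>1 s)"
    unfolding inner_real2 q_def by (simp add: power2_eq_square algebra_simps)
  then have "q\<^sup>2 = r\<^sup>2" using orth[of s] unit_speed[of s] sq[of s] by (simp add: p_def)
  moreover have "0 < q" using 1 \<kappa>_pos[of s] unfolding q_def[symmetric] by (metis zero_less_mult_pos zero_less_one)
  ultimately have "q = r" using r by (simp add: power2_eq_iff_nonneg)
  then show ?thesis using 1 r unfolding q_def[symmetric] by (simp add: field_simps)
qed

lemma rotation_displacement:
  assumes "has_rotation_number l s \<omega>"
  shows "(\<lambda>N. (s (int N) - s (- int N)) / (2 * real N)) \<longlonglongrightarrow> \<omega> * l"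
proof -
  have "(\<lambda>N. s (int N) / (of_int (int N) * l)) \<longlonglongrightarrow> \<omega>"
    using assms filterlim_compose[OF _ filterlim_int_sequentially] unfolding has_rotation_number_def by blast
  moreover have "filterlim (\<lambda>N. - int N) at_bot sequentially"
    unfolding filterlim_at_bot eventually_sequentially
  proof
    fix Z :: int
    show "\<exists>M. \<forall>N\<ge>M. - int N \<le> Z" by (intro exI[of _ "nat (- Z)"]) auto
  qed
  then have "(\<lambda>N. s (- int N) / (of_int (- int N) * l)) \<longlonglongrightarrow> \<omega>"
    using assms filterlim_compose[of "\<lambda>i. s i / (of_int i * l)" "nhds \<omega>" at_bot] unfolding has_rotation_number_def by blast
  ultimately have "(\<lambda>N. l / 2 * (s (int N) / (of_int (int N) * l) + s (- int N) / (of_int (- int N) * l))) \<longlonglongrightarrow> l / 2 * (\<omega> + \<omega>)"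
    by (intro tendsto_intros)
  moreover have eq: "l / 2 * (s (int N) / (of_int (int N) * l) + s (- int N) / (of_int (- int N) * l)) = (s (int N) - s (- int N)) / (2 * real N)" for N
    using l_pos by (cases "N = 0") (simp_all add: field_simps)
  moreover have "l / 2 * (\<omega> + \<omega>) = \<omega> * l" by simp
  ultimately show ?thesis by (simp only: eq)
qed

text \<open>Splits off the telescoping arc length, which contributes the linear term
  \<open>- \<omega> * l\<close>; the remaining sum of deficits is of third order.\<close>

lemma action_deficit:
  assumes "m \<le> n"
  shows "twist.action m n s = (\<Sum>i\<in>{m..<n}. s (i + 1) - s i - dist (\<gamma> (s i)) (\<gamma> (s (i + 1)))) - (s n - s m)"
proof -
  have "(\<Sum>i\<in>{m..<n}. s (i + 1) - s i - dist (\<gamma> (s i)) (\<gamma> (s (i + 1))))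
      = (\<Sum>i\<in>{m..<n}. s (i + 1) - s i) + twist.action m n s"
    unfolding twist.action_def gen_fun_def sum.distrib[symmetric] by simp
  then show ?thesis using sum_int_telescope[OF assms, of s] by simp
qed

end

section \<open>Cubic asymptotics of Mather's function at 0\<close>

context lazutkin
begin

lemma X_lower_bound:
  obtains k where "0 < k" "\<And>s s'. s \<le> s' \<Longrightarrow> k * (s' - s) \<le> X s' - X s"
proof -
  obtain k where k: "0 < k" "\<And>t. k \<le> \<kappa> t" by (rule \<kappa>_bounded_below) blast
  have "k powr (2/3) * (s' - s) \<le> X s' - X s" if "s \<le> s'" for s s'
  proof (cases "s = s'")
    case False
    then obtain \<xi> where "X s' - X s = (s' - s) * \<kappa> \<xi> powr (2/3)" using X_mean_value[of s s'] \<open>s \<le> s'\<close> by auto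
    moreover have "k powr (2/3) \<le> \<kappa> \<xi> powr (2/3)" using k by (intro powr_mono2) auto
    ultimately show ?thesis using that by (simp add: mult.commute mult_left_mono)
  qed simp
  then show ?thesis using that[of "k powr (2/3)"] k by simp
qed

text \<open>
  The cubic deficit dominates its tangent line at the average step \<open>w\<close>; for long chords
  this uses only that the deficit is bounded away from \<open>0\<close>.
\<close>

lemma deficit_ge_tangent:
  assumes \<epsilon>: "0 < \<epsilon>" "\<epsilon> < 1"
  obtains w0 where "0 < w0" "\<And>w s s'. 0 \<le> w \<Longrightarrow> w \<le> w0 \<Longrightarrow> s \<le> s' \<Longrightarrow> s' \<le> s + l \<Longrightarrow>
    (1 - \<epsilon>) / 24 * (3 * w\<^sup>2 * (X s' - X s) - 2 * w ^ 3) \<le> s' - s - dist (\<gamma> s) (\<gamma> s')"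
proof -
  obtain \<eta> where \<eta>: "0 < \<eta>"
    "\<And>s s'. s \<le> s' \<Longrightarrow> s' \<le> s + \<eta> \<Longrightarrow> (1 - \<epsilon>) / 24 * (X s' - X s) ^ 3 \<le> s' - s - dist (\<gamma> s) (\<gamma> s')"
    using arc_chord_deficit[OF \<epsilon>] by metis
  obtain k where k: "0 < k" "\<And>s s'. s \<le> s' \<Longrightarrow> k * (s' - s) \<le> X s' - X s" by (rule X_lower_bound) blast
  \<comment> \<open>Solves \<open>3 * w0\<^sup>2 * L = (k * \<eta>) ^ 3\<close>: even at the largest
    possible step \<open>L\<close>, the tangent line does not exceed the cube reached on an arc of
    length \<open>\<eta>\<close>.\<close>
  define w0 where "w0 = sqrt ((k * \<eta>) ^ 3 / (3 * L))"
  have w0: "0 < w0" using k \<eta> L_pos by (simp add: w0_def)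
  show ?thesis
  proof (rule that[OF w0])
    fix w s s' assume w: "0 \<le> w" "w \<le> w0" and s: "s \<le> s'" "s' \<le> s + l"
    have \<epsilon>': "0 \<le> (1 - \<epsilon>) / 24" using \<epsilon> by simp
    show "(1 - \<epsilon>) / 24 * (3 * w\<^sup>2 * (X s' - X s) - 2 * w ^ 3) \<le> s' - s - dist (\<gamma> s) (\<gamma> s')"
    proof (cases "s' \<le> s + \<eta>")
      case True
      have "0 \<le> X s' - X s" using s X_le_iff by simp
      then have "(1 - \<epsilon>) / 24 * (3 * w\<^sup>2 * (X s' - X s) - 2 * w ^ 3) \<le> (1 - \<epsilon>) / 24 * (X s' - X s) ^ 3"
        by (intro mult_left_mono cube_tangent_le w \<epsilon>')
      also have "\<dots> \<le> s' - s - dist (\<gamma> s) (\<gamma> s')" using \<eta>(2) s True by blast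
      finally show ?thesis .
    next
      case False
      have "X s' - X s \<le> L" using X_le_iff[of s' "s + l"] s X_period[of s] by simp
      moreover have "w\<^sup>2 \<le> w0\<^sup>2" using w by (intro power_mono)
      moreover have "w0\<^sup>2 = (k * \<eta>) ^ 3 / (3 * L)" using k \<eta> L_pos by (simp add: w0_def)
      ultimately have "3 * w\<^sup>2 * (X s' - X s) \<le> 3 * ((k * \<eta>) ^ 3 / (3 * L)) * L"
        using s X_le_iff k(1) \<eta>(1) L_pos by (intro mult_mono) auto
      also have "\<dots> = (k * \<eta>) ^ 3" using L_pos by simp
      also have "\<dots> \<le> (X (s + \<eta>) - X s) ^ 3" using k(2)[of s "s + \<eta>"] k(1) \<eta>(1) by (intro power_mono) auto
      finally have "3 * w\<^sup>2 * (X s' - X s) - 2 * w ^ 3 \<le> (X (s + \<eta>) - X s) ^ 3"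
        using zero_le_power[OF w(1), of 3] by linarith
      then have "(1 - \<epsilon>) / 24 * (3 * w\<^sup>2 * (X s' - X s) - 2 * w ^ 3) \<le> (1 - \<epsilon>) / 24 * (X (s + \<eta>) - X s) ^ 3"
        using \<epsilon>' by (rule mult_left_mono)
      also have "\<dots> \<le> \<eta> - dist (\<gamma> s) (\<gamma> (s + \<eta>))" using \<eta>(2)[of s "s + \<eta>"] \<eta>(1) by simp
      \<comment> \<open>Lengthening an arc does not decrease its deficit, since the added chord is
        at most the added arc.\<close>
      also have "\<dots> \<le> s' - s - dist (\<gamma> s) (\<gamma> s')"
        using dist_triangle[of "\<gamma> s" "\<gamma> s'" "\<gamma> (s + \<eta>)"] chord_le_arc[of "s + \<eta>" s'] False by simp
      finally show ?thesis .
    qed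
  qed
qed

lemma rotation_displacement_X:
  assumes "has_rotation_number l s \<omega>"
  shows "(\<lambda>N. (X (s (int N)) - X (s (- int N))) / (2 * real N)) \<longlonglongrightarrow> \<omega> * L"
proof -
  define e where "e N = X (s (int N)) - X (s (- int N)) - (s (int N) - s (- int N)) * (L / l)" for N
  have e: "\<bar>e N\<bar> \<le> 2 * L" for N
  proof -
    have "\<bar>a - b - (p - q)\<bar> \<le> 2 * M" if "\<bar>a - c - p\<bar> \<le> M" "\<bar>b - c - q\<bar> \<le> M" for a b c p q M :: real
      using that by linarith
    from this[OF X_linear_growth X_linear_growth] show ?thesis unfolding e_def left_diff_distrib .
  qed
  have "(\<lambda>N. e N / (2 * real N)) \<longlonglongrightarrow> 0"
  proof (rule Lim_null_comparison)
    show "\<forall>\<^sub>F N in sequentially. norm (e N / (2 * real N)) \<le> L * (1 / real N)"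
    proof (rule always_eventually, rule allI)
      fix N
      have "\<bar>e N\<bar> / (2 * real N) \<le> (2 * L) / (2 * real N)" using e by (intro divide_right_mono) auto
      then show "norm (e N / (2 * real N)) \<le> L * (1 / real N)" by simp
    qed
    show "(\<lambda>N. L * (1 / real N)) \<longlonglongrightarrow> 0" using tendsto_mult[OF tendsto_const lim_1_over_n, of L] by simp
  qed
  moreover have "(\<lambda>N. (s (int N) - s (- int N)) / (2 * real N) * (L / l)) \<longlonglongrightarrow> \<omega> * l * (L / l)"
    by (intro tendsto_mult tendsto_const rotation_displacement[OF assms])
  ultimately have "(\<lambda>N. e N / (2 * real N) + (s (int N) - s (- int N)) / (2 * real N) * (L / l)) \<longlonglongrightarrow> 0 + \<omega> * l * (L / l)"
    by (rule tendsto_add)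
  moreover have "e N / (2 * real N) + (s (int N) - s (- int N)) / (2 * real N) * (L / l) = (X (s (int N)) - X (s (- int N))) / (2 * real N)" for N
  proof -
    have "(a - b * c) / n + b / n * c = a / n" for a b c n :: real by (simp add: diff_divide_distrib)
    then show ?thesis unfolding e_def .
  qed
  ultimately show ?thesis using l_pos by simp
qed

text \<open>The tangent bound is affine in the \<open>X\<close>-increments, so its sum telescopes
  and sees only the mean step, which tends to \<open>w = \<omega> * L\<close>; there it equals
  \<open>3 * w ^ 3 - 2 * w ^ 3\<close>.\<close>

lemma mather_beta_lower_bound:
  assumes \<epsilon>: "0 < \<epsilon>" "\<epsilon> < 1"
  obtains w0 where "0 < w0" "\<And>\<omega>. 0 < \<omega> \<Longrightarrow> \<omega> < 1 \<Longrightarrow> \<omega> * L \<le> w0 \<Longrightarrow>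
    (1 - \<epsilon>) / 24 * (\<omega> * L) ^ 3 \<le> mather_beta l \<gamma> \<omega> + \<omega> * l"
proof -
  obtain w0 where w0: "0 < w0" and tangent: "\<And>w s s'. 0 \<le> w \<Longrightarrow> w \<le> w0 \<Longrightarrow> s \<le> s' \<Longrightarrow> s' \<le> s + l \<Longrightarrow>
    (1 - \<epsilon>) / 24 * (3 * w\<^sup>2 * (X s' - X s) - 2 * w ^ 3) \<le> s' - s - dist (\<gamma> s) (\<gamma> s')"
    using deficit_ge_tangent[OF \<epsilon>] by metis
  show ?thesis
  proof (rule that[OF w0])
    fix \<omega> assume \<omega>: "0 < \<omega>" "\<omega> < 1" "\<omega> * L \<le> w0"
    define w where "w = \<omega> * L"
    have w: "0 \<le> w" "w \<le> w0" using \<omega> L_pos by (auto simp: w_def)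
    obtain s where s: "twist.minimal s" "has_rotation_number l s \<omega>"
      "(\<lambda>N. twist.action (- int N) (int N) s / (2 * real N)) \<longlonglongrightarrow> mather_beta l \<gamma> \<omega>"
      using mather_beta_attained[OF \<omega>(1,2)] by metis
    define d where "d N = (s (int N) - s (- int N)) / (2 * real N)" for N
    define x where "x N = (X (s (int N)) - X (s (- int N))) / (2 * real N)" for N
    have "(1 - \<epsilon>) / 24 * (3 * w\<^sup>2 * x N - 2 * w ^ 3) - d N \<le> twist.action (- int N) (int N) s / (2 * real N)"
      if N: "0 < N" for N
    proof -
      have "(1 - \<epsilon>) / 24 * (3 * w\<^sup>2 * (X (s (int N)) - X (s (- int N))) - 2 * w ^ 3 * (2 * real N))
        = (\<Sum>i\<in>{- int N..<int N}. (1 - \<epsilon>) / 24 * (3 * w\<^sup>2 * (X (s (i + 1)) - X (s i)) - 2 * w ^ 3))"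
      proof -
        have "(\<Sum>i\<in>{- int N..<int N}. (1 - \<epsilon>) / 24 * (3 * w\<^sup>2 * (X (s (i + 1)) - X (s i)) - 2 * w ^ 3))
          = (1 - \<epsilon>) / 24 * (3 * w\<^sup>2 * (\<Sum>i\<in>{- int N..<int N}. X (s (i + 1)) - X (s i)) - (\<Sum>i\<in>{- int N..<int N}. 2 * w ^ 3))"
          unfolding sum_distrib_left[of "3 * w\<^sup>2"] sum_subtractf[symmetric] sum_distrib_left[of "(1 - \<epsilon>) / 24"] ..
        then show ?thesis using sum_int_telescope[of "- int N" "int N" "\<lambda>i. X (s i)"] by simp
      qed
      also have "\<dots> \<le> (\<Sum>i\<in>{- int N..<int N}. s (i + 1) - s i - dist (\<gamma> (s i)) (\<gamma> (s (i + 1))))"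
        using minimal_step[OF s(1)] by (intro sum_mono tangent w) auto
      finally have "(1 - \<epsilon>) / 24 * (3 * w\<^sup>2 * (X (s (int N)) - X (s (- int N))) - 2 * w ^ 3 * (2 * real N))
          - (s (int N) - s (- int N)) \<le> twist.action (- int N) (int N) s"
        using action_deficit[of "- int N" "int N" s] by simp
      then have "((1 - \<epsilon>) / 24 * (3 * w\<^sup>2 * (X (s (int N)) - X (s (- int N))) - 2 * w ^ 3 * (2 * real N))
          - (s (int N) - s (- int N))) / (2 * real N) \<le> twist.action (- int N) (int N) s / (2 * real N)"
        by (rule divide_right_mono) simp
      moreover have scale: "(c * (p * a - q * n) - e) / n = c * (p * (a / n) - q) - e / n" if "n \<noteq> 0" for a c e n p q :: real
        using that by (simp add: field_simps)
      have "2 * real N \<noteq> 0" using N by simp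
      note scale[OF this]
      ultimately show ?thesis unfolding d_def x_def by (simp only:)
    qed
    then have "\<exists>M. \<forall>N\<ge>M. (1 - \<epsilon>) / 24 * (3 * w\<^sup>2 * x N - 2 * w ^ 3) - d N \<le> twist.action (- int N) (int N) s / (2 * real N)"
      by (intro exI[of _ 1]) auto
    moreover have "(\<lambda>N. (1 - \<epsilon>) / 24 * (3 * w\<^sup>2 * x N - 2 * w ^ 3) - d N) \<longlonglongrightarrow> (1 - \<epsilon>) / 24 * (3 * w\<^sup>2 * (\<omega> * L) - 2 * w ^ 3) - \<omega> * l"
      unfolding x_def d_def by (intro tendsto_intros rotation_displacement_X[OF s(2)] rotation_displacement[OF s(2)])
    ultimately have "(1 - \<epsilon>) / 24 * (3 * w\<^sup>2 * (\<omega> * L) - 2 * w ^ 3) - \<omega> * l \<le> mather_beta l \<gamma> \<omega>"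
      using s(3) by (intro LIMSEQ_le)
    moreover have "3 * w\<^sup>2 * (\<omega> * L) - 2 * w ^ 3 = (\<omega> * L) ^ 3"
      by (simp add: w_def power2_eq_square power3_eq_cube)
    ultimately show "(1 - \<epsilon>) / 24 * (\<omega> * L) ^ 3 \<le> mather_beta l \<gamma> \<omega> + \<omega> * l" by simp
  qed
qed

text \<open>The competitor has equal steps in Lazutkin's parameter.\<close>

lemma mather_beta_upper_bound:
  assumes \<epsilon>: "0 < \<epsilon>" "\<epsilon> < 1"
  obtains w0 where "0 < w0" "\<And>\<omega>. 0 < \<omega> \<Longrightarrow> \<omega> < 1 \<Longrightarrow> \<omega> * L < w0 \<Longrightarrow>
    mather_beta l \<gamma> \<omega> + \<omega> * l \<le> (1 + \<epsilon>) / 24 * (\<omega> * L) ^ 3"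
proof -
  obtain \<eta> where \<eta>: "0 < \<eta>"
    "\<And>s s'. s \<le> s' \<Longrightarrow> s' \<le> s + \<eta> \<Longrightarrow> s' - s - dist (\<gamma> s) (\<gamma> s') \<le> (1 + \<epsilon>) / 24 * (X s' - X s) ^ 3"
    using arc_chord_deficit[OF \<epsilon>] by metis
  obtain k where k: "0 < k" "\<And>s s'. s \<le> s' \<Longrightarrow> k * (s' - s) \<le> X s' - X s" by (rule X_lower_bound) blast
  have w0: "0 < k * \<eta>" using k \<eta> by simp
  have "\<forall>x. \<exists>s. X s = x" using X_surj by metis
  then obtain Y where Y: "\<And>x. X (Y x) = x" by metis
  show ?thesis
  proof (rule that[OF w0])
    fix \<omega> assume \<omega>: "0 < \<omega>" "\<omega> < 1" "\<omega> * L < k * \<eta>"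
    obtain s where s: "twist.minimal s" "has_rotation_number l s \<omega>"
      "(\<lambda>N. twist.action (- int N) (int N) s / (2 * real N)) \<longlonglongrightarrow> mather_beta l \<gamma> \<omega>"
      using mather_beta_attained[OF \<omega>(1,2)] by metis
    define d where "d N = (s (int N) - s (- int N)) / (2 * real N)" for N
    define x where "x N = (X (s (int N)) - X (s (- int N))) / (2 * real N)" for N
    have xlim: "x \<longlonglongrightarrow> \<omega> * L" unfolding x_def[abs_def] by (rule rotation_displacement_X[OF s(2)])
    have bound: "twist.action (- int N) (int N) s / (2 * real N) \<le> (1 + \<epsilon>) / 24 * x N ^ 3 - d N"
      if N: "0 < N" and xN: "x N < k * \<eta>" for N
    proof -
      \<comment> \<open>The step is \<open>x N\<close> rather than its limit
        \<open>\<omega> * L\<close>, so that \<open>t\<close> meets \<open>s\<close> at both ends of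
        the window; \<open>x N < k * \<eta>\<close> makes every arc short enough for the deficit
        estimate.\<close>
      define t where "t i = Y (X (s (- int N)) + of_int (i + int N) * x N)" for i
      have Xt: "X (t i) = X (s (- int N)) + of_int (i + int N) * x N" for i by (simp add: t_def Y)
      have Xt_step: "X (t (i + 1)) - X (t i) = x N" for i by (simp add: Xt algebra_simps)
      have sadm: "twist.admissible (- int N) (int N) s" using s(1) by (simp add: twist.minimal_def)
      have s_le: "s (- int N) \<le> s (int N)" "s (int N) \<le> s (- int N) + of_int (int (2 * N)) * l"
        using twist.admissible_bounds[OF sadm, of "- int N" "int N"] by simp_all
      have x0: "0 \<le> x N" using s_le(1) X_le_iff by (simp add: x_def)
      have xL: "x N \<le> L"
      proof -
        have "X (s (int N)) \<le> X (s (- int N)) + of_int (int (2 * N)) * L"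
          using s_le(2) X_le_iff X_period_int by metis
        then show ?thesis using N by (simp add: x_def field_simps)
      qed
      have step: "t i \<le> t (i + 1)" "t (i + 1) \<le> t i + l" for i
      proof -
        show le: "t i \<le> t (i + 1)" using Xt_step[of i] x0 by (subst X_le_iff[symmetric]) linarith
        show "t (i + 1) \<le> t i + l" using Xt_step[of i] xL by (subst X_le_iff[symmetric]) (simp add: X_period)
      qed
      have short: "t (i + 1) \<le> t i + \<eta>" for i
      proof -
        have "k * (t (i + 1) - t i) \<le> k * \<eta>" using k(2)[OF step(1)[of i]] Xt_step[of i] xN by linarith
        then show ?thesis using k(1) by simp
      qed
      have eq: "t i = t' \<longleftrightarrow> X (t i) = X t'" for i t' using X_le_iff by (metis order_antisym order_refl)
      have ends: "t (- int N) = s (- int N)" "t (int N) = s (int N)"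
      proof -
        show "t (- int N) = s (- int N)" unfolding eq Xt by simp
        show "t (int N) = s (int N)" unfolding eq Xt using N by (simp add: x_def field_simps)
      qed
      have "twist.action (- int N) (int N) s \<le> twist.action (- int N) (int N) t"
        using N ends step by (intro twist.minimalD[OF s(1)]) (auto simp: twist.admissible_def)
      also have "\<dots> = (\<Sum>i\<in>{- int N..<int N}. t (i + 1) - t i - dist (\<gamma> (t i)) (\<gamma> (t (i + 1)))) - (s (int N) - s (- int N))"
        using action_deficit[of "- int N" "int N" t] ends by simp
      also have "(\<Sum>i\<in>{- int N..<int N}. t (i + 1) - t i - dist (\<gamma> (t i)) (\<gamma> (t (i + 1))))
          \<le> (\<Sum>i\<in>{- int N..<int N}. (1 + \<epsilon>) / 24 * x N ^ 3)"
        using \<eta>(2)[OF step(1) short] unfolding Xt_step by (intro sum_mono) blast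
      also have "\<dots> = 2 * real N * ((1 + \<epsilon>) / 24 * x N ^ 3)" by simp
      finally have "twist.action (- int N) (int N) s \<le> 2 * real N * ((1 + \<epsilon>) / 24 * x N ^ 3) - (s (int N) - s (- int N))"
        by simp
      from divide_right_mono[OF this, of "2 * real N"] N show ?thesis
        by (simp add: d_def diff_divide_distrib)
    qed
    have "\<forall>\<^sub>F N in sequentially. x N < k * \<eta>" using order_tendstoD(2)[OF xlim \<omega>(3)] .
    then obtain M where "\<And>N. M \<le> N \<Longrightarrow> x N < k * \<eta>" unfolding eventually_sequentially by blast
    then have "\<exists>M. \<forall>N\<ge>M. twist.action (- int N) (int N) s / (2 * real N) \<le> (1 + \<epsilon>) / 24 * x N ^ 3 - d N"
      using bound by (intro exI[of _ "Suc M"]) auto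
    moreover have "(\<lambda>N. (1 + \<epsilon>) / 24 * x N ^ 3 - d N) \<longlonglongrightarrow> (1 + \<epsilon>) / 24 * (\<omega> * L) ^ 3 - \<omega> * l"
      unfolding d_def by (intro tendsto_intros xlim rotation_displacement[OF s(2)])
    ultimately have "mather_beta l \<gamma> \<omega> \<le> (1 + \<epsilon>) / 24 * (\<omega> * L) ^ 3 - \<omega> * l"
      using s(3) by (intro LIMSEQ_le)
    then show "mather_beta l \<gamma> \<omega> + \<omega> * l \<le> (1 + \<epsilon>) / 24 * (\<omega> * L) ^ 3" by simp
  qed
qed

lemma mather_beta_asymptotics:
  "((\<lambda>\<omega>. (mather_beta l \<gamma> \<omega> + \<omega> * l) / \<omega> ^ 3) \<longlongrightarrow> L ^ 3 / 24) (at_right 0)"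
proof (rule tendstoI)
  fix e :: real assume e: "0 < e"
  define \<epsilon> where "\<epsilon> = min (1 / 2) (e / L ^ 3)"
  have \<epsilon>: "0 < \<epsilon>" "\<epsilon> < 1" using e L_pos by (auto simp: \<epsilon>_def)
  have "\<epsilon> * L ^ 3 \<le> e / L ^ 3 * L ^ 3" using L_pos by (intro mult_right_mono) (auto simp: \<epsilon>_def)
  then have \<epsilon>e: "\<epsilon> * L ^ 3 \<le> e" using L_pos by simp
  obtain w1 where w1: "0 < w1" "\<And>\<omega>. 0 < \<omega> \<Longrightarrow> \<omega> < 1 \<Longrightarrow> \<omega> * L \<le> w1 \<Longrightarrow>
    (1 - \<epsilon>) / 24 * (\<omega> * L) ^ 3 \<le> mather_beta l \<gamma> \<omega> + \<omega> * l"
    using mather_beta_lower_bound[OF \<epsilon>] by metis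
  obtain w2 where w2: "0 < w2" "\<And>\<omega>. 0 < \<omega> \<Longrightarrow> \<omega> < 1 \<Longrightarrow> \<omega> * L < w2 \<Longrightarrow>
    mather_beta l \<gamma> \<omega> + \<omega> * l \<le> (1 + \<epsilon>) / 24 * (\<omega> * L) ^ 3"
    using mather_beta_upper_bound[OF \<epsilon>] by metis
  define b where "b = min 1 (min (w1 / L) (w2 / L))"
  have b: "0 < b" using w1 w2 L_pos by (simp add: b_def)
  have "dist ((mather_beta l \<gamma> \<omega> + \<omega> * l) / \<omega> ^ 3) (L ^ 3 / 24) < e" if \<omega>: "0 < \<omega>" "\<omega> < b" for \<omega>
  proof -
    have "\<omega> < 1" "\<omega> < w1 / L" "\<omega> < w2 / L" using \<omega> by (auto simp: b_def)
    then have "\<omega> < 1" "\<omega> * L < w1" "\<omega> * L < w2" using L_pos by (auto simp: pos_less_divide_eq)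
    then have 1: "(1 - \<epsilon>) / 24 * (\<omega> * L) ^ 3 \<le> mather_beta l \<gamma> \<omega> + \<omega> * l"
      "mather_beta l \<gamma> \<omega> + \<omega> * l \<le> (1 + \<epsilon>) / 24 * (\<omega> * L) ^ 3"
      using w1(2) w2(2) \<omega> by auto
    define v where "v = (mather_beta l \<gamma> \<omega> + \<omega> * l) / \<omega> ^ 3"
    have v: "mather_beta l \<gamma> \<omega> + \<omega> * l = v * \<omega> ^ 3" using \<omega> by (simp add: v_def)
    have "((1 - \<epsilon>) / 24 * L ^ 3) * \<omega> ^ 3 \<le> v * \<omega> ^ 3" "v * \<omega> ^ 3 \<le> ((1 + \<epsilon>) / 24 * L ^ 3) * \<omega> ^ 3"
      using 1 unfolding v by (simp_all add: power_mult_distrib mult_ac)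
    moreover have "0 < \<omega> ^ 3" using \<omega> by simp
    ultimately have "(1 - \<epsilon>) / 24 * L ^ 3 \<le> v" "v \<le> (1 + \<epsilon>) / 24 * L ^ 3" using mult_le_cancel_right_pos by blast+
    moreover have "\<bar>v - c / 24\<bar> \<le> a * c / 24" if "(1 - a) / 24 * c \<le> v" "v \<le> (1 + a) / 24 * c" for a c v :: real
    proof -
      have "c - a * c \<le> 24 * v" "24 * v \<le> c + a * c" using that by (simp_all add: algebra_simps)
      then show ?thesis unfolding abs_le_iff by (simp add: field_simps)
    qed
    ultimately have "\<bar>v - L ^ 3 / 24\<bar> \<le> \<epsilon> * L ^ 3 / 24" by blast
    then show ?thesis using \<epsilon>e e by (simp add: v_def dist_real_def)
  qed
  then show "\<forall>\<^sub>F \<omega> in at_right 0. dist ((mather_beta l \<gamma> \<omega> + \<omega> * l) / \<omega> ^ 3) (L ^ 3 / 24) < e"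
    unfolding eventually_at_right_field using b by auto
qed

text \<open>The remainder of the expansion up to order 3 is \<open>O(x ^ 4)\<close>, and the
  asymptotics restrict to any set accumulating at 0 from the right. Subtracting the two leaves a
  cubic polynomial that is \<open>o(x ^ 3)\<close>.\<close>

lemma formal_coefficients:
  assumes "formal_taylor_expansion E (mather_beta l \<gamma>) \<beta>"
  shows "\<beta> 1 = - l" "\<beta> 3 = L ^ 3 / 4"
proof -
  define F where "F = at 0 within (E \<inter> {0<..})"
  define r where "r x = mather_beta l \<gamma> x - (\<Sum>k\<le>3. \<beta> k * x ^ k / fact k)" for x
  have F: "F \<noteq> bot" using assms trivial_limit_within by (auto simp: F_def formal_taylor_expansion_def)
  have pos: "\<forall>\<^sub>F x in F. 0 < x" unfolding F_def by (simp add: eventually_at_filter)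
  have id: "((\<lambda>x. x) \<longlongrightarrow> 0) F" unfolding F_def by (rule tendsto_ident_at)
  have "r \<in> O[F](\<lambda>x. x ^ (3 + 1))"
    using assms unfolding formal_taylor_expansion_def r_def F_def by blast
  then obtain C where "\<forall>\<^sub>F x in F. norm (r x) \<le> C * norm (x ^ (3 + 1))" by (rule landau_o.bigE)
  with pos have "\<forall>\<^sub>F x in F. norm (r x / x ^ 3) \<le> C * x"
  proof eventually_elim
    case (elim x)
    have "\<bar>r x\<bar> / x ^ 3 \<le> C * x ^ 4 / x ^ 3" using elim by (intro divide_right_mono) auto
    also have "C * x ^ 4 / x ^ 3 = C * x" using elim(1) by (simp add: eval_nat_numeral)
    finally show ?case using elim(1) by simp
  qed
  moreover have "((\<lambda>x. C * x) \<longlongrightarrow> 0) F" using tendsto_mult[OF tendsto_const id, of C] by simp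
  ultimately have r0: "((\<lambda>x. r x / x ^ 3) \<longlongrightarrow> 0) F" by (rule Lim_null_comparison)
  have "((\<lambda>\<omega>. (mather_beta l \<gamma> \<omega> + \<omega> * l) / \<omega> ^ 3) \<longlongrightarrow> L ^ 3 / 24) F"
    using mather_beta_asymptotics unfolding F_def by (rule tendsto_within_subset) simp
  then have "((\<lambda>x. (mather_beta l \<gamma> x + x * l) / x ^ 3 - r x / x ^ 3 - L ^ 3 / 24) \<longlongrightarrow> L ^ 3 / 24 - 0 - L ^ 3 / 24) F"
    by (intro tendsto_diff r0 tendsto_const)
  moreover have "\<forall>\<^sub>F x in F. (mather_beta l \<gamma> x + x * l) / x ^ 3 - r x / x ^ 3 - L ^ 3 / 24
      = (\<beta> 0 + (\<beta> 1 + l) * x + \<beta> 2 / 2 * x ^ 2 + (\<beta> 3 / 6 - L ^ 3 / 24) * x ^ 3) / x ^ 3"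
    using pos
  proof eventually_elim
    case (elim x)
    have "(\<Sum>k\<le>3. \<beta> k * x ^ k / fact k) = \<beta> 0 + \<beta> 1 * x + \<beta> 2 / 2 * x ^ 2 + \<beta> 3 / 6 * x ^ 3"
      by (simp add: eval_nat_numeral)
    then have "mather_beta l \<gamma> x + x * l - r x - L ^ 3 / 24 * x ^ 3
        = \<beta> 0 + (\<beta> 1 + l) * x + \<beta> 2 / 2 * x ^ 2 + (\<beta> 3 / 6 - L ^ 3 / 24) * x ^ 3"
      by (simp add: r_def algebra_simps)
    moreover have "(mather_beta l \<gamma> x + x * l) / x ^ 3 - r x / x ^ 3 - L ^ 3 / 24 = (mather_beta l \<gamma> x + x * l - r x - L ^ 3 / 24 * x ^ 3) / x ^ 3"
      using elim by (simp add: diff_divide_distrib)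
    ultimately show ?case by simp
  qed
  ultimately have "((\<lambda>x. (\<beta> 0 + (\<beta> 1 + l) * x + \<beta> 2 / 2 * x ^ 2 + (\<beta> 3 / 6 - L ^ 3 / 24) * x ^ 3) / x ^ 3) \<longlongrightarrow> 0) F"
    using Lim_transform_eventually by fastforce
  from cubic_coefficients_unique(2,4)[OF F id pos this]
  show "\<beta> 1 = - l" "\<beta> 3 = L ^ 3 / 4" by simp_all
qed

section \<open>Hoelder's inequality and its equality case\<close>

lemma constant_curvature_L:
  assumes "\<And>s. \<kappa> s = a"
  shows "L ^ 3 = 4 * pi\<^sup>2 * l"
proof -
  have a: "0 < a" using \<kappa>_pos[of 0] assms by simp
  obtain \<theta> where \<theta>: "\<And>s. (\<theta> has_real_derivative \<kappa> s) (at s)" "\<And>s. \<theta> (s + l) = \<theta> s + 2 * pi"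
    by (rule total_curvature) blast
  have "\<theta> l - \<theta> 0 = (l - 0) * a" using MVT2[OF l_pos, of \<theta> \<kappa>] \<theta>(1) assms by auto
  then have la: "l * a = 2 * pi" using \<theta>(2)[of 0] by simp
  have "L = l * a powr (2/3)" using X_mean_value[OF l_pos] assms by (auto simp: L_def)
  then have "L ^ 3 = l ^ 3 * a\<^sup>2" by (simp add: power_mult_distrib powr_cube[OF a])
  also have "\<dots> = l * (l * a)\<^sup>2" by (simp add: power2_eq_square power3_eq_cube)
  finally show ?thesis by (simp add: la power2_eq_square)
qed

text \<open>
  Hoelder's inequality for \<open>\<integral> \<kappa>\<^bsup>2/3\<^esup>\<close>, by integrating the tangent-line bound
  \<open>3 b \<kappa>\<^bsup>2/3\<^esup> \<le> b\<^sup>3 + 2 \<kappa>\<close>, where \<open>b\<^sup>3\<close> is the mean curvature \<open>2 \<pi> / l\<close>.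
\<close>

lemma L_cube_le: "L ^ 3 \<le> 4 * pi\<^sup>2 * l"
  and L_cube_eq_imp: "L ^ 3 = 4 * pi\<^sup>2 * l \<Longrightarrow> \<kappa> s = 2 * pi / l"
proof -
  obtain \<theta> where \<theta>: "\<And>s. (\<theta> has_real_derivative \<kappa> s) (at s)" "\<And>s. \<theta> (s + l) = \<theta> s + 2 * pi"
    by (rule total_curvature) blast
  define b where "b = (2 * pi / l) powr (1/3)"
  have b: "0 < b" using l_pos by (simp add: b_def)
  have b3: "b ^ 3 = 2 * pi / l" using l_pos by (simp add: b_def powr_power)
  define y where "y s = \<kappa> s powr (1/3)" for s
  have y: "0 < y s" "y s ^ 3 = \<kappa> s" "(y s)\<^sup>2 = \<kappa> s powr (2/3)" for s
    using \<kappa>_pos[of s] by (simp_all add: y_def powr_power)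
  \<comment> \<open>The integrated gap of the tangent-line bound; with \<open>y\<close> the cube
    root of \<kappa>, its derivative is a square times a positive factor.\<close>
  define G where "G s = b ^ 3 * s + 2 * \<theta> s - 3 * b * X s" for s
  have "(G has_real_derivative b ^ 3 * 1 + 2 * \<kappa> s - 3 * b * \<kappa> s powr (2/3)) (at s)" for s
    unfolding G_def by (intro DERIV_diff DERIV_add DERIV_cmult DERIV_ident \<theta>(1) X_deriv)
  moreover have "b ^ 3 * 1 + 2 * \<kappa> s - 3 * b * \<kappa> s powr (2/3) = (y s - b)\<^sup>2 * (2 * y s + b)" for s
  proof -
    have "(y s - b)\<^sup>2 * (2 * y s + b) = b ^ 3 + 2 * y s ^ 3 - 3 * b * (y s)\<^sup>2"
      by (simp add: power2_eq_square power3_eq_cube algebra_simps)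
    then show ?thesis unfolding y(2,3) by simp
  qed
  ultimately have G: "(G has_real_derivative (y s - b)\<^sup>2 * (2 * y s + b)) (at s)" for s by simp
  have mono: "G s \<le> G t" if "s \<le> t" for s t
  proof (rule DERIV_nonneg_imp_nondecreasing[OF that])
    fix x
    have "0 \<le> (y x - b)\<^sup>2 * (2 * y x + b)" using y(1)[of x] b by simp
    then show "\<exists>v. (G has_real_derivative v) (at x) \<and> 0 \<le> v" using G by blast
  qed
  \<comment> \<open>The \<open>6 * pi\<close> is 2 pi from \<open>b ^ 3 * l\<close> and 4 pi from
    twice the total curvature.\<close>
  have per: "G (s + l) = G s + (6 * pi - 3 * b * L)" for s
  proof -
    have "b ^ 3 * l = 2 * pi" using l_pos by (simp add: b3)
    then show ?thesis unfolding G_def \<theta>(2) X_period distrib_left by simp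
  qed
  have "0 \<le> 6 * pi - 3 * b * L" using mono[of 0 "0 + l"] per[of 0] l_pos by simp
  then have bL: "b * L \<le> 2 * pi" by simp
  have cube: "(b * L) ^ 3 = 2 * pi / l * L ^ 3" by (simp add: power_mult_distrib b3)
  have "(b * L) ^ 3 \<le> (2 * pi) ^ 3" using bL b L_pos by (intro power_mono) auto
  then show "L ^ 3 \<le> 4 * pi\<^sup>2 * l"
    unfolding cube using l_pos by (simp add: field_simps power2_eq_square power3_eq_cube)
  assume "L ^ 3 = 4 * pi\<^sup>2 * l"
  then have "(b * L) ^ 3 = (2 * pi) ^ 3"
    unfolding cube using l_pos by (simp add: field_simps power2_eq_square power3_eq_cube)
  then have "b * L = 2 * pi" by (rule power_eq_imp_eq_base) (use b L_pos in auto)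
  \<comment> \<open>In the equality case \<open>G\<close> is nondecreasing and periodic, hence
    constant, and its vanishing derivative forces \<open>y s = b\<close>.\<close>
  then have per0: "G (s + l) = G s" for s using per[of s] by simp
  have le: "G (s + real n * l) = G s" for s n
  proof (induction n)
    case (Suc n) then show ?case using per0[of "s + real n * l"] by (simp add: algebra_simps)
  qed simp
  have const: "G t = G s" if "s \<le> t" for s t
  proof -
    obtain n :: nat where "(t - s) / l < real n" using reals_Archimedean2 by blast
    then have "t \<le> s + real n * l" using l_pos by (simp add: field_simps)
    then show ?thesis using mono[OF that] mono[of t "s + real n * l"] le[of s n] by simp
  qed
  have "G t = G 0" for t using const[of 0 t] const[of t 0] by (cases "0 \<le> t") auto
  then have "G = (\<lambda>t. G 0)" by blast
  then have "(G has_real_derivative 0) (at s)" using DERIV_const by metis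
  then have "(y s - b)\<^sup>2 * (2 * y s + b) = 0" using G DERIV_unique by blast
  then have "y s = b" using y(1)[of s] b by simp
  then show "\<kappa> s = 2 * pi / l" using y(2)[of s] b3 by simp
qed

end

theorem corollary1:
  fixes \<Omega> :: "(real^2) set" and l :: real and \<gamma> :: "real \<Rightarrow> real^2" and \<beta> :: "nat \<Rightarrow> real"
  assumes "billiard_table \<Omega> l \<gamma>"
    and "formal_taylor_expansion (caustic_rotation_numbers \<Omega> l \<gamma>) (mather_beta l \<gamma>) \<beta>"
  shows "\<beta> 3 + pi\<^sup>2 * \<beta> 1 \<le> 0 \<and>
         (\<beta> 3 + pi\<^sup>2 * \<beta> 1 = 0 \<longleftrightarrow> (\<exists>z r. r > 0 \<and> \<Omega> = ball z r))"
proof -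
  interpret billiard \<Omega> l \<gamma> using assms(1) by unfold_locales
  have "continuous_on UNIV (\<lambda>s. \<kappa> s powr (2/3))"
    using \<kappa>_pos by (intro continuous_intros \<kappa>_continuous) (simp add: less_imp_neq[symmetric])
  then obtain X where "\<And>s. (X has_real_derivative \<kappa> s powr (2/3)) (at s)"
    by (rule antiderivative_exists) blast
  then interpret lazutkin \<Omega> l \<gamma> X by unfold_locales
  have *: "\<beta> 3 + pi\<^sup>2 * \<beta> 1 = (L ^ 3 - 4 * pi\<^sup>2 * l) / 4"
    using formal_coefficients[OF assms(2)] by simp
  have "L ^ 3 = 4 * pi\<^sup>2 * l \<longleftrightarrow> (\<exists>z r. r > 0 \<and> \<Omega> = ball z r)"
  proof
    assume "L ^ 3 = 4 * pi\<^sup>2 * l"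
    then obtain z where "\<Omega> = ball z (1 / (2 * pi / l))"
      using constant_curvature_imp_ball[of "2 * pi / l"] L_cube_eq_imp by metis
    then show "\<exists>z r. r > 0 \<and> \<Omega> = ball z r" using l_pos by (intro exI[of _ z] exI[of _ "1 / (2 * pi / l)"]) simp
  next
    assume "\<exists>z r. r > 0 \<and> \<Omega> = ball z r"
    then obtain z r where zr: "0 < r" "\<Omega> = ball z r" by blast
    then show "L ^ 3 = 4 * pi\<^sup>2 * l"
      using ball_imp_constant_curvature constant_curvature_L by metis
  qed
  then show ?thesis unfolding * using L_cube_le by auto
qed

end
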